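(* Let $\varphi^{\mathfrak H}=Q(\pi_1-\pi_1^\perp)\cdots(\pi_r-\pi_r^\perp):S^2\to U(n)$ be a harmonic map of uniton number $r$ corresponding to an array $\mathfrak H$ (in echelon form). For $t\in\,]0,1]$ let $\varphi_t$ be the one-parameter family of harmonic maps obtained by following the flow line of $\nabla E$ starting at $\varphi^{\mathfrak H}$, i.e. $\varphi_t=Q\,\Phi_t(-1)$, where $\Phi_t=(t\,\Phi^{\mathfrak H})_u$ is the unitary Iwasawa factor of the loop $(t\,\Phi^{\mathfrak H})(\lambda)=\Phi^{\mathfrak H}(\lambda t)\,\Phi^{\mathfrak H}(t)^{-1}$. Then for every $t\in\,]0,1]$ the harmonic map $\varphi_t$ is the one associated to the array $\mathfrak H(t)$; that is, $\Phi_t=\Phi^{\mathfrak H(t)}$ and $\varphi_t=\varphi^{\mathfrak H(t)}$, where the constant left factor $Q$ is kept fixed.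
   Context: Arrays. An array $\mathfrak H=(H_{i,j})_{0\le i\le r-1,\,1\le j\le J}$ ($J\le n$) consists of $\mathbb C^n$-valued meromorphic functions on $S^2$. It is in echelon form if there are integers $0=d_0\le d_1\le d_2\le\dots\le d_r\le n$ such that $H_{i,j}=0$ whenever $j>d_{i+1}$ and, for each $i=1,\dots,r$, the sub-array made up of the first $i$ rows and the first $d_i$ columns has linearly independent columns; equivalently, for each $i$ the vectors $H_{i,d_i+1},\dots,H_{i,d_{i+1}}$ are linearly independent (over the meromorphic functions). All arrays representing a harmonic map are assumed to be in echelon form. Harmonic map of an array. For $\mathfrak H$ define recursively subbundles $\underline\alpha_1,\dots,\underline\alpha_r$ of the trivial bundle $\underline{\mathbb C}^n=S^2\times\mathbb C^n$: for $i=0,\dots,r-1$, $\underline\alpha_{i+1}$ is the subbundle spanned (off a discrete set, then extended) by $\alpha^{(k)}_{i+1,j}=\sum_{s=k}^{i}C^i_sH^{(k)}_{s-k,j}$, $1\le j\le J$, $0\le k\le i$. Here $H^{(k)}$ is the $k$-th derivative with respect to a local complex coordinate, $\pi_i,\pi_i^\perp$ are the orthogonal projections onto $\underline\alpha_i,\underline\alpha_i^\perp$, and $C^i_s=\sum_{1\le i_1<\dots<i_s\le i}\pi_{i_s}^\perp\cdots\pi_{i_1}^\perp$ with $C^i_0=\mathrm{Id}$. For $Q\in U(n)$ constant, $\varphi^{\mathfrak H}=Q(\pi_1-\pi_1^\perp)\cdots(\pi_r-\pi_r^\perp)$ is a harmonic map $S^2\to U(n)$, and $\Phi^{\mathfrak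 H}(\lambda)=(\pi_1+\lambda\pi_1^\perp)\cdots(\pi_r+\lambda\pi_r^\perp)$ is its associated extended solution (up to left multiplication by a constant), satisfying $\Phi^{\mathfrak H}(1)=\mathrm{Id}$ and $Q\Phi^{\mathfrak H}(-1)=\varphi^{\mathfrak H}$. In general, an extended solution is a family $\phi_\lambda:S^2\to U(n)$, smooth in $\lambda\in S^1$, with $\phi_1=\mathrm{Id}$ and $\phi_\lambda^{-1}d\phi_\lambda=(1-\lambda^{-1})A_z+(1-\lambda)A_{\bar z}$, where $A_z,A_{\bar z}$ are the $(1,0)$ and $(0,1)$ parts of $A=\frac12\varphi^{-1}d\varphi$; up to left multiplication by a constant, $\phi_{-1}=\varphi$. The uniton number of $\varphi$ is the least $k\in\mathbb N$ such that, for an extended solution $\phi$ of $\varphi$ and some loop $\gamma\in\Omega(U(n))$ (constant on $S^2$), $\gamma\phi$ is of the form $\sum_{i=0}^k\lambda^iA_i$. Deformed array. For $t\in\,]0,1]$, $\mathfrak H(t)=(H_{i,j}(t))$, where for $d_k+1\le j\le d_{k+1}$ (with $0\le k\le r-1$), $H_{i,j}(t)=\sum_{s=0}^i\binom is t^{s-k}(t-1)^{i-s}H_{s,j}$ (and $H_{i,j}(t)=0$ for $j>d_r$). $\varphi^{\mathfrak H(t)}$ and $\Phi^{\mathfrak H(t)}$ are built from $\mathfrak H(t)$ by the construction above, with the same $Q$. Flow. $\Omega(U(n))$ is the group of based loops $\gamma:S^1\to U(n)$, $\gamma(1)=\mathrm{Id}$; $\Lambda Gl(\mathbb C^n)$ is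 the group of smooth loops in $Gl(\mathbb C^n)$; $\Lambda_+$ is its subgroup of loops $\gamma$ such that both $\gamma$ and $\gamma^{-1}$ have Fourier series with only non-negative powers of $\lambda$. By the Iwasawa decomposition each $\gamma\in\Lambda Gl(\mathbb C^n)$ is uniquely $\gamma=\gamma_u\gamma_+$ with $\gamma_u\in\Omega(U(n))$, $\gamma_+\in\Lambda_+$. The flow line of $\nabla E$ of the energy $E(\gamma)=\int_{S^1}\|\gamma'\|^2$ on algebraic loops starting at $\gamma$ is given by the action $t\mapsto(t\gamma)_u$, $(t\gamma)(\lambda)=\gamma(\lambda t)\gamma(t)^{-1}$, $t\in\,]0,1]$; it is applied pointwise on $S^2$ to $\Phi^{\mathfrak H}$. *)

theory Defs
  imports "HOL-Analysis.Analysis" "HOL-Complex_Analysis.Complex_Analysis"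
begin

section \<open>Unitary matrices and orthogonal projections\<close>

text \<open>The scalar multiple of a matrix \<open>A\<close> by \<open>c\<close> is written \<open>mat c ** A\<close> throughout, and
  linear spans over the complex numbers are \<open>vec.span\<close> (not the real \<open>span\<close>).\<close>

definition adj :: "complex^'n^'n \<Rightarrow> complex^'n^'n" where
  "adj A = (\<chi> i j. cnj (A $ j $ i))"

definition unitary_group :: "(complex^'n^'n) set" where
  "unitary_group = {A. A ** adj A = mat 1 \<and> adj A ** A = mat 1}"

definition orth_proj :: "(complex^'n) set \<Rightarrow> complex^'n^'n" where
  "orth_proj V = (THE P. P ** P = P \<and> adj P = P \<and> range (\<lambda>v. P *v v) = V)"

definition mprod :: "(complex^'n^'n) list \<Rightarrow> complex^'n^'n" where
  "mprod Ps = foldr (**) Ps (mat 1)"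


section \<open>The Riemann sphere\<close>

text \<open>\<open>S\<^sup>2\<close> is the one-point compactification of \<open>\<complex>\<close>: \<open>None\<close> is the point at infinity, and the two
  charts are \<open>z \<mapsto> Some z\<close> and \<open>w \<mapsto> 1/w\<close> (with \<open>0\<close> sent to infinity).\<close>

type_synonym rsphere = "complex option"

definition chart_inf :: "complex \<Rightarrow> rsphere" where
  "chart_inf w = (if w = 0 then None else Some (1 / w))"

text \<open>A meromorphic function on \<open>S\<^sup>2\<close> is represented by its restriction to \<open>\<complex>\<close>, with arbitrary
  values at the poles. Hence identities between meromorphic functions are required off a discrete
  set only.\<close>

definition mero_sphere :: "(complex \<Rightarrow> complex) \<Rightarrow> bool" where
  "mero_sphere f \<longleftrightarrow> f meromorphic_on UNIV \<and> (\<lambda>w. f (1 / w)) meromorphic_on {0}"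

definition mero_sphere_vec :: "(complex \<Rightarrow> complex^'n) \<Rightarrow> bool" where
  "mero_sphere_vec f \<longleftrightarrow> (\<forall>l. mero_sphere (\<lambda>z. f z $ l))"

definition vderiv :: "nat \<Rightarrow> (complex \<Rightarrow> complex^'n) \<Rightarrow> complex \<Rightarrow> complex^'n" where
  "vderiv k f z = (\<chi> l. (deriv ^^ k) (\<lambda>w. f w $ l) z)"

text \<open>Continuous extension to all of \<open>S\<^sup>2\<close> of a map given off a discrete set.\<close>

definition extend_sphere :: "(complex \<Rightarrow> complex^'n^'n) \<Rightarrow> rsphere \<Rightarrow> complex^'n^'n" where
  "extend_sphere f p = (case p of Some z \<Rightarrow> Lim (at z) f | None \<Rightarrow> Lim at_infinity f)"


section \<open>Arrays\<close>

text \<open>\<open>H i j\<close> is the entry in row \<open>i \<in> {0..<r}\<close> and column \<open>j \<in> {1..J}\<close>; values of \<open>H\<close> at other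
  indices are never used.\<close>

type_synonym 'n array = "nat \<Rightarrow> nat \<Rightarrow> complex \<Rightarrow> complex^'n"

definition is_array :: "nat \<Rightarrow> nat \<Rightarrow> 'n::finite array \<Rightarrow> bool" where
  "is_array r J H \<longleftrightarrow> J \<le> CARD('n) \<and> (\<forall>i<r. \<forall>j\<in>{1..J}. mero_sphere_vec (H i j))"

text \<open>Linear independence, over the field of meromorphic functions on \<open>S\<^sup>2\<close>, of the columns of the
  sub-array made up of the first \<open>i\<close> rows and the first \<open>m\<close> columns.\<close>

definition indep_columns :: "'n::finite array \<Rightarrow> nat \<Rightarrow> nat \<Rightarrow> bool" where
  "indep_columns H i m \<longleftrightarrow>
     (\<forall>c :: nat \<Rightarrow> complex \<Rightarrow> complex.
        (\<forall>j\<in>{1..m}. mero_sphere (c j)) \<and>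
        (\<forall>l<i. \<forall>\<^sub>\<approx>z\<in>UNIV. (\<Sum>j=1..m. c j z *s H l j z) = 0)
        \<longrightarrow> (\<forall>j\<in>{1..m}. \<forall>\<^sub>\<approx>z\<in>UNIV. c j z = 0))"

definition echelon :: "nat \<Rightarrow> nat \<Rightarrow> (nat \<Rightarrow> nat) \<Rightarrow> 'n::finite array \<Rightarrow> bool" where
  "echelon r J d H \<longleftrightarrow>
     d 0 = 0 \<and> (\<forall>i<r. d i \<le> d (Suc i)) \<and> d r \<le> J \<and>
     (\<forall>i<r. \<forall>j\<in>{1..J}. d (Suc i) < j \<longrightarrow> (\<forall>\<^sub>\<approx>z\<in>UNIV. H i j z = 0)) \<and>
     (\<forall>i\<in>{1..r}. indep_columns H i (d i))"


section \<open>The maps associated with an array\<close>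

text \<open>\<open>C\<^sup>i\<^sub>s\<close>: a chain \<open>1 \<le> i\<^sub>1 < \<dots> < i\<^sub>s \<le> i\<close> is the set \<open>I = {i\<^sub>1, \<dots>, i\<^sub>s}\<close>, and the factors are
  multiplied with indices decreasing from left to right.\<close>

definition Cmat :: "(nat \<Rightarrow> complex^'n^'n) \<Rightarrow> nat \<Rightarrow> nat \<Rightarrow> complex^'n^'n" where
  "Cmat P i s = (\<Sum>I \<in> {I. I \<subseteq> {1..i} \<and> card I = s}.
                   mprod (map (\<lambda>m. mat 1 - P m) (rev (sorted_list_of_set I))))"

text \<open>\<open>alpha P H i k j\<close> is the section \<open>\<alpha>\<^sup>(\<^sup>k\<^sup>)\<close> with index \<open>i + 1, j\<close>, where \<open>P m\<close> is the value at the point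
  \<open>z\<close> of the projection onto the \<open>m\<close>-th bundle. Derivatives are taken in the affine coordinate
  \<open>z\<close>; infinity belongs to the discrete set off which the spanning condition is not imposed.\<close>

definition alpha ::
  "(nat \<Rightarrow> complex^'n^'n) \<Rightarrow> 'n::finite array \<Rightarrow> nat \<Rightarrow> nat \<Rightarrow> nat \<Rightarrow> complex \<Rightarrow> complex^'n" where
  "alpha P H i k j z = (\<Sum>s=k..i. Cmat P i s *v vderiv k (H (s - k) j) z)"

text \<open>Course-of-values recursion: \<open>projs J H i m\<close> is \<open>\<pi>\<^sub>m\<close> for \<open>1 \<le> m \<le> i\<close> (and junk for other \<open>m\<close>).\<close>

primrec projs :: "nat \<Rightarrow> 'n::finite array \<Rightarrow> nat \<Rightarrow> nat \<Rightarrow> rsphere \<Rightarrow> complex^'n^'n" where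
  "projs J H 0 = (\<lambda>m p. mat 1)"
| "projs J H (Suc i) = (projs J H i)(Suc i :=
     extend_sphere (\<lambda>z. orth_proj (vec.span
       {alpha (\<lambda>m. projs J H i m (Some z)) H i k j z | k j. k \<le> i \<and> j \<in> {1..J}})))"

definition bundle_proj :: "nat \<Rightarrow> 'n::finite array \<Rightarrow> nat \<Rightarrow> rsphere \<Rightarrow> complex^'n^'n" where
  "bundle_proj J H i = projs J H i i"

definition Phi_array ::
  "nat \<Rightarrow> nat \<Rightarrow> 'n::finite array \<Rightarrow> complex \<Rightarrow> rsphere \<Rightarrow> complex^'n^'n" where
  "Phi_array r J H \<zeta> p =
     mprod (map (\<lambda>i. bundle_proj J H i p + mat \<zeta> ** (mat 1 - bundle_proj J H i p)) [1..<Suc r])"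

definition phi_array ::
  "complex^'n^'n \<Rightarrow> nat \<Rightarrow> nat \<Rightarrow> 'n::finite array \<Rightarrow> rsphere \<Rightarrow> complex^'n^'n" where
  "phi_array Q r J H p =
     Q ** mprod (map (\<lambda>i. bundle_proj J H i p - (mat 1 - bundle_proj J H i p)) [1..<Suc r])"

text \<open>The deformed array. The exponent \<open>s - k\<close> may be negative. Columns \<open>j > d\<^sub>r\<close> are zero.\<close>

definition deform ::
  "(nat \<Rightarrow> nat) \<Rightarrow> nat \<Rightarrow> real \<Rightarrow> 'n::finite array \<Rightarrow> 'n array" where
  "deform d r t H i j z =
     (if 1 \<le> j \<and> j \<le> d r then
        let k = (THE k. k < r \<and> d k + 1 \<le> j \<and> j \<le> d (Suc k)) in
        \<Sum>s=0..i. (of_nat (i choose s) * of_real t powi (int s - int k) *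
                    (of_real t - 1) ^ (i - s)) *s H s j z
      else 0)"


section \<open>Harmonic maps, extended solutions, uniton number\<close>

primrec C_order :: "nat \<Rightarrow> ('a::real_normed_vector \<Rightarrow> 'b::real_normed_vector) \<Rightarrow> bool" where
  "C_order 0 f \<longleftrightarrow> continuous_on UNIV f"
| "C_order (Suc k) f \<longleftrightarrow>
     f differentiable_on UNIV \<and> (\<forall>v. C_order k (\<lambda>x. frechet_derivative f (at x) v))"

definition C_infinity :: "('a::real_normed_vector \<Rightarrow> 'b::real_normed_vector) \<Rightarrow> bool" where
  "C_infinity f \<longleftrightarrow> (\<forall>k. C_order k f)"

definition smooth_sphere :: "(rsphere \<Rightarrow> complex^'n^'n) \<Rightarrow> bool" where
  "smooth_sphere F \<longleftrightarrow> C_infinity (\<lambda>z. F (Some z)) \<and> C_infinity (\<lambda>w. F (chart_inf w))"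

definition d_z :: "(complex \<Rightarrow> complex^'n^'n) \<Rightarrow> complex \<Rightarrow> complex^'n^'n" where
  "d_z f z = mat (1/2) ** (frechet_derivative f (at z) 1 - mat \<i> ** frechet_derivative f (at z) \<i>)"

definition d_zbar :: "(complex \<Rightarrow> complex^'n^'n) \<Rightarrow> complex \<Rightarrow> complex^'n^'n" where
  "d_zbar f z = mat (1/2) ** (frechet_derivative f (at z) 1 + mat \<i> ** frechet_derivative f (at z) \<i>)"

text \<open>The components of \<open>A = \<onehalf> \<phi>\<^sup>-\<^sup>1 d\<phi>\<close> in a chart.\<close>

definition A_z :: "(complex \<Rightarrow> complex^'n^'n) \<Rightarrow> complex \<Rightarrow> complex^'n^'n" where
  "A_z f z = mat (1/2) ** (matrix_inv (f z) ** d_z f z)"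

definition A_zbar :: "(complex \<Rightarrow> complex^'n^'n) \<Rightarrow> complex \<Rightarrow> complex^'n^'n" where
  "A_zbar f z = mat (1/2) ** (matrix_inv (f z) ** d_zbar f z)"

text \<open>The harmonic map equation \<open>d*A = 0\<close> in a conformal chart.\<close>

definition harmonic_chart :: "(complex \<Rightarrow> complex^'n^'n) \<Rightarrow> bool" where
  "harmonic_chart f \<longleftrightarrow> (\<forall>z. d_zbar (A_z f) z + d_z (A_zbar f) z = 0)"

definition harmonic_map :: "(rsphere \<Rightarrow> complex^'n^'n) \<Rightarrow> bool" where
  "harmonic_map \<phi> \<longleftrightarrow> range \<phi> \<subseteq> unitary_group \<and> smooth_sphere \<phi> \<and>
     harmonic_chart (\<lambda>z. \<phi> (Some z)) \<and> harmonic_chart (\<lambda>w. \<phi> (chart_inf w))"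

definition smooth_loop :: "(complex \<Rightarrow> complex^'n^'n) \<Rightarrow> bool" where
  "smooth_loop \<gamma> \<longleftrightarrow> C_infinity (\<lambda>\<theta>::real. \<gamma> (cis \<theta>))"

definition ext_sol_chart ::
  "(complex \<Rightarrow> complex^'n^'n) \<Rightarrow> (complex \<Rightarrow> complex \<Rightarrow> complex^'n^'n) \<Rightarrow> bool" where
  "ext_sol_chart f F \<longleftrightarrow> (\<forall>\<zeta>\<in>sphere 0 1. \<forall>z.
     matrix_inv (F \<zeta> z) ** d_z (F \<zeta>) z = mat (1 - inverse \<zeta>) ** A_z f z \<and>
     matrix_inv (F \<zeta> z) ** d_zbar (F \<zeta>) z = mat (1 - \<zeta>) ** A_zbar f z)"

text \<open>\<open>\<Phi>\<close> is an extended solution of \<open>\<phi>\<close>. At \<open>\<zeta> = -1\<close> the equation says that \<open>\<Phi>\<^sub>-\<^sub>1\<close> and \<open>\<phi>\<close> have the same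
  Maurer-Cartan form, so they agree up to left multiplication by a constant.\<close>

definition extended_solution ::
  "(rsphere \<Rightarrow> complex^'n^'n) \<Rightarrow> (complex \<Rightarrow> rsphere \<Rightarrow> complex^'n^'n) \<Rightarrow> bool" where
  "extended_solution \<phi> \<Phi> \<longleftrightarrow>
     (\<forall>\<zeta>\<in>sphere 0 1. range (\<Phi> \<zeta>) \<subseteq> unitary_group \<and> smooth_sphere (\<Phi> \<zeta>)) \<and>
     (\<forall>p. smooth_loop (\<lambda>\<zeta>. \<Phi> \<zeta> p)) \<and>
     (\<forall>p. \<Phi> 1 p = mat 1) \<and>
     ext_sol_chart (\<lambda>z. \<phi> (Some z)) (\<lambda>\<zeta> z. \<Phi> \<zeta> (Some z)) \<and>
     ext_sol_chart (\<lambda>w. \<phi> (chart_inf w)) (\<lambda>\<zeta> w. \<Phi> \<zeta> (chart_inf w))"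

text \<open>Loops are functions on \<open>\<complex>\<close> of which only the values on the unit circle matter.\<close>

definition based_loops :: "(complex \<Rightarrow> complex^'n^'n) set" where
  "based_loops = {\<gamma>. smooth_loop \<gamma> \<and> \<gamma> ` sphere 0 1 \<subseteq> unitary_group \<and> \<gamma> 1 = mat 1}"

definition unitons_le :: "(rsphere \<Rightarrow> complex^'n^'n) \<Rightarrow> nat \<Rightarrow> bool" where
  "unitons_le \<phi> k \<longleftrightarrow> (\<exists>\<Phi> \<gamma> A. extended_solution \<phi> \<Phi> \<and> \<gamma> \<in> based_loops \<and>
     (\<forall>\<zeta>\<in>sphere 0 1. \<forall>p::rsphere. \<gamma> \<zeta> ** \<Phi> \<zeta> p = (\<Sum>i=0..k. mat (\<zeta> ^ i) ** A i p)))"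

definition has_uniton_number :: "(rsphere \<Rightarrow> complex^'n^'n) \<Rightarrow> nat \<Rightarrow> bool" where
  "has_uniton_number \<phi> k \<longleftrightarrow> unitons_le \<phi> k \<and> (\<forall>m<k. \<not> unitons_le \<phi> m)"


section \<open>Iwasawa decomposition and the flow\<close>

definition loops_GL :: "(complex \<Rightarrow> complex^'n^'n) set" where
  "loops_GL = {\<gamma>. smooth_loop \<gamma> \<and> (\<forall>\<zeta>\<in>sphere 0 1. invertible (\<gamma> \<zeta>))}"

definition fourier_coeff :: "(complex \<Rightarrow> complex^'n^'n) \<Rightarrow> int \<Rightarrow> complex^'n^'n" where
  "fourier_coeff \<gamma> m =
     (\<chi> i j. integral {0..2*pi} (\<lambda>\<theta>. \<gamma> (cis \<theta>) $ i $ j * cis (- of_int m * \<theta>)) / (2 * pi))"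

definition loops_plus :: "(complex \<Rightarrow> complex^'n^'n) set" where
  "loops_plus = {\<gamma> \<in> loops_GL. \<forall>m<0. fourier_coeff \<gamma> m = 0 \<and>
                                      fourier_coeff (\<lambda>\<zeta>. matrix_inv (\<gamma> \<zeta>)) m = 0}"

text \<open>The unitary Iwasawa factor. It is unique as a function on the unit circle, and a representative
  on \<open>\<complex>\<close> is chosen.\<close>

definition iwasawa_u :: "(complex \<Rightarrow> complex^'n^'n) \<Rightarrow> complex \<Rightarrow> complex^'n^'n" where
  "iwasawa_u \<gamma> = (SOME \<gamma>\<^sub>u. \<gamma>\<^sub>u \<in> based_loops \<and>
     (\<exists>\<delta>\<in>loops_plus. \<forall>\<zeta>\<in>sphere 0 1. \<gamma> \<zeta> = \<gamma>\<^sub>u \<zeta> ** \<delta> \<zeta>))"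

text \<open>The action of \<open>t\<close> on a loop that extends to nonzero \<open>\<lambda>\<close>, here a polynomial one.\<close>

definition act :: "real \<Rightarrow> (complex \<Rightarrow> complex^'n^'n) \<Rightarrow> complex \<Rightarrow> complex^'n^'n" where
  "act t \<gamma> \<zeta> = \<gamma> (\<zeta> * of_real t) ** matrix_inv (\<gamma> (of_real t))"

definition flow ::
  "real \<Rightarrow> (complex \<Rightarrow> rsphere \<Rightarrow> complex^'n^'n) \<Rightarrow> complex \<Rightarrow> rsphere \<Rightarrow> complex^'n^'n" where
  "flow t \<Phi> \<zeta> p = iwasawa_u (act t (\<lambda>\<mu>. \<Phi> \<mu> p)) \<zeta>"

end

theory Submission
  imports Defs
begin

text \<open>At a generic point of the sphere put \<open>\<Phi>\<^sub>i(\<lambda>) = \<Prod>\<^bsub>m\<le>i\<^esub> (\<pi>\<^sub>m + \<lambda> \<pi>\<^sub>m\<^sup>\<bottom>)\<close> and \<open>y = \<lambda> / (1 - \<lambda>)\<close>.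
  Since \<open>\<Phi>\<^sub>i\<close> has inverse \<open>\<Sum>\<^sub>s C\<^sup>i\<^sub>s / y\<^sup>s\<close>, the sections spanning the bundle of index \<open>i + 1\<close> are the values at
  \<open>\<lambda> = 0\<close> of the series \<open>y\<^sup>k \<Sum>\<^sub>l y\<^sup>l H\<^sub>l\<^sub>,\<^sub>j\<close> (with \<open>k\<close>-th derivatives of the entries) multiplied by the
  inverse of \<open>\<Phi>\<^sub>i\<close>. Hence these series, together with all multiples of \<open>y\<^sup>r\<close>, generate \<open>\<Phi>\<^sub>r H\<^sub>+\<close> as a module over
  the power series in \<open>y\<close>. The substitution \<open>\<lambda> \<mapsto> t \<lambda>\<close> turns the generators of \<open>H\<close> into unit
  multiples of the generators of \<open>H(t)\<close>, so the quotient of the loop of \<open>H\<close> at \<open>t \<lambda>\<close> by the loop of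
  \<open>H(t)\<close> at \<open>\<lambda>\<close> and its inverse are polynomials in \<open>\<lambda>\<close>, and uniqueness of the Iwasawa factor applies.

  To reach the exceptional points one needs the bundles to extend continuously. The vector \<open>\<pi>\<^bsub>i+1\<^esub> v\<close>
  is the value at \<open>\<lambda> = 1\<close> of the orthogonal projection of \<open>\<Phi>\<^sub>i v\<close> onto the polynomials of degree at
  most \<open>i\<close> in \<open>\<Phi>\<^bsub>i+1\<^esub> H\<^sub>+\<close>, because \<open>\<Phi>\<^sub>i\<close> is unitary on the circle. That space is spanned by meromorphic
  vectors, and such spans extend over the poles.\<close>

text \<open>The coordinate y is chosen because P + \<lambda> (1 - P) then has the inverse 1 + (1 -
  P) / y, whose products expand without further constants. In this coordinate \<lambda> \<mapsto> t
  \<lambda> becomes y \<mapsto> t y / (1 + (1 - t) y), and expanding its powers produces the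
  binomial coefficients and the powers of t - 1 in the deformed array; the power of t attached to a
  column is a nonzero scalar and does not change spans.

  The bundles are defined by limits, so nothing is known about their values until the limits exist.
  The spanning sections contain orthogonal projections onto earlier bundles; they are not
  meromorphic, and their span cannot be extended by clearing poles. The generators of the module
  involve only derivatives of the array, at the price of working with vector polynomials in
  \<lambda>. Finite sums over roots of unity replace integrals there, and they also recover the
  coefficients of a polynomial from its values, so that a polynomial quotient of two loops stays
  polynomial in the limit. The inverse quotient is obtained from the same argument with 1 / t in
  place of t.\<close>

no_notation fps_nth (infixl "$" 75)

section \<open>Algebra at a single generic point\<close>

section \<open>Projection factors acting on power series\<close>

text \<open>A sequence \<open>g\<close> stands for the power series \<open>\<Sum>\<^sub>q y\<^sup>q g\<^sub>q\<close> in \<open>y = \<lambda> / (1 - \<lambda>)\<close>. Then \<open>N_step\<close> is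
  multiplication by the inverse of \<open>P + \<lambda> (1 - P)\<close> with the power \<open>1 / y\<close> dropped, and \<open>S_step\<close> is multiplication by
  \<open>(1 + y) (P + \<lambda> (1 - P)) = y + P\<close>. The predicate \<open>divisible\<close> says that nothing is dropped on the
  way, that is, \<open>g\<close> lies in \<open>\<Phi> H\<^sub>+\<close>. Finally \<open>bernstein M g\<close> is the polynomial
  \<open>(1 - \<lambda>)\<^sup>M \<Sum>\<^bsub>q\<le>M\<^esub> y\<^sup>q g\<^sub>q\<close>.\<close>

definition shift :: "(nat \<Rightarrow> complex^'n) \<Rightarrow> nat \<Rightarrow> complex^'n" where
  "shift g q = (if q = 0 then 0 else g (q - 1))"

definition N_step :: "complex^'n^'n \<Rightarrow> (nat \<Rightarrow> complex^'n) \<Rightarrow> nat \<Rightarrow> complex^'n" where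
  "N_step P g q = g q + (mat 1 - P) *v g (Suc q)"

definition S_step :: "complex^'n^'n \<Rightarrow> (nat \<Rightarrow> complex^'n) \<Rightarrow> nat \<Rightarrow> complex^'n" where
  "S_step P g q = shift g q + P *v g q"

primrec T_op :: "(complex^'n^'n) list \<Rightarrow> (nat \<Rightarrow> complex^'n) \<Rightarrow> nat \<Rightarrow> complex^'n" where
  "T_op [] g = g"
| "T_op (P # Ps) g = T_op Ps (N_step P g)"

primrec S_op :: "(complex^'n^'n) list \<Rightarrow> (nat \<Rightarrow> complex^'n) \<Rightarrow> nat \<Rightarrow> complex^'n" where
  "S_op [] g = g"
| "S_op (P # Ps) g = S_step P (S_op Ps g)"

primrec divisible :: "(complex^'n^'n) list \<Rightarrow> (nat \<Rightarrow> complex^'n) \<Rightarrow> bool" where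
  "divisible [] g \<longleftrightarrow> True"
| "divisible (P # Ps) g \<longleftrightarrow> P *v g 0 = g 0 \<and> divisible Ps (N_step P g)"

primrec Phi :: "(complex^'n^'n) list \<Rightarrow> complex \<Rightarrow> complex^'n^'n" where
  "Phi [] x = mat 1"
| "Phi (P # Ps) x = (P + mat x ** (mat 1 - P)) ** Phi Ps x"

definition bernstein :: "nat \<Rightarrow> (nat \<Rightarrow> complex^'n) \<Rightarrow> complex \<Rightarrow> complex^'n" where
  "bernstein M g x = (\<Sum>q\<le>M. (x ^ q * (1 - x) ^ (M - q)) *s g q)"

definition series_add :: "(nat \<Rightarrow> complex^'n) \<Rightarrow> (nat \<Rightarrow> complex^'n) \<Rightarrow> nat \<Rightarrow> complex^'n" where
  "series_add g h q = g q + h q"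

definition series_scale :: "complex \<Rightarrow> (nat \<Rightarrow> complex^'n) \<Rightarrow> nat \<Rightarrow> complex^'n" where
  "series_scale c g q = c *s g q"

lemma mat_mult_left: "mat c ** A = (\<chi> i. c *s (A $ i))" for A :: "complex^'n^'m"
proof -
  have "(\<Sum>k\<in>UNIV. (if i = k then c else 0) * A $ k $ j) = c * A $ i $ j" for i j
  proof -
    have "(\<Sum>k\<in>UNIV. (if i = k then c else 0) * A $ k $ j) = (\<Sum>k\<in>UNIV. if i = k then c * A $ k $ j else 0)"
      by (rule sum.cong) auto
    then show ?thesis by simp
  qed
  then show ?thesis
    by (simp add: matrix_matrix_mult_def mat_def vec_eq_iff)
qed

lemma mat_vector_mult: "mat c *v v = c *s v" for v :: "complex^'n"
proof -
  have "(\<Sum>k\<in>UNIV. (if i = k then c else 0) * v $ k) = c * v $ i" for i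
  proof -
    have "(\<Sum>k\<in>UNIV. (if i = k then c else 0) * v $ k) = (\<Sum>k\<in>UNIV. if i = k then c * v $ k else 0)"
      by (rule sum.cong) auto
    then show ?thesis by simp
  qed
  then show ?thesis
    by (simp add: matrix_vector_mult_def mat_def vec_eq_iff)
qed

lemma mat_mult_vector: "(mat c ** A) *v v = c *s (A *v v)" for A :: "complex^'n^'n"
  by (simp add: matrix_vector_mul_assoc[symmetric] mat_vector_mult)

lemma mult_vec_scale: "A *v (c *s v) = c *s (A *v v)" for A :: "complex^'n^'m"
  by (simp add: vec_eq_iff matrix_vector_mult_def sum_distrib_left mult_ac)

lemma mult_vec_sum: "A *v (\<Sum>x\<in>X. f x) = (\<Sum>x\<in>X. A *v f x)" for A :: "complex^'n^'m"
  by (induction X rule: infinite_finite_induct) (simp_all add: matrix_vector_right_distrib)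

lemmas mv_simps = matrix_vector_right_distrib matrix_vector_mult_diff_distrib
  matrix_vector_mult_diff_rdistrib matrix_vector_mult_add_rdistrib mat_mult_vector mult_vec_scale
  matrix_vector_mul_lid vector_add_ldistrib vector_sadd_rdistrib vector_ssub_ldistrib vector_smult_assoc

lemma N_step_series_add: "N_step P (series_add g h) = series_add (N_step P g) (N_step P h)"
  by (rule ext) (simp add: N_step_def series_add_def mv_simps algebra_simps)

lemma N_step_series_scale: "N_step P (series_scale c g) = series_scale c (N_step P g)"
  by (rule ext) (simp add: N_step_def series_scale_def mv_simps algebra_simps)

lemma T_op_series_add: "T_op Ps (series_add g h) = series_add (T_op Ps g) (T_op Ps h)"
  by (induction Ps arbitrary: g h) (auto simp: N_step_series_add)

lemma T_op_series_scale: "T_op Ps (series_scale c g) = series_scale c (T_op Ps g)"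
  by (induction Ps arbitrary: g) (auto simp: N_step_series_scale)

lemma divisible_series_add: "divisible Ps g \<Longrightarrow> divisible Ps h \<Longrightarrow> divisible Ps (series_add g h)"
  by (induction Ps arbitrary: g h) (auto simp: N_step_series_add, simp add: series_add_def mv_simps)

lemma divisible_series_scale: "divisible Ps g \<Longrightarrow> divisible Ps (series_scale c g)"
  by (induction Ps arbitrary: g) (auto simp: N_step_series_scale, simp add: series_scale_def mv_simps)

text \<open>\<open>N_step\<close> discards the coefficient of 1 / y, which after multiplication by y
  would reappear in degree 0. The hypothesis says that this coefficient is zero.\<close>

lemma N_step_shift: "P *v g 0 = g 0 \<Longrightarrow> N_step P (shift g) = shift (N_step P g)"
  by (rule ext) (auto simp add: N_step_def shift_def mv_simps algebra_simps)

lemma divisible_shift: "divisible Ps g \<Longrightarrow> divisible Ps (shift g) \<and> T_op Ps (shift g) = shift (T_op Ps g)"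
  by (induction Ps arbitrary: g) (auto simp: N_step_shift, simp add: shift_def)

text \<open>Each inverse factor has a pole of order at most one in y, so a zero of order n =
  \<open>length Ps\<close> outlasts them all: y^n times any series lies in \<Phi> H_+.\<close>

lemma divisible_vanish: "(\<And>q. q < length Ps \<Longrightarrow> g q = 0) \<Longrightarrow> divisible Ps g"
proof (induction Ps arbitrary: g)
  case (Cons P Ps)
  have "divisible Ps (N_step P g)"
    by (rule Cons.IH) (use Cons.prems in \<open>simp add: N_step_def\<close>)
  then show ?case using Cons.prems[of 0] by simp
qed auto

text \<open>Divisibility is a condition on the coefficients below \<open>length Ps\<close> only.
  This is what permits truncation and computation modulo a power of y.\<close>

lemma divisible_cong:
  assumes "divisible Ps g" "\<And>q. q < length Ps \<Longrightarrow> g q = h q"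
  shows "divisible Ps h"
proof -
  have "divisible Ps (series_add h (series_scale (-1) g))"
    by (rule divisible_vanish) (simp add: series_add_def series_scale_def assms(2))
  moreover have "series_add (series_add h (series_scale (-1) g)) g = h"
    by (rule ext) (simp add: series_add_def series_scale_def)
  ultimately show ?thesis
    using divisible_series_add[OF _ assms(1)] by metis
qed

lemma divisible_append: "divisible (Ps @ [P]) g \<longleftrightarrow> divisible Ps g \<and> P *v T_op Ps g 0 = T_op Ps g 0"
  by (induction Ps arbitrary: g) auto

lemma T_op_append: "T_op (Ps @ [P]) g = N_step P (T_op Ps g)"
  by (induction Ps arbitrary: g) auto

lemma T_op_vanish_0: "(\<And>q. q \<le> length Ps \<Longrightarrow> g q = 0) \<Longrightarrow> T_op Ps g 0 = 0"
proof (induction Ps arbitrary: g)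
  case (Cons P Ps)
  show ?case unfolding T_op.simps
    by (rule Cons.IH) (use Cons.prems in \<open>auto simp: N_step_def\<close>)
qed auto

lemma S_op_vanish: "(\<And>q. q > M \<Longrightarrow> g q = 0) \<Longrightarrow> q > M + length Ps \<Longrightarrow> S_op Ps g q = 0"
proof (induction Ps arbitrary: q)
  case (Cons P Ps)
  have "S_op Ps g (q - 1) = 0" "S_op Ps g q = 0"
    using Cons by auto
  then show ?case by (simp add: S_step_def shift_def)
qed auto

text \<open>Multiplying y + P by 1 - \<lambda> gives P + \<lambda> (1 - P); the additional factor 1
  - \<lambda> is supplied by passing from M to M + 1.\<close>

lemma bernstein_S_step: "(\<And>q. q > M \<Longrightarrow> g q = 0) \<Longrightarrow>
  bernstein (Suc M) (S_step P g) x = (P + mat x ** (mat 1 - P)) *v bernstein M g x"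
proof -
  assume g: "\<And>q. q > M \<Longrightarrow> g q = 0"
  have 1: "bernstein (Suc M) (shift g) x = x *s bernstein M g x"
    unfolding bernstein_def shift_def
    by (subst sum.atMost_Suc_shift) (simp add: vec.scale_sum_right mult.assoc)
  have 2: "(\<Sum>q\<le>Suc M. (x ^ q * (1 - x) ^ (Suc M - q)) *s (P *v g q)) = (1 - x) *s (P *v bernstein M g x)"
  proof -
    have "(\<Sum>q\<le>Suc M. (x ^ q * (1 - x) ^ (Suc M - q)) *s (P *v g q))
       = (\<Sum>q\<le>M. (x ^ q * (1 - x) ^ (Suc M - q)) *s (P *v g q))"
      by (simp add: g)
    also have "\<dots> = (\<Sum>q\<le>M. (1 - x) *s (P *v ((x ^ q * (1 - x) ^ (M - q)) *s g q)))"
      by (rule sum.cong) (auto simp: Suc_diff_le mult_vec_scale mult_ac)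
    also have "\<dots> = (1 - x) *s (P *v bernstein M g x)"
      by (simp add: bernstein_def mult_vec_sum vec.scale_sum_right)
    finally show ?thesis .
  qed
  have "bernstein (Suc M) (S_step P g) x = bernstein (Suc M) (shift g) x + (\<Sum>q\<le>Suc M. (x ^ q * (1 - x) ^ (Suc M - q)) *s (P *v g q))"
    unfolding bernstein_def S_step_def by (simp add: vec.scale_right_distrib sum.distrib)
  then show ?thesis
    unfolding 1 2 by (simp add: mv_simps algebra_simps vec.scale_left_diff_distrib)
qed

lemma bernstein_add: "bernstein M (series_add g h) x = bernstein M g x + bernstein M h x"
  by (simp add: bernstein_def series_add_def vec.scale_right_distrib sum.distrib)

lemma bernstein_cong: "(\<And>q. q \<le> M \<Longrightarrow> g q = h q) \<Longrightarrow> bernstein M g x = bernstein M h x"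
  by (simp add: bernstein_def)

lemma bernstein_shift: "bernstein (Suc M) (shift g) x = x *s bernstein M g x"
  unfolding bernstein_def shift_def
  by (subst sum.atMost_Suc_shift) (simp add: vec.scale_sum_right mult.assoc)

lemma bernstein_Suc: "g (Suc M) = 0 \<Longrightarrow> bernstein (Suc M) g x = (1 - x) *s bernstein M g x"
  by (simp add: bernstein_def vec.scale_sum_right Suc_diff_le mult_ac)

text \<open>The series 1 + y is 1 / (1 - \<lambda>) and cancels the additional factor 1 -
  \<lambda>.\<close>

lemma bernstein_one_plus_shift: "g (Suc M) = 0 \<Longrightarrow> bernstein (Suc M) (series_add g (shift g)) x = bernstein M g x"
  by (simp add: bernstein_add bernstein_shift bernstein_Suc vec.scale_left_diff_distrib)

text \<open>In symbols (y + P) (1 + (1 - P) / y) = 1 + y, because P (1 - P) = 0. In this order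
  nothing may have been discarded by \<open>N_step\<close>, whence the second hypothesis; in the
  opposite order the term in 1 / y never arises.\<close>

lemma S_N_step:
  assumes "P ** P = P" "P *v g 0 = g 0"
  shows "S_step P (N_step P g) = series_add g (shift g)"
proof
  fix q show "S_step P (N_step P g) q = series_add g (shift g) q"
    using assms by (cases q) (simp_all add: S_step_def N_step_def series_add_def shift_def mv_simps matrix_vector_mul_assoc)
qed

lemma N_S_step:
  assumes "P ** P = P"
  shows "N_step P (S_step P g) = series_add g (shift g)"
proof
  have [simp]: "P *v (P *v v) = P *v v" for v
    using assms by (simp add: matrix_vector_mul_assoc)
  fix q show "N_step P (S_step P g) q = series_add g (shift g) q"
    by (cases q) (simp_all add: S_step_def N_step_def series_add_def shift_def mv_simps)
qed

text \<open>Division by a factor does not raise the degree in y, and multiplying back costs 1 + y =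
  1 / (1 - \<lambda>) per factor, so the same M serves on both sides. Divisibility of series thus
  becomes an identity of polynomials in \<lambda>.\<close>

lemma Phi_bernstein_T_op:
  assumes "\<forall>P\<in>set Ps. P ** P = P" "divisible Ps g" "\<And>q. q > M \<Longrightarrow> g q = 0"
  shows "Phi Ps x *v bernstein M (T_op Ps g) x = bernstein M g x"
  using assms
proof (induction Ps arbitrary: g)
  case (Cons P Ps)
  have N: "\<And>q. q > M \<Longrightarrow> N_step P g q = 0"
    using Cons.prems by (simp add: N_step_def)
  have "Phi (P # Ps) x *v bernstein M (T_op (P # Ps) g) x
      = (P + mat x ** (mat 1 - P)) *v (Phi Ps x *v bernstein M (T_op Ps (N_step P g)) x)"
    by (simp add: matrix_vector_mul_assoc)
  also have "\<dots> = (P + mat x ** (mat 1 - P)) *v bernstein M (N_step P g) x"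
    by (subst Cons.IH) (use Cons.prems N in auto)
  also have "\<dots> = bernstein (Suc M) (S_step P (N_step P g)) x"
    by (rule bernstein_S_step[symmetric]) (rule N)
  also have "\<dots> = bernstein M g x"
    using Cons.prems by (simp add: S_N_step bernstein_one_plus_shift)
  finally show ?case .
qed auto

lemma Phi_bernstein:
  assumes "\<And>q. q > M \<Longrightarrow> u q = 0"
  shows "Phi Ps x *v bernstein M u x = bernstein (M + length Ps) (S_op Ps u) x"
proof (induction Ps)
  case (Cons P Ps)
  show ?case
    using bernstein_S_step[OF S_op_vanish[OF assms], where P = P]
    by (simp add: matrix_vector_mul_assoc[symmetric] Cons.IH)
qed auto

text \<open>\<open>S_op Ps u\<close> is (1 + y)^n \<Phi> u. Dividing by \<Phi> leaves (1 + y)^n u,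
  and at y = 0 the scalar is 1.\<close>

lemma divisible_S_op:
  assumes "\<forall>P\<in>set Ps. P ** P = P"
  shows "divisible Ps (S_op Ps u) \<and> T_op Ps (S_op Ps u) 0 = u 0"
  using assms
proof (induction Ps)
  case (Cons P Ps)
  let ?w = "S_op Ps u"
  have IH: "divisible Ps ?w" "T_op Ps ?w 0 = u 0" and P: "P ** P = P" using Cons by auto
  have "P *v S_step P ?w 0 = S_step P ?w 0"
    using P by (simp add: S_step_def shift_def matrix_vector_mul_assoc)
  moreover have "divisible Ps (series_add ?w (shift ?w))"
    using IH divisible_shift divisible_series_add by blast
  moreover have "T_op Ps (series_add ?w (shift ?w)) 0 = u 0"
    using IH divisible_shift[OF IH(1)] by (simp add: T_op_series_add) (simp add: series_add_def shift_def)
  ultimately show ?case using P by (simp add: N_S_step)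
qed auto

text \<open>If g = \<Phi> h and h vanishes at y = 0, then h / y is again a power series and g / y =
  \<Phi> (h / y).\<close>

lemma divisible_descend:
  assumes "\<forall>P\<in>set Ps. P ** P = P" "divisible Ps g" "T_op Ps g 0 = 0"
  shows "g 0 = 0 \<and> divisible Ps (\<lambda>q. g (Suc q))"
  using assms
proof (induction Ps arbitrary: g)
  case (Cons P Ps)
  let ?w = "N_step P g"
  have w: "?w 0 = 0" "divisible Ps (\<lambda>q. ?w (Suc q))" and P: "P ** P = P" and g0: "P *v g 0 = g 0"
    using Cons by auto
  have "P *v ?w 0 = P *v g 0"
    using P by (simp add: N_step_def mv_simps matrix_vector_mul_assoc)
  then have g: "g 0 = 0" using w g0 by simp
  have "P *v g (Suc 0) = g (Suc 0)"
    using w(1) by (simp add: N_step_def g mv_simps)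
  moreover have "N_step P (\<lambda>q. g (Suc q)) = (\<lambda>q. ?w (Suc q))"
    by (rule ext) (simp add: N_step_def)
  ultimately show ?case using g w by simp
qed auto

definition plist :: "(nat \<Rightarrow> complex^'n^'n) \<Rightarrow> nat \<Rightarrow> (complex^'n^'n) list" where
  "plist P i = map P [1..<Suc i]"

lemma plist_0 [simp]: "plist P 0 = []"
  by (simp add: plist_def)

lemma plist_Suc: "plist P (Suc i) = plist P i @ [P (Suc i)]"
  by (simp add: plist_def)

lemma length_plist [simp]: "length (plist P i) = i"
  by (simp add: plist_def)

lemma set_plist: "set (plist P i) = P ` {1..i}"
  by (auto simp: plist_def)

lemma Cmat_0: "Cmat P 0 s = (if s = 0 then mat 1 else 0)"
proof -
  have "{I :: nat set. I \<subseteq> {1..0} \<and> card I = s} = (if s = 0 then {{}} else {})" by auto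
  then show ?thesis by (simp add: Cmat_def mprod_def)
qed

lemma Cmat_gt: "s > i \<Longrightarrow> Cmat P i s = 0"
proof -
  assume "s > i"
  have "card I \<noteq> s" if "I \<subseteq> {1..i}" for I
    using card_mono[OF _ that] \<open>s > i\<close> by simp
  then have "{I. I \<subseteq> {1..i} \<and> card I = s} = {}" by blast
  then show ?thesis by (simp only: Cmat_def sum.empty)
qed

lemma matrix_mult_sum: "A ** (\<Sum>x\<in>X. f x) = (\<Sum>x\<in>X. A ** f x)" for A :: "complex^'n^'n"
  by (induction X rule: infinite_finite_induct) (simp_all add: matrix_add_ldistrib)

text \<open>Chains are sorted by whether they contain i + 1; being the largest index, it contributes
  the leftmost factor, and removing it leaves a chain of length s - 1.\<close>

lemma Cmat_Suc:
  "Cmat P (Suc i) s = Cmat P i s + (if s = 0 then 0 else (mat 1 - P (Suc i)) ** Cmat P i (s - 1))"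
proof -
  let ?f = "\<lambda>I. mprod (map (\<lambda>m. mat 1 - P m) (rev (sorted_list_of_set I)))"
  define A where "A = {I. I \<subseteq> {1..i} \<and> card I = s}"
  define B where "B = {I. I \<subseteq> {1..i} \<and> Suc (card I) = s}"
  have fin: "finite I" if "I \<in> A \<union> B" for I
    using that finite_subset[of I "{1..i}"] by (auto simp: A_def B_def)
  have finAB: "finite A" "finite B"
    by (rule finite_subset[of _ "Pow {1..i}"], auto simp: A_def B_def)+
  have notin: "Suc i \<notin> I" if "I \<in> A \<union> B" for I
    using that by (auto simp: A_def B_def)
  have split: "{I. I \<subseteq> {1..Suc i} \<and> card I = s} = A \<union> insert (Suc i) ` B"
  proof (intro equalityI subsetI)
    fix I assume I: "I \<in> {I. I \<subseteq> {1..Suc i} \<and> card I = s}"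
    then have finI: "finite I" using finite_subset by blast
    show "I \<in> A \<union> insert (Suc i) ` B"
    proof (cases "Suc i \<in> I")
      case True
      have "I - {Suc i} \<in> B"
        using I True finI by (auto simp: B_def le_Suc_eq card_Suc_Diff1 simp del: card_Diff_insert card_Diff_singleton)
      moreover have "I = insert (Suc i) (I - {Suc i})" using True by auto
      ultimately show ?thesis by blast
    next
      case False
      then show ?thesis using I by (auto simp: A_def le_Suc_eq)
    qed
  next
    fix I assume "I \<in> A \<union> insert (Suc i) ` B"
    then show "I \<in> {I. I \<subseteq> {1..Suc i} \<and> card I = s}"
    proof
      assume "I \<in> A" then show ?thesis by (auto simp: A_def)
    next
      assume "I \<in> insert (Suc i) ` B"
      then obtain K where K: "K \<in> B" "I = insert (Suc i) K" by auto
      then show ?thesis using fin[of K] notin[of K] by (auto simp: B_def)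
    qed
  qed
  have "Cmat P (Suc i) s = sum ?f A + sum ?f (insert (Suc i) ` B)"
    unfolding Cmat_def split
    by (rule sum.union_disjoint) (use finAB notin in auto)
  also have "sum ?f (insert (Suc i) ` B) = (\<Sum>I\<in>B. ?f (insert (Suc i) I))"
    by (subst sum.reindex) (auto simp: inj_on_def insert_ident notin)
  also have "\<dots> = (\<Sum>I\<in>B. (mat 1 - P (Suc i)) ** ?f I)"
  proof (rule sum.cong[OF refl])
    fix I assume I: "I \<in> B"
    have "I \<subseteq> {1..i}" using I by (simp add: B_def)
    moreover have "finite I" using fin I by blast
    moreover have "Suc i \<notin> I" using I notin by blast
    moreover have "x \<le> Suc i" if "x \<in> I" for x
      using that \<open>I \<subseteq> {1..i}\<close> by fastforce
    ultimately have "sorted_list_of_set (insert (Suc i) I) = sorted_list_of_set I @ [Suc i]"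
      by (simp add: sorted_insort_is_snoc)
    then show "?f (insert (Suc i) I) = (mat 1 - P (Suc i)) ** ?f I"
      by (simp only: mprod_def) simp
  qed
  also have "\<dots> = (mat 1 - P (Suc i)) ** sum ?f B"
    by (simp add: matrix_mult_sum)
  also have "sum ?f A = Cmat P i s" by (simp add: A_def Cmat_def)
  also have "(mat 1 - P (Suc i)) ** sum ?f B = (if s = 0 then 0 else (mat 1 - P (Suc i)) ** Cmat P i (s - 1))"
  proof (cases s)
    case 0
    then have "B = {}" by (auto simp: B_def)
    then show ?thesis using 0 by simp
  next
    case (Suc s')
    then have "sum ?f B = Cmat P i s'" unfolding Cmat_def B_def by simp
    then show ?thesis using Suc by simp
  qed
  finally show ?thesis .
qed

text \<open>The operators C are the coefficients of the product of the factors 1 + (1 -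
  \<open>P m\<close>) / y. The negative powers discarded on the way never feed back, since every
  factor only lowers powers of y.\<close>

lemma T_op_Cmat: "T_op (plist P i) g q = (\<Sum>s\<le>i. Cmat P i s *v g (q + s))"
proof (induction i arbitrary: q)
  case 0
  show ?case by (simp add: Cmat_0)
next
  case (Suc i)
  have "T_op (plist P (Suc i)) g q = N_step (P (Suc i)) (T_op (plist P i) g) q"
    by (simp add: plist_Suc T_op_append)
  also have "\<dots> = (\<Sum>s\<le>i. Cmat P i s *v g (q + s)) + (\<Sum>s\<le>i. ((mat 1 - P (Suc i)) ** Cmat P i s) *v g (q + Suc s))"
    by (simp add: N_step_def Suc.IH mult_vec_sum matrix_vector_mul_assoc)
  also have "(\<Sum>s\<le>i. Cmat P i s *v g (q + s)) = (\<Sum>s\<le>Suc i. Cmat P i s *v g (q + s))"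
    by (simp add: Cmat_gt)
  also have "(\<Sum>s\<le>i. ((mat 1 - P (Suc i)) ** Cmat P i s) *v g (q + Suc s))
     = (\<Sum>s\<le>Suc i. (if s = 0 then 0 else (mat 1 - P (Suc i)) ** Cmat P i (s - 1)) *v g (q + s))"
    unfolding sum.atMost_Suc_shift[of _ i] by simp
  also have "(\<Sum>s\<le>Suc i. Cmat P i s *v g (q + s)) + \<dots> = (\<Sum>s\<le>Suc i. Cmat P (Suc i) s *v g (q + s))"
    by (simp only: Cmat_Suc matrix_vector_mult_add_rdistrib sum.distrib)
  finally show ?case .
qed

section \<open>The module generated by the columns of an array\<close>

text \<open>With \<open>h k l j\<close> standing for the k-th derivative of the entry in row l and
  column j, this is y^(k + m) times the series of k-th derivatives of column j. The factor y^k
  belongs to the generator, and m counts further multiplications by y.\<close>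

definition col_series :: "(nat \<Rightarrow> nat \<Rightarrow> nat \<Rightarrow> complex^'n) \<Rightarrow> nat \<Rightarrow> nat \<Rightarrow> nat \<Rightarrow> nat \<Rightarrow> complex^'n" where
  "col_series h k m j q = (if q < k + m then 0 else h k (q - (k + m)) j)"

text \<open>Membership in the module of the columns, modulo \<open>y\<^sup>i\<close>.\<close>

inductive spanned :: "(nat \<Rightarrow> nat \<Rightarrow> nat \<Rightarrow> complex^'n) \<Rightarrow> nat \<Rightarrow> nat \<Rightarrow> (nat \<Rightarrow> complex^'n) \<Rightarrow> bool"
  for h J i where
  spanned_col: "k + m < i \<Longrightarrow> j \<in> {1..J} \<Longrightarrow> spanned h J i (col_series h k m j)"
| spanned_high: "(\<And>q. q < i \<Longrightarrow> g q = 0) \<Longrightarrow> spanned h J i g"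
| spanned_series_add: "spanned h J i f \<Longrightarrow> spanned h J i g \<Longrightarrow> spanned h J i (series_add f g)"
| spanned_series_scale: "spanned h J i g \<Longrightarrow> spanned h J i (series_scale c g)"

text \<open>The recursive definition of the bundles read at one point, with projections and
  derivatives as free data. The algebra is carried out for such data and later applied to their
  values at a generic point.\<close>

definition frame_of :: "(nat \<Rightarrow> complex^'n^'n) \<Rightarrow> (nat \<Rightarrow> nat \<Rightarrow> nat \<Rightarrow> complex^'n) \<Rightarrow> nat \<Rightarrow> nat \<Rightarrow> bool" where
  "frame_of P h J r \<longleftrightarrow> (\<forall>i<r. P (Suc i) ** P (Suc i) = P (Suc i) \<and>
     range (\<lambda>v. P (Suc i) *v v) =
       vec.span {\<Sum>s=k..i. Cmat P i s *v h k (s - k) j | k j. k \<le> i \<and> j \<in> {1..J}})"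

lemma shift_col_series: "shift (col_series h k m j) = col_series h k (Suc m) j"
  by (rule ext) (auto simp: shift_def col_series_def)

lemma T_op_col_series:
  assumes "k \<le> i"
  shows "T_op (plist P i) (col_series h k 0 j) 0 = (\<Sum>s=k..i. Cmat P i s *v h k (s - k) j)"
proof -
  have "T_op (plist P i) (col_series h k 0 j) 0 = (\<Sum>s\<le>i. Cmat P i s *v col_series h k 0 j s)"
    by (subst T_op_Cmat) simp
  also have "\<dots> = (\<Sum>s=k..i. Cmat P i s *v col_series h k 0 j s)"
    by (rule sum.mono_neutral_right) (auto simp: col_series_def)
  also have "\<dots> = (\<Sum>s=k..i. Cmat P i s *v h k (s - k) j)"
    by (rule sum.cong) (auto simp: col_series_def)
  finally show ?thesis .
qed

lemma frame_of_idem: "frame_of P h J r \<Longrightarrow> i \<le> r \<Longrightarrow> \<forall>R\<in>set (plist P i). R ** R = R"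
  unfolding frame_of_def set_plist by (auto simp: Suc_le_eq dest!: gr0_implies_Suc)

lemma idem_range_fixed: "P ** P = P \<Longrightarrow> x \<in> range (\<lambda>v. P *v v) \<Longrightarrow> P *v x = x" for P :: "complex^'n^'n"
  by (auto simp: matrix_vector_mul_assoc)

text \<open>For k \<le> i, dividing the generator by \<Phi>_i leaves at y = 0 precisely the section
  with derivative index k, which lies in the range of \<open>P (Suc i)\<close>. For k > i the order
  in y is too high for anything to remain there.\<close>

lemma divisible_col_series_0:
  assumes "frame_of P h J r" "i \<le> r" "j \<in> {1..J}"
  shows "divisible (plist P i) (col_series h k 0 j)"
  using assms(2)
proof (induction i)
  case (Suc i)
  let ?x = "T_op (plist P i) (col_series h k 0 j) 0"
  have "P (Suc i) *v ?x = ?x"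
  proof (cases "k \<le> i")
    case True
    have "?x \<in> range (\<lambda>v. P (Suc i) *v v)"
      using assms Suc.prems True unfolding T_op_col_series[OF True] frame_of_def
      by (auto intro!: vec.span_base)
    moreover have "P (Suc i) ** P (Suc i) = P (Suc i)"
      using assms Suc.prems by (auto simp: frame_of_def)
    ultimately show ?thesis by (intro idem_range_fixed)
  next
    case False
    have "?x = 0"
      by (rule T_op_vanish_0) (use False in \<open>simp add: col_series_def\<close>)
    then show ?thesis by simp
  qed
  then show ?case
    using Suc by (simp add: plist_Suc divisible_append)
qed simp

lemma divisible_col_series:
  assumes "frame_of P h J r" "i \<le> r" "j \<in> {1..J}"
  shows "divisible (plist P i) (col_series h k m j)"
proof (induction m)
  case (Suc m)
  then show ?case using divisible_shift by (simp only: shift_col_series[symmetric]) blast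
qed (rule divisible_col_series_0[OF assms])

lemma spanned_shift: "spanned h J i g \<Longrightarrow> spanned h J (Suc i) (shift g)"
proof (induction rule: spanned.induct)
  case (spanned_col k m j)
  then show ?case unfolding shift_col_series by (intro spanned.spanned_col) auto
next
  case (spanned_high g)
  then show ?case by (intro spanned.spanned_high) (auto simp: shift_def)
next
  case (spanned_series_add f g)
  have "shift (series_add f g) = series_add (shift f) (shift g)" by (rule ext) (simp add: shift_def series_add_def)
  then show ?case using spanned_series_add by (simp add: spanned.spanned_series_add)
next
  case (spanned_series_scale g c)
  have "shift (series_scale c g) = series_scale c (shift g)" by (rule ext) (simp add: shift_def series_scale_def)
  then show ?case using spanned_series_scale by (simp add: spanned.spanned_series_scale)
qed

text \<open>The quotient of g by \<Phi>_i takes at y = 0 a value in the next bundle, and some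
  combination of generators with m = 0 has the same value. Subtracting it leaves y times an element
  of \<Phi>_i H_+, to which the induction hypothesis applies.\<close>

theorem divisible_imp_spanned:
  assumes "frame_of P h J r" "i \<le> r" "divisible (plist P i) g"
  shows "spanned h J i g"
  using assms(2,3)
proof (induction i arbitrary: g)
  case 0
  show ?case by (rule spanned_high) simp
next
  case (Suc i)
  let ?Ps = "plist P i"
  have g: "divisible ?Ps g" "P (Suc i) *v T_op ?Ps g 0 = T_op ?Ps g 0"
    using Suc.prems by (simp_all add: plist_Suc divisible_append)
  define A where "A = {\<Sum>s=k..i. Cmat P i s *v h k (s - k) j | k j. k \<le> i \<and> j \<in> {1..J}}"
  have "range (\<lambda>v. P (Suc i) *v v) = vec.span A"
    using assms(1) Suc.prems unfolding frame_of_def A_def by simp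
  then have span: "T_op ?Ps g 0 \<in> vec.span A"
    using g(2) by (metis rangeI)
  \<comment> \<open>The spanning sections are the values at y = 0 belonging to generators, so by
    linearity every vector of the span is the value of a generated series.\<close>
  have ex: "\<exists>G. spanned h J (Suc i) G \<and> divisible ?Ps G \<and> T_op ?Ps G 0 = x" if "x \<in> vec.span A" for x
    using that
  proof (induction rule: vec.span_induct_alt)
    case base
    have "spanned h J (Suc i) (\<lambda>_. 0)" by (rule spanned_high) simp
    moreover have "divisible ?Ps (\<lambda>_. 0)" "T_op ?Ps (\<lambda>_. 0) 0 = 0"
      by (rule divisible_vanish, simp) (rule T_op_vanish_0, simp)
    ultimately show ?case by blast
  next
    case (step c x y)
    then obtain G where G: "spanned h J (Suc i) G" "divisible ?Ps G" "T_op ?Ps G 0 = y" by blast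
    from step(1) obtain k j where kj: "k \<le> i" "j \<in> {1..J}" "x = (\<Sum>s=k..i. Cmat P i s *v h k (s - k) j)"
      by (auto simp: A_def)
    let ?E = "col_series h k 0 j"
    have "spanned h J (Suc i) (series_add (series_scale c ?E) G)"
      by (intro spanned_series_add spanned_series_scale spanned_col G) (use kj in auto)
    moreover have "divisible ?Ps (series_add (series_scale c ?E) G)"
      using Suc.prems kj by (intro divisible_series_add divisible_series_scale G divisible_col_series[OF assms(1)]) auto
    moreover have "T_op ?Ps (series_add (series_scale c ?E) G) 0 = c *s x + y"
      using T_op_col_series[OF kj(1), of P h j] kj G by (simp add: T_op_series_add T_op_series_scale series_add_def series_scale_def)
    ultimately show ?case by blast
  qed
  then obtain G where G: "spanned h J (Suc i) G" "divisible ?Ps G" "T_op ?Ps G 0 = T_op ?Ps g 0"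
    using span by blast
  define g' where "g' = series_add g (series_scale (-1) G)"
  have "divisible ?Ps g'" unfolding g'_def by (intro divisible_series_add divisible_series_scale g G)
  moreover have "T_op ?Ps g' 0 = 0"
    unfolding g'_def by (simp add: T_op_series_add T_op_series_scale series_add_def series_scale_def G)
  ultimately have g': "g' 0 = 0" "divisible ?Ps (\<lambda>q. g' (Suc q))"
    using divisible_descend[OF frame_of_idem[OF assms(1), of i], of g'] Suc.prems by simp_all
  have "spanned h J (Suc i) (shift (\<lambda>q. g' (Suc q)))"
    by (rule spanned_shift, rule Suc.IH) (use Suc.prems g' in auto)
  then have "spanned h J (Suc i) (series_add G (shift (\<lambda>q. g' (Suc q))))"
    using G spanned_series_add by blast
  moreover have "series_add G (shift (\<lambda>q. g' (Suc q))) = g"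
  proof
    fix q
    have "shift (\<lambda>q. g' (Suc q)) q = g' q" using g'(1) by (cases q) (auto simp: shift_def)
    then show "series_add G (shift (\<lambda>q. g' (Suc q))) q = g q"
      by (simp add: series_add_def g'_def series_scale_def)
  qed
  ultimately show ?case by simp
qed

definition spanned_index :: "nat \<Rightarrow> nat \<Rightarrow> (nat \<times> nat \<times> nat) set" where
  "spanned_index i J = {(k, m, j). k + m < i \<and> j \<in> {1..J}}"

lemma finite_spanned_index: "finite (spanned_index i J)"
  by (rule finite_subset[of _ "{..<i} \<times> {..<i} \<times> {1..J}"]) (auto simp: spanned_index_def)

text \<open>Constant coefficients suffice because powers of y are absorbed into the index m, and
  what has order at least i drops out.\<close>

lemma spanned_imp_sum:
  assumes "spanned h J i g"
  shows "\<exists>c. \<forall>q<i. g q = (\<Sum>(k, m, j)\<in>spanned_index i J. c (k, m, j) *s col_series h k m j q)"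
  using assms
proof induction
  case (spanned_col k m j)
  show ?case
  proof (intro exI[of _ "\<lambda>b. if b = (k, m, j) then 1 else 0"] allI impI)
    fix q
    have "(\<Sum>(k', m', j')\<in>spanned_index i J. (if (k', m', j') = (k, m, j) then 1 else 0) *s col_series h k' m' j' q)
      = (\<Sum>b\<in>spanned_index i J. if b = (k, m, j) then col_series h k m j q else 0)"
      by (rule sum.cong) (auto split: if_splits)
    also have "\<dots> = col_series h k m j q"
      using spanned_col finite_spanned_index[of i J] by (simp add: spanned_index_def)
    finally show "col_series h k m j q = (\<Sum>(k', m', j')\<in>spanned_index i J. (if (k', m', j') = (k, m, j) then 1 else 0) *s col_series h k' m' j' q)"
      by simp
  qed
next
  case (spanned_high g)
  then show ?case by (intro exI[of _ "\<lambda>_. 0"]) (simp add: case_prod_beta)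
next
  case (spanned_series_add f g)
  then obtain c d where
    "\<And>q. q < i \<Longrightarrow> f q = (\<Sum>(k, m, j)\<in>spanned_index i J. c (k, m, j) *s col_series h k m j q)"
    "\<And>q. q < i \<Longrightarrow> g q = (\<Sum>(k, m, j)\<in>spanned_index i J. d (k, m, j) *s col_series h k m j q)"
    by blast
  then show ?case
    by (intro exI[of _ "\<lambda>b. c b + d b"])
      (simp add: series_add_def case_prod_beta vec.scale_left_distrib sum.distrib)
next
  case (spanned_series_scale g a)
  then obtain c where
    "\<And>q. q < i \<Longrightarrow> g q = (\<Sum>(k, m, j)\<in>spanned_index i J. c (k, m, j) *s col_series h k m j q)"
    by blast
  then show ?case
    by (intro exI[of _ "\<lambda>b. a * c b"])
      (simp add: series_scale_def case_prod_beta vec.scale_sum_right)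
qed

section \<open>The substitution \<open>\<lambda> \<mapsto> t \<lambda>\<close> on power series\<close>

text \<open>With \<open>y\<^sub>t = t y / (1 + (1 - t) y)\<close>, which is \<open>y\<close> at \<open>t \<lambda>\<close>, the series \<open>rescale t r g\<close> is
  \<open>(1 + (1 - t) y)\<^sup>r g(y\<^sub>t)\<close> modulo \<open>y\<^bsup>r+1\<^esup>\<close>, and \<open>column_rescale t f\<close>, the deformation of a column up to a scalar, is
  \<open>f(y\<^sub>t) / (1 + (1 - t) y)\<close>. So they differ by a power of \<open>mul_lin (1 - t)\<close>.\<close>

definition rescale :: "complex \<Rightarrow> nat \<Rightarrow> (nat \<Rightarrow> complex^'n) \<Rightarrow> nat \<Rightarrow> complex^'n" where
  "rescale t r g p = (\<Sum>q\<le>p. (t ^ q * of_nat ((r - q) choose (p - q)) * (1 - t) ^ (p - q)) *s g q)"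

definition column_rescale :: "complex \<Rightarrow> (nat \<Rightarrow> complex^'n) \<Rightarrow> nat \<Rightarrow> complex^'n" where
  "column_rescale t f p = (\<Sum>l\<le>p. (of_nat (p choose l) * t ^ l * (t - 1) ^ (p - l)) *s f l)"

definition mul_lin :: "complex \<Rightarrow> (nat \<Rightarrow> complex^'n) \<Rightarrow> nat \<Rightarrow> complex^'n" where
  "mul_lin c g = series_add g (series_scale c (shift g))"

lemma mul_lin_pow_Suc:
  "(mul_lin c ^^ Suc a) g p = (mul_lin c ^^ a) g p + (if p = 0 then 0 else c *s (mul_lin c ^^ a) g (p - 1))"
proof -
  let ?f = "(mul_lin c ^^ a) g"
  have "mul_lin c ?f p = series_add ?f (series_scale c (shift ?f)) p"
    by (rule fun_cong[OF mul_lin_def])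
  then show ?thesis by (simp add: series_add_def series_scale_def shift_def)
qed

text \<open>Binomial expansion of 1 - t x = (1 - t) x + (1 - x).\<close>

lemma bernstein_monomial_rescaled:
  fixes x t :: complex
  assumes "q \<le> r"
  shows "(t * x) ^ q * (1 - t * x) ^ (r - q) =
    (\<Sum>p=q..r. x ^ p * (1 - x) ^ (r - p) * (t ^ q * of_nat ((r - q) choose (p - q)) * (1 - t) ^ (p - q)))"
proof -
  have "(1 - t * x) ^ (r - q) = ((1 - t) * x + (1 - x)) ^ (r - q)"
    by (simp add: algebra_simps)
  also have "\<dots> = (\<Sum>m\<le>r - q. of_nat ((r - q) choose m) * ((1 - t) * x) ^ m * (1 - x) ^ (r - q - m))"
    by (simp add: binomial_ring)
  also have "(t * x) ^ q * \<dots> = (\<Sum>m\<le>r - q. x ^ (q + m) * (1 - x) ^ (r - (q + m)) * (t ^ q * of_nat ((r - q) choose m) * (1 - t) ^ m))"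
    unfolding sum_distrib_left
    by (rule sum.cong) (auto simp: power_add power_mult_distrib mult_ac diff_diff_left)
  also have "\<dots> = (\<Sum>p=q..r. x ^ p * (1 - x) ^ (r - p) * (t ^ q * of_nat ((r - q) choose (p - q)) * (1 - t) ^ (p - q)))"
    by (rule sum.reindex_bij_witness[of _ "\<lambda>p. p - q" "\<lambda>m. q + m"]) (use assms in auto)
  finally show ?thesis .
qed

lemma sum_triangle_swap:
  "(\<Sum>q\<le>r. \<Sum>p=q..r. f p q) = (\<Sum>p\<le>r. \<Sum>q\<le>p. f p q)"
  for r :: nat and f :: "nat \<Rightarrow> nat \<Rightarrow> 'a::comm_monoid_add"
  by (simp add: sum.Sigma, rule sum.reindex_bij_witness[of _ "\<lambda>(p, q). (q, p)" "\<lambda>(q, p). (p, q)"]) auto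

lemma bernstein_rescale: "bernstein r g (t * x) = bernstein r (rescale t r g) x"
proof -
  let ?A = "\<lambda>p q. x ^ p * (1 - x) ^ (r - p) * (t ^ q * of_nat ((r - q) choose (p - q)) * (1 - t) ^ (p - q))"
  have "bernstein r g (t * x) = (\<Sum>q\<le>r. \<Sum>p=q..r. ?A p q *s g q)"
    unfolding bernstein_def
    by (rule sum.cong) (simp_all only: atMost_iff bernstein_monomial_rescaled vec.scale_sum_left)
  also have "\<dots> = (\<Sum>p\<le>r. \<Sum>q\<le>p. ?A p q *s g q)"
    by (rule sum_triangle_swap)
  also have "\<dots> = bernstein r (rescale t r g) x"
    unfolding bernstein_def rescale_def by (simp add: vec.scale_sum_right)
  finally show ?thesis .
qed

lemma rescale_vanish: "(\<And>q. q > r \<Longrightarrow> g q = 0) \<Longrightarrow> p > r \<Longrightarrow> rescale t r g p = 0"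
  unfolding rescale_def
proof (rule sum.neutral, rule ballI)
  fix q assume g: "\<And>q. q > r \<Longrightarrow> g q = 0" and p: "p > r" and "q \<in> {..p}"
  show "(t ^ q * of_nat (r - q choose (p - q)) * (1 - t) ^ (p - q)) *s g q = 0"
  proof (cases "q > r")
    case False
    then have "(r - q) choose (p - q) = 0" using p by (intro binomial_eq_0) simp
    then show ?thesis by simp
  qed (simp add: g)
qed

lemma rescale_series_add: "rescale t r (series_add f g) = series_add (rescale t r f) (rescale t r g)"
  by (rule ext) (simp add: rescale_def series_add_def vec.scale_right_distrib sum.distrib)

lemma rescale_series_scale: "rescale t r (series_scale c g) = series_scale c (rescale t r g)"
  by (rule ext) (simp add: rescale_def series_scale_def vec.scale_sum_right mult_ac)

text \<open>These are the coefficients of t^l y^l (1 + (1 - t) y)^(a - l - 1). The exponent may be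
  negative, hence the generalized binomial coefficient; each further factor 1 + (1 - t) y raises it
  by Pascal's rule.\<close>

lemma mul_lin_column_rescale:
  "(mul_lin (1 - t) ^^ a) (column_rescale t f) p =
    (\<Sum>l\<le>p. (t ^ l * ((of_nat a - of_nat l - 1) gchoose (p - l)) * (1 - t) ^ (p - l)) *s f l)"
proof (induction a arbitrary: p)
  case 0
  have "of_nat (p choose l) * t ^ l * (t - 1) ^ (p - l) =
      t ^ l * ((of_nat 0 - of_nat l - 1) gchoose (p - l)) * (1 - t) ^ (p - l)" if "l \<le> p" for l
  proof -
    \<comment> \<open>Upper negation yields an ordinary binomial coefficient, and its sign turns the
      power of 1 - t into one of t - 1.\<close>
    have "(- (of_nat l + 1 :: complex)) gchoose (p - l) = (-1) ^ (p - l) * ((of_nat l + 1 + of_nat (p - l) - 1) gchoose (p - l))"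
      by (rule gbinomial_minus)
    also have "(of_nat l + 1 + of_nat (p - l) - 1 :: complex) = of_nat p"
      using that by (simp add: of_nat_diff)
    also have "(of_nat p gchoose (p - l) :: complex) = of_nat (p choose l)"
      using that by (simp add: binomial_gbinomial[symmetric] binomial_symmetric[symmetric])
    finally have *: "(- (of_nat l + 1 :: complex)) gchoose (p - l) = (-1) ^ (p - l) * of_nat (p choose l)" .
    have "(t - 1) ^ (p - l) = (-1) ^ (p - l) * (1 - t) ^ (p - l)"
      by (simp flip: power_mult_distrib)
    moreover have "(of_nat 0 - of_nat l - 1 :: complex) = - (of_nat l + 1)" by simp
    ultimately show ?thesis using * by (simp only: mult_ac)
  qed
  then show ?case
    unfolding column_rescale_def by (auto intro!: sum.cong)
next
  case (Suc a)
  let ?c = "\<lambda>a l p. t ^ l * ((of_nat a - of_nat l - 1) gchoose (p - l)) * (1 - t) ^ (p - l)"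
  let ?X = "(mul_lin (1 - t) ^^ a) (column_rescale t f)"
  have "(mul_lin (1 - t) ^^ Suc a) (column_rescale t f) p = ?X p + (1 - t) *s shift ?X p"
    by (simp add: mul_lin_pow_Suc shift_def del: funpow.simps)
  also have "\<dots> = (\<Sum>l\<le>p. ?c (Suc a) l p *s f l)"
  proof (cases p)
    case 0
    then show ?thesis by (simp add: shift_def Suc.IH)
  next
    case (Suc p')
    have *: "?c a l p + (1 - t) * ?c a l p' = ?c (Suc a) l p" if "l \<le> p'" for l
    proof -
      have "(of_nat (Suc a) - of_nat l - 1 :: complex) = (of_nat a - of_nat l - 1) + 1" by simp
      then have "((of_nat (Suc a) - of_nat l - 1 :: complex) gchoose (Suc (p' - l)))
        = ((of_nat a - of_nat l - 1) gchoose (p' - l)) + ((of_nat a - of_nat l - 1) gchoose (Suc (p' - l)))"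
        by (metis gbinomial_Suc_Suc)
      then show ?thesis using that Suc by (simp add: Suc_diff_le algebra_simps)
    qed
    have "?X p + (1 - t) *s shift ?X p = (\<Sum>l\<le>p. ?c a l p *s f l) + (1 - t) *s (\<Sum>l\<le>p'. ?c a l p' *s f l)"
      using Suc by (simp add: shift_def Suc.IH)
    also have "\<dots> = (\<Sum>l\<le>p'. (?c a l p + (1 - t) * ?c a l p') *s f l) + ?c a p p *s f p"
      using Suc by (simp add: vec.scale_left_distrib sum.distrib vec.scale_sum_right)
    also have "\<dots> = (\<Sum>l\<le>p'. ?c (Suc a) l p *s f l) + ?c (Suc a) p p *s f p"
      by (intro arg_cong2[of _ _ _ _ "(+)"] sum.cong) (auto simp: *)
    also have "\<dots> = (\<Sum>l\<le>p. ?c (Suc a) l p *s f l)"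
      using Suc by simp
    finally show ?thesis .
  qed
  finally show ?case .
qed

lemma mul_lin_cong:
  assumes "\<And>l. l \<le> p \<Longrightarrow> f l = c *s g l"
  shows "(mul_lin b ^^ a) f p = c *s (mul_lin b ^^ a) g p"
  using assms
proof (induction a arbitrary: p)
  case (Suc a)
  then show ?case
    by (cases p) (auto simp: mul_lin_pow_Suc vec.scale_right_distrib mult_ac simp del: funpow.simps)
qed simp

lemma mul_lin_col_series:
  "(mul_lin b ^^ a) (col_series h k m j) p =
    (if p < k + m then 0 else (mul_lin b ^^ a) (\<lambda>l. h k l j) (p - (k + m)))"
proof (induction a arbitrary: p)
  case (Suc a)
  show ?case
  proof (cases "p \<le> k + m")
    case True
    then show ?thesis by (auto simp: mul_lin_pow_Suc Suc.IH simp del: funpow.simps)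
  next
    case False
    then have "p - 1 - (k + m) = p - (k + m) - 1" by simp
    with False show ?thesis by (auto simp: mul_lin_pow_Suc Suc.IH simp del: funpow.simps)
  qed
qed (simp add: col_series_def)

lemma divisible_mul_lin: "divisible Ps g \<Longrightarrow> divisible Ps ((mul_lin c ^^ a) g)"
  by (induction a) (auto simp: mul_lin_def intro!: divisible_series_add divisible_series_scale dest: divisible_shift)

text \<open>With b = k + m, substituting y_t into y^b and multiplying by (1 + (1 - t) y)^r gives t^b
  y^b (1 + (1 - t) y)^(r - b). Expressing the substituted column through
  \<open>column_rescale\<close> costs one more factor, whence the exponent r + 1 - b. Only degrees
  below r are compared, as \<open>h'\<close> is tied to \<open>h\<close> in the rows below
  r.\<close>

lemma rescale_col_series:
  assumes "k + m < r" "p < r"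
    and "\<And>l. l < r \<Longrightarrow> h' k l j = c *s column_rescale t (\<lambda>l. h k l j) l" "c \<noteq> 0"
  shows "rescale t r (col_series h k m j) p =
    (t ^ (k + m) / c) *s (mul_lin (1 - t) ^^ (Suc r - (k + m))) (col_series h' k m j) p"
proof (cases "p < k + m")
  case True
  have "rescale t r (col_series h k m j) p = 0"
    unfolding rescale_def by (rule sum.neutral) (use True in \<open>auto simp: col_series_def\<close>)
  then show ?thesis using True by (simp add: mul_lin_col_series)
next
  case False
  define b where "b = k + m"
  define p' where "p' = p - b"
  have p: "p = p' + b" using False by (simp add: p'_def b_def)
  let ?f = "\<lambda>l. h k l j"
  have "rescale t r (col_series h k m j) p
     = (\<Sum>q=b..p. (t ^ q * of_nat ((r - q) choose (p - q)) * (1 - t) ^ (p - q)) *s col_series h k m j q)"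
    unfolding rescale_def
    by (rule sum.mono_neutral_right) (auto simp: col_series_def b_def)
  also have "\<dots> = (\<Sum>l\<le>p'. (t ^ (l + b) * of_nat ((r - (l + b)) choose (p' - l)) * (1 - t) ^ (p' - l)) *s ?f l)"
    by (rule sum.reindex_bij_witness[of _ "\<lambda>l. l + b" "\<lambda>q. q - b"]) (auto simp: p col_series_def b_def)
  also have "\<dots> = t ^ b *s (\<Sum>l\<le>p'. (t ^ l * ((of_nat (Suc r - b) - of_nat l - 1) gchoose (p' - l)) * (1 - t) ^ (p' - l)) *s ?f l)"
    unfolding vec.scale_sum_right
  proof (rule sum.cong[OF refl])
    fix l assume "l \<in> {..p'}"
    then have "(of_nat (Suc r - b) - of_nat l - 1 :: complex) = of_nat (r - (l + b))"
      using p assms by (simp add: of_nat_diff Suc_diff_le)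
    then have "((of_nat (Suc r - b) - of_nat l - 1 :: complex) gchoose (p' - l)) = of_nat ((r - (l + b)) choose (p' - l))"
      by (simp add: binomial_gbinomial)
    then show "(t ^ (l + b) * of_nat ((r - (l + b)) choose (p' - l)) * (1 - t) ^ (p' - l)) *s ?f l
      = t ^ b *s ((t ^ l * ((of_nat (Suc r - b) - of_nat l - 1) gchoose (p' - l)) * (1 - t) ^ (p' - l)) *s ?f l)"
      by (simp add: power_add mult_ac)
  qed
  also have "\<dots> = t ^ b *s (mul_lin (1 - t) ^^ (Suc r - b)) (column_rescale t ?f) p'"
    by (simp only: mul_lin_column_rescale)
  also have "(mul_lin (1 - t) ^^ (Suc r - b)) (column_rescale t ?f) p' = (1 / c) *s (mul_lin (1 - t) ^^ (Suc r - b)) (\<lambda>l. h' k l j) p'"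
    by (rule mul_lin_cong) (use assms p in auto)
  finally show ?thesis
    using False by (simp add: mul_lin_col_series b_def p'_def)
qed

text \<open>Generators go to generators of the other module times a scalar and a power of 1 + (1 -
  t) y, both harmless for divisibility; agreement below degree r is enough.\<close>

lemma spanned_imp_divisible_rescale:
  assumes "frame_of P' h' J r" "spanned h J r g"
    and "\<And>k l j. l < r \<Longrightarrow> j \<in> {1..J} \<Longrightarrow> h' k l j = c j *s column_rescale t (\<lambda>l. h k l j) l"
    and "\<And>j. j \<in> {1..J} \<Longrightarrow> c j \<noteq> 0"
  shows "divisible (plist P' r) (rescale t r g)"
  using assms(2)
proof induction
  case (spanned_col k m j)
  have "divisible (plist P' r) (series_scale (t ^ (k + m) / c j) ((mul_lin (1 - t) ^^ (Suc r - (k + m))) (col_series h' k m j)))"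
    by (intro divisible_series_scale divisible_mul_lin divisible_col_series[OF assms(1)] spanned_col) simp
  then show ?case
    by (rule divisible_cong)
      (use rescale_col_series[of k m r _ h' j "c j" t h] spanned_col assms(3,4) in \<open>simp add: series_scale_def\<close>)
next
  case (spanned_high g)
  show ?case
    by (rule divisible_vanish) (auto simp: rescale_def spanned_high intro!: sum.neutral)
next
  case spanned_series_add then show ?case by (simp add: rescale_series_add divisible_series_add)
next
  case spanned_series_scale then show ?case by (simp add: rescale_series_scale divisible_series_scale)
qed

text \<open>The substitutions \<lambda> \<mapsto> t \<lambda> and \<lambda> \<mapsto> \<lambda> / t
  cancel, and so do the two denominators. In coefficients, the inner sum is the expansion of a power
  of (1 / t) (t - 1) + (1 / t - 1) = 0.\<close>

lemma column_rescale_inverse: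
  assumes "t \<noteq> 0"
  shows "column_rescale (1 / t) (column_rescale t f) = f"
proof
  fix p
  let ?s = "1 / t"
  let ?A = "\<lambda>l q. of_nat (p choose l) * ?s ^ l * (?s - 1) ^ (p - l) * (of_nat (l choose q) * t ^ q * (t - 1) ^ (l - q))"
  have "column_rescale ?s (column_rescale t f) p = (\<Sum>l\<le>p. \<Sum>q\<le>l. ?A l q *s f q)"
    by (simp add: column_rescale_def vec.scale_sum_right)
  also have "\<dots> = (\<Sum>q\<le>p. (\<Sum>l=q..p. ?A l q) *s f q)"
    by (simp only: sum_triangle_swap[symmetric] vec.scale_sum_left)
  also have "\<dots> = (\<Sum>q\<le>p. (if q = p then 1 else 0) *s f q)"
  proof (rule sum.cong[OF refl])
    fix q assume "q \<in> {..p}"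
    then have q: "q \<le> p" by simp
    have "(\<Sum>l=q..p. ?A l q) = (\<Sum>m\<le>p - q. of_nat (p choose q) * (of_nat ((p - q) choose m) * (?s * (t - 1)) ^ m * (?s - 1) ^ (p - q - m)))"
    proof (rule sum.reindex_bij_witness[of _ "\<lambda>m. q + m" "\<lambda>l. l - q"])
      fix l assume l: "l \<in> {q..p}"
      then have "(of_nat (p choose l) * of_nat (l choose q) :: complex) = of_nat (p choose q) * of_nat ((p - q) choose (l - q))"
        using choose_mult[of q l p] by (simp flip: of_nat_mult)
      moreover have "?s ^ l * t ^ q = ?s ^ (l - q)"
        using l assms by (simp add: power_diff field_simps power_one_over flip: power_add)
      moreover have "?A l q = (of_nat (p choose l) * of_nat (l choose q)) * (?s ^ l * t ^ q) * ((?s - 1) ^ (p - l) * (t - 1) ^ (l - q))"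
        by (simp only: mult_ac)
      ultimately have "?A l q = of_nat (p choose q) * of_nat ((p - q) choose (l - q)) * ?s ^ (l - q) * ((?s - 1) ^ (p - l) * (t - 1) ^ (l - q))"
        by (simp only:)
      moreover have "p - q - (l - q) = p - l" using l by auto
      ultimately show "of_nat (p choose q) * (of_nat ((p - q) choose (l - q)) * (?s * (t - 1)) ^ (l - q) * (?s - 1) ^ (p - q - (l - q))) = ?A l q"
        by (simp only: power_mult_distrib mult_ac)
    qed (use q in auto)
    also have "\<dots> = of_nat (p choose q) * (?s * (t - 1) + (?s - 1)) ^ (p - q)"
      by (subst binomial_ring) (simp add: sum_distrib_left)
    also have "?s * (t - 1) + (?s - 1) = 0"
      using assms by (simp add: field_simps)
    also have "of_nat (p choose q) * 0 ^ (p - q) = (if q = p then 1 else 0 :: complex)"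
      using q by auto
    finally show "(\<Sum>l=q..p. ?A l q) *s f q = (if q = p then 1 else 0) *s f q" by simp
  qed
  also have "\<dots> = f p"
    by (simp add: if_distrib[of "\<lambda>c. c *s _"] cong: if_cong)
  finally show "column_rescale ?s (column_rescale t f) p = f p" .
qed

lemma column_rescale_scale: "column_rescale t (\<lambda>l. c *s f l) p = c *s column_rescale t f p"
  by (simp add: column_rescale_def vec.scale_sum_right mult_ac)

lemma column_rescale_cong: "(\<And>l. l \<le> p \<Longrightarrow> f l = g l) \<Longrightarrow> column_rescale t f p = column_rescale t g p"
  by (simp add: column_rescale_def)

lemma column_rescale_relation_inverse:
  assumes "\<And>k l j. l < r \<Longrightarrow> j \<in> {1..J} \<Longrightarrow> h' k l j = c j *s column_rescale t (\<lambda>l. h k l j) l"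
    and "\<And>j. j \<in> {1..J} \<Longrightarrow> c j \<noteq> 0" "t \<noteq> 0" "l < r" "j \<in> {1..J}"
  shows "h k l j = (1 / c j) *s column_rescale (1 / t) (\<lambda>l. h' k l j) l"
proof -
  have "column_rescale (1 / t) (\<lambda>l. h' k l j) l = column_rescale (1 / t) (\<lambda>l. c j *s column_rescale t (\<lambda>l. h k l j) l) l"
    by (rule column_rescale_cong) (use assms in auto)
  also have "\<dots> = c j *s h k l j"
    using column_rescale_inverse[OF assms(3), of "\<lambda>l. h k l j"] by (simp add: column_rescale_scale)
  finally show ?thesis using assms by simp
qed

section \<open>Polynomial dependence on the loop parameter\<close>

lemma bernstein_monomials: "\<exists>b. \<forall>x. bernstein M g x = (\<Sum>m\<le>M. x ^ m *s b m)"
proof -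
  define p :: "nat \<Rightarrow> complex poly" where "p q = monom 1 q * [:1, -1:] ^ (M - q)" for q
  have deg: "degree (p q) \<le> M" if "q \<le> M" for q
  proof -
    have "degree ([:1, -1 :: complex:] ^ (M - q)) \<le> M - q"
      by (rule order_trans[OF degree_power_le]) simp
    then show ?thesis
      using that degree_mult_le[of "monom 1 q" "[:1, -1 :: complex:] ^ (M - q)"]
      by (simp add: p_def degree_monom_eq)
  qed
  have eval: "x ^ q * (1 - x) ^ (M - q) = (\<Sum>m\<le>M. coeff (p q) m * x ^ m)" if "q \<le> M" for q and x :: complex
  proof -
    have "x ^ q * (1 - x) ^ (M - q) = poly (p q) x"
      by (simp add: p_def poly_monom)
    also have "\<dots> = (\<Sum>m\<le>degree (p q). coeff (p q) m * x ^ m)"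
      by (rule poly_altdef)
    also have "\<dots> = (\<Sum>m\<le>M. coeff (p q) m * x ^ m)"
      by (rule sum.mono_neutral_left) (use deg[OF that] in \<open>auto simp: coeff_eq_0\<close>)
    finally show ?thesis .
  qed
  show ?thesis
  proof (intro exI allI)
    fix x
    have "bernstein M g x = (\<Sum>q\<le>M. \<Sum>m\<le>M. (x ^ m * coeff (p q) m) *s g q)"
      unfolding bernstein_def by (rule sum.cong) (simp_all add: eval vec.scale_sum_left mult.commute)
    also have "\<dots> = (\<Sum>m\<le>M. x ^ m *s (\<Sum>q\<le>M. coeff (p q) m *s g q))"
      by (subst sum.swap) (simp add: vec.scale_sum_right)
    finally show "bernstein M g x = (\<Sum>m\<le>M. x ^ m *s (\<Sum>q\<le>M. coeff (p q) m *s g q))" .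
  qed
qed

definition const_series :: "complex^'n \<Rightarrow> nat \<Rightarrow> complex^'n" where
  "const_series a q = (if q = 0 then a else 0)"

lemma Phi_const: "Phi Ps x *v a = bernstein (length Ps) (S_op Ps (const_series a)) x"
  using Phi_bernstein[of 0 "const_series a" Ps x] by (simp add: const_series_def bernstein_def)

text \<open>The polynomial \<Phi>(\<lambda>) a is (1 - \<lambda>)^r times a series in \<Phi> H_+,
  hence comes from a combination of generators. Its rescaling lies in the module of the other loop,
  and dividing by that loop leaves a polynomial of degree at most r.\<close>

lemma Phi_flow_vector:
  assumes "frame_of P h J r" "frame_of P' h' J r"
    and "\<And>k l j. l < r \<Longrightarrow> j \<in> {1..J} \<Longrightarrow> h' k l j = c j *s column_rescale t (\<lambda>l. h k l j) l"
    and "\<And>j. j \<in> {1..J} \<Longrightarrow> c j \<noteq> 0"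
  shows "\<exists>b. \<forall>x. Phi (plist P r) (t * x) *v a = Phi (plist P' r) x *v (\<Sum>m\<le>r. x ^ m *s b m)"
proof -
  let ?g = "S_op (plist P r) (const_series a)"
  have supp: "?g q = 0" if "q > r" for q
    using S_op_vanish[where M = 0 and g = "const_series a" and q = q and Ps = "plist P r"] that by (simp add: const_series_def)
  have "divisible (plist P r) ?g"
    using divisible_S_op frame_of_idem[OF assms(1) order_refl] by blast
  then have "spanned h J r ?g" by (rule divisible_imp_spanned[OF assms(1) order_refl])
  then have *: "divisible (plist P' r) (rescale t r ?g)"
    by (rule spanned_imp_divisible_rescale[OF assms(2)]) (use assms in auto)
  have "Phi (plist P r) (t * x) *v a = Phi (plist P' r) x *v bernstein r (T_op (plist P' r) (rescale t r ?g)) x" for x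
    using Phi_bernstein_T_op[OF frame_of_idem[OF assms(2) order_refl] * rescale_vanish[OF supp], where x = x]
    by (simp add: Phi_const bernstein_rescale)
  then show ?thesis using bernstein_monomials[of r "T_op (plist P' r) (rescale t r ?g)"] by metis
qed

lemma mult_axis_nth: "(A *v axis i 1) $ k = A $ k $ i" for A :: "complex^'n^'n"
proof -
  have "(\<Sum>j\<in>UNIV. A $ k $ j * (if j = i then 1 else 0)) = (\<Sum>j\<in>UNIV. if j = i then A $ k $ j else 0)"
    by (rule sum.cong) auto
  then show ?thesis by (simp add: matrix_vector_mult_def axis_def)
qed

lemma matrix_eq_columns: "(\<And>i. A *v axis i 1 = B *v axis i 1) \<Longrightarrow> A = B" for A :: "complex^'n^'n"
  unfolding vec_eq_iff by (metis mult_axis_nth)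

definition poly_loop :: "nat \<Rightarrow> (nat \<Rightarrow> complex^'n^'n) \<Rightarrow> complex \<Rightarrow> complex^'n^'n" where
  "poly_loop N A x = (\<Sum>m\<le>N. mat (x ^ m) ** A m)"

lemma poly_loop_mult_axis:
  "poly_loop N (\<lambda>m. \<chi> k i. b i m $ k) x *v axis i 1 = (\<Sum>m\<le>N. x ^ m *s b i m)"
  by (simp add: poly_loop_def vec_eq_iff mult_axis_nth mat_mult_left)

theorem Phi_flow:
  assumes "frame_of P h J r" "frame_of P' h' J r"
    and "\<And>k l j. l < r \<Longrightarrow> j \<in> {1..J} \<Longrightarrow> h' k l j = c j *s column_rescale t (\<lambda>l. h k l j) l"
    and "\<And>j. j \<in> {1..J} \<Longrightarrow> c j \<noteq> 0"
  shows "\<exists>D. \<forall>x. Phi (plist P r) (t * x) = Phi (plist P' r) x ** poly_loop r D x"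
proof -
  have "\<forall>i. \<exists>b. \<forall>x. Phi (plist P r) (t * x) *v axis i 1 = Phi (plist P' r) x *v (\<Sum>m\<le>r. x ^ m *s b m)"
    using Phi_flow_vector[OF assms] by blast
  then obtain b where b: "\<And>i x. Phi (plist P r) (t * x) *v axis i 1 = Phi (plist P' r) x *v (\<Sum>m\<le>r. x ^ m *s b i m)"
    by metis
  have "Phi (plist P r) (t * x) = Phi (plist P' r) x ** poly_loop r (\<lambda>m. \<chi> k i. b i m $ k) x" for x
    by (rule matrix_eq_columns) (simp add: b poly_loop_mult_axis flip: matrix_vector_mul_assoc)
  then show ?thesis by blast
qed

lemma Phi_poly_loop: "\<exists>D. \<forall>x. Phi Ps x = poly_loop (length Ps) D x"
proof -
  have "\<forall>i. \<exists>b. \<forall>x. Phi Ps x *v axis i 1 = (\<Sum>m\<le>length Ps. x ^ m *s b m)"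
    unfolding Phi_const using bernstein_monomials by blast
  then obtain b where b: "\<And>i x. Phi Ps x *v axis i 1 = (\<Sum>m\<le>length Ps. x ^ m *s b i m)"
    by metis
  have "Phi Ps x = poly_loop (length Ps) (\<lambda>m. \<chi> k i. b i m $ k) x" for x
    by (rule matrix_eq_columns) (simp add: b poly_loop_mult_axis)
  then show ?thesis by blast
qed

section \<open>Analysis: extending the bundles over the whole sphere\<close>

section \<open>Unitarity on the circle\<close>

definition cinner :: "complex^'n \<Rightarrow> complex^'n \<Rightarrow> complex" where
  "cinner v w = (\<Sum>a\<in>UNIV. cnj (v $ a) * w $ a)"

lemma cinner_adj: "cinner (A *v v) w = cinner v (adj A *v w)" for A :: "complex^'n^'n"
proof -
  have "cinner (A *v v) w = (\<Sum>a\<in>UNIV. \<Sum>b\<in>UNIV. cnj (A $ a $ b) * cnj (v $ b) * w $ a)"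
    by (simp add: cinner_def matrix_vector_mult_def sum_distrib_right)
  also have "\<dots> = (\<Sum>b\<in>UNIV. \<Sum>a\<in>UNIV. cnj (A $ a $ b) * cnj (v $ b) * w $ a)"
    by (rule sum.swap)
  also have "\<dots> = cinner v (adj A *v w)"
    by (simp add: cinner_def matrix_vector_mult_def adj_def sum_distrib_left mult_ac)
  finally show ?thesis .
qed

lemma cinner_add_left: "cinner (u + v) w = cinner u w + cinner v w"
  by (simp add: cinner_def distrib_right sum.distrib)

lemma cinner_scale_left: "cinner (c *s v) w = cnj c * cinner v w"
  by (simp add: cinner_def sum_distrib_left mult_ac)

lemma cinner_sum_left: "cinner (\<Sum>x\<in>X. f x) w = (\<Sum>x\<in>X. cinner (f x) w)"
  by (induction X rule: infinite_finite_induct) (simp_all add: cinner_add_left, simp_all add: cinner_def)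

lemma adj_mult: "adj (A ** B) = adj B ** adj A"
  by (simp add: adj_def matrix_matrix_mult_def vec_eq_iff mult.commute)

lemma adj_add: "adj (A + B) = adj A + adj B"
  by (simp add: adj_def vec_eq_iff)

lemma adj_diff: "adj (A - B) = adj A - adj B"
  by (simp add: adj_def vec_eq_iff)

lemma adj_mat: "adj (mat c) = mat (cnj c)"
  by (simp add: adj_def mat_def vec_eq_iff)

lemma adj_adj [simp]: "adj (adj A) = A"
  by (simp add: adj_def vec_eq_iff)

lemma mat_commute: "A ** mat c = mat c ** A" for A :: "complex^'n^'n"
proof -
  have "A ** mat c *v v = mat c ** A *v v" for v
    by (simp add: mat_mult_vector mat_vector_mult mult_vec_scale flip: matrix_vector_mul_assoc)
  then show ?thesis by (simp add: matrix_eq)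
qed

lemma mat_mult_mat: "mat a ** (mat b :: complex^'n^'n) = mat (a * b)"
  by (simp add: matrix_eq mat_mult_vector mat_vector_mult)

lemma Phi_append: "Phi (Ps @ Qs) x = Phi Ps x ** Phi Qs x"
  by (induction Ps) (auto simp: matrix_mul_assoc)

lemma proj_factor_inverse:
  fixes P :: "complex^'n^'n"
  assumes "P ** P = P" "x * y = 1"
  shows "(P + mat x ** (mat 1 - P)) ** (P + mat y ** (mat 1 - P)) = mat 1"
proof -
  have P: "P *v (P *v v) = P *v v" for v
    using assms(1) by (simp add: matrix_vector_mul_assoc)
  have "(P + mat x ** (mat 1 - P)) ** (P + mat y ** (mat 1 - P)) *v v = mat 1 *v v" for v
    by (simp add: mv_simps P assms(2) mat_vector_mult mult.commute[of y x] flip: matrix_vector_mul_assoc)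
  then show ?thesis by (simp add: matrix_eq)
qed

lemma Phi_rev_inverse:
  assumes "\<forall>P\<in>set Ps. P ** P = P" "x \<noteq> 0"
  shows "Phi (rev Ps) (inverse x) ** Phi Ps x = mat 1" "Phi Ps x ** Phi (rev Ps) (inverse x) = mat 1"
proof -
  have "Phi (rev Ps) (inverse x) ** Phi Ps x = mat 1 \<and> Phi Ps x ** Phi (rev Ps) (inverse x) = mat 1"
    using assms(1)
  proof (induction Ps)
    case (Cons P Ps)
    let ?F = "\<lambda>x. P + mat x ** (mat 1 - P)"
    have F: "?F (inverse x) ** ?F x = mat 1" "?F x ** ?F (inverse x) = mat 1"
      by (rule proj_factor_inverse; use Cons.prems assms(2) in simp)+
    have "Phi (rev (P # Ps)) (inverse x) ** Phi (P # Ps) x =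
        Phi (rev Ps) (inverse x) ** (?F (inverse x) ** ?F x) ** Phi Ps x"
      by (simp add: Phi_append matrix_mul_assoc)
    moreover have "Phi (P # Ps) x ** Phi (rev (P # Ps)) (inverse x) =
        ?F x ** (Phi Ps x ** Phi (rev Ps) (inverse x)) ** ?F (inverse x)"
      by (simp add: Phi_append matrix_mul_assoc)
    ultimately show ?case using Cons F by simp
  qed simp
  then show "Phi (rev Ps) (inverse x) ** Phi Ps x = mat 1" "Phi Ps x ** Phi (rev Ps) (inverse x) = mat 1"
    by auto
qed

lemma adj_Phi:
  assumes "\<forall>P\<in>set Ps. adj P = P" "norm x = 1"
  shows "adj (Phi Ps x) = Phi (rev Ps) (inverse x)"
  using assms(1)
proof (induction Ps)
  case (Cons P Ps)
  have "x * cnj x = 1"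
    using assms(2) complex_norm_square[of x] by simp
  then have "cnj x = inverse x"
    by (simp add: inverse_unique)
  then have "adj (P + mat x ** (mat 1 - P)) = P + mat (inverse x) ** (mat 1 - P)"
    using Cons.prems by (simp add: adj_add adj_mult adj_diff adj_mat mat_commute)
  then show ?case using Cons by (simp add: Phi_append adj_mult)
qed (simp add: adj_mat)

lemma Phi_unitary:
  assumes "\<forall>P\<in>set Ps. P ** P = P" "\<forall>P\<in>set Ps. adj P = P" "norm x = 1"
  shows "Phi Ps x \<in> unitary_group"
proof -
  have "x \<noteq> 0" using assms(3) by auto
  then show ?thesis
    using Phi_rev_inverse[OF assms(1)] adj_Phi[OF assms(2,3)] by (simp add: unitary_group_def)
qed

lemma Phi_1: "Phi Ps 1 = mat 1"
  by (induction Ps) auto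

section \<open>Averaging over roots of unity\<close>

definition runity :: "nat \<Rightarrow> nat \<Rightarrow> complex" where
  "runity N l = cis (2 * pi * l / N)"

lemma norm_runity [simp]: "norm (runity N l) = 1"
  by (simp add: runity_def)

lemma runity_0 [simp]: "runity N 0 = 1"
  by (simp add: runity_def)

lemma sum_runity_power:
  assumes "0 < m" "m < N"
  shows "(\<Sum>l<N. runity N l ^ m) = 0"
proof -
  define z where "z = cis (2 * pi * m / N)"
  have "runity N l ^ m = z ^ l" for l
    by (simp add: runity_def z_def Complex.DeMoivre mult_ac)
  then have "(\<Sum>l<N. runity N l ^ m) = (\<Sum>l<N. z ^ l)" by simp
  moreover have "z \<noteq> 1"
  proof
    assume "z = 1"
    then have "cos (2 * pi * m / N) = 1" by (simp add: z_def complex_eq_iff)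
    then obtain k :: int where "2 * pi * m / N = of_int k * 2 * pi"
      using cos_one_2pi_int by blast
    then have "real m = of_int k * real N" using assms by (simp add: field_simps)
    then have "int m = k * int N" by (metis of_int_eq_iff of_int_mult of_int_of_nat_eq)
    then have "int N dvd int m" by simp
    then show False using assms by (auto dest: dvd_imp_le)
  qed
  moreover have "z ^ N = 1"
    using assms by (simp add: z_def Complex.DeMoivre cis_multiple_2pi[of "real m", simplified])
  ultimately show ?thesis by (simp add: geometric_sum)
qed

lemma sum_runity_cnj:
  assumes "m < N" "m' < N"
  shows "(\<Sum>l<N. cnj (runity N l) ^ m * runity N l ^ m') = (if m = m' then of_nat N else 0)"
proof -
  have norm1: "cnj (runity N l) * runity N l = 1" for l
    using complex_norm_square[of "runity N l"] by (simp add: mult.commute)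
  have cancel: "cnj (runity N l) ^ k * runity N l ^ k = 1" for l k
    by (simp add: norm1 flip: power_mult_distrib)
  consider "m = m'" | "m < m'" | "m' < m" by linarith
  then show ?thesis
  proof cases
    case 1
    then show ?thesis by (simp add: cancel)
  next
    case 2
    then have "runity N l ^ m' = runity N l ^ m * runity N l ^ (m' - m)" for l
      by (simp flip: power_add)
    then have "cnj (runity N l) ^ m * runity N l ^ m' = runity N l ^ (m' - m)" for l
      using cancel[of l m] by (simp flip: mult.assoc)
    then show ?thesis using sum_runity_power[of "m' - m" N] 2 assms by simp
  next
    case 3
    then have "cnj (runity N l) ^ m = cnj (runity N l) ^ (m - m') * cnj (runity N l) ^ m'" for l
      by (simp flip: power_add)
    then have "cnj (runity N l) ^ m * runity N l ^ m' = cnj (runity N l ^ (m - m'))" for l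
      using cancel[of l m'] by (simp add: mult.assoc)
    then have "(\<Sum>l<N. cnj (runity N l) ^ m * runity N l ^ m') = cnj (\<Sum>l<N. runity N l ^ (m - m'))"
      by (simp only: cnj_sum)
    then show ?thesis using sum_runity_power[of "m - m'" N] 3 assms by simp
  qed
qed

text \<open>The degree in \<lambda> is at most M, so none of the nonconstant monomials survives the
  sum over M + 1 roots of unity; the constant term is the value at \<lambda> = 0.\<close>

lemma bernstein_mean: "(\<Sum>l<Suc M. bernstein M g (runity (Suc M) l)) = of_nat (Suc M) *s g 0"
proof -
  obtain b where b: "\<And>x. bernstein M g x = (\<Sum>m\<le>M. x ^ m *s b m)"
    using bernstein_monomials by blast
  have "bernstein M g 0 = g 0"
  proof -
    have "bernstein M g 0 = (\<Sum>q\<le>M. if q = 0 then g 0 else 0)"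
      unfolding bernstein_def by (rule sum.cong) auto
    then show ?thesis by simp
  qed
  moreover have "(\<Sum>m\<le>M. 0 ^ m *s b m) = (\<Sum>m\<le>M. if m = 0 then b 0 else 0)"
    by (rule sum.cong) auto
  ultimately have b0: "b 0 = g 0" using b[of 0] by simp
  have "(\<Sum>l<Suc M. bernstein M g (runity (Suc M) l)) = (\<Sum>m\<le>M. (\<Sum>l<Suc M. runity (Suc M) l ^ m) *s b m)"
    unfolding b by (subst sum.swap) (simp only: vec.scale_sum_left)
  also have "\<dots> = (\<Sum>m\<le>M. if m = 0 then of_nat (Suc M) *s b 0 else 0)"
  proof (rule sum.cong[OF refl])
    fix m assume "m \<in> {..M}"
    then show "(\<Sum>l<Suc M. runity (Suc M) l ^ m) *s b m = (if m = 0 then of_nat (Suc M) *s b 0 else 0)"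
      using sum_runity_power[of m "Suc M"] by (cases "m = 0") (simp_all del: sum.lessThan_Suc of_nat_Suc)
  qed
  also have "\<dots> = of_nat (Suc M) *s g 0"
    by (simp add: b0)
  finally show ?thesis .
qed

text \<open>Multiplying a vector of the next bundle by \<Phi>_i gives an element of \<Phi>_(i+1) H_+
  of degree at most i in \<lambda>. It involves only the coefficients up to y^i, so its expansion in
  generators modulo y^(i + 1) is exact.\<close>

lemma proj_in_column_span:
  assumes "frame_of P h J (Suc i)"
  shows "\<exists>c. \<forall>x. Phi (plist P i) x *v (P (Suc i) *v v) =
    (\<Sum>(k, m, j)\<in>spanned_index (Suc i) J. c (k, m, j) *s bernstein i (col_series h k m j) x)"
proof -
  let ?g = "S_op (plist P i) (const_series (P (Suc i) *v v))"
  have idem: "\<forall>R\<in>set (plist P i). R ** R = R" "P (Suc i) ** P (Suc i) = P (Suc i)"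
    using frame_of_idem[OF assms, of i] assms by (auto simp: frame_of_def)
  have "divisible (plist P (Suc i)) ?g"
    using divisible_S_op[OF idem(1), of "const_series (P (Suc i) *v v)"] idem(2)
    by (simp add: plist_Suc divisible_append const_series_def matrix_vector_mul_assoc)
  from spanned_imp_sum[OF divisible_imp_spanned[OF assms order_refl this]]
  obtain c where c: "\<And>q. q < Suc i \<Longrightarrow> ?g q = (\<Sum>(k, m, j)\<in>spanned_index (Suc i) J. c (k, m, j) *s col_series h k m j q)"
    by blast
  show ?thesis
  proof (intro exI allI)
    fix x
    have "Phi (plist P i) x *v (P (Suc i) *v v) = bernstein i ?g x"
      by (simp add: Phi_const)
    also have "\<dots> = bernstein i (\<lambda>q. \<Sum>(k, m, j)\<in>spanned_index (Suc i) J. c (k, m, j) *s col_series h k m j q) x"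
      by (rule bernstein_cong) (simp add: c)
    also have "\<dots> = (\<Sum>(k, m, j)\<in>spanned_index (Suc i) J. c (k, m, j) *s bernstein i (col_series h k m j) x)"
      unfolding bernstein_def case_prod_beta vec.scale_sum_right
      by (subst sum.swap) (simp add: mult_ac)
    finally show "Phi (plist P i) x *v (P (Suc i) *v v) =
      (\<Sum>(k, m, j)\<in>spanned_index (Suc i) J. c (k, m, j) *s bernstein i (col_series h k m j) x)" .
  qed
qed

text \<open>On polynomials of degree at most \<open>i\<close>, the mean over the roots of unity of order \<open>i + 1\<close> is the mean over the circle.\<close>

lemma compl_orth_column:
  assumes "frame_of P h J (Suc i)" "\<And>m. m \<le> i \<Longrightarrow> adj (P (Suc m)) = P (Suc m)" "j \<in> {1..J}"
  shows "(\<Sum>l<Suc i. cinner (bernstein i (col_series h k m j) (runity (Suc i) l))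
           (Phi (plist P i) (runity (Suc i) l) *v (v - P (Suc i) *v v))) = 0"
proof -
  \<comment> \<open>Truncation leaves \<open>bernstein i\<close> unchanged and provides the finite
    support that the division identity requires.\<close>
  define g where "g q = (if q \<le> i then col_series h k m j q else 0)" for q
  have idem: "\<forall>R\<in>set (plist P i). R ** R = R" "P (Suc i) ** P (Suc i) = P (Suc i)"
    using frame_of_idem[OF assms(1), of i] assms(1) by (auto simp: frame_of_def)
  have herm: "\<forall>R\<in>set (plist P i). adj R = R"
    using assms(2) by (auto simp: set_plist Suc_le_eq dest!: gr0_implies_Suc)
  have "divisible (plist P (Suc i)) g"
    by (rule divisible_cong[OF divisible_col_series[OF assms(1) order_refl assms(3)]]) (simp add: g_def)
  then have g: "divisible (plist P i) g" "P (Suc i) *v T_op (plist P i) g 0 = T_op (plist P i) g 0"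
    by (simp_all add: plist_Suc divisible_append)
  let ?u = "T_op (plist P i) g" and ?w = "v - P (Suc i) *v v"
  \<comment> \<open>On the circle \<Phi>_i is unitary and cancels from both arguments; a polynomial
    paired with a fixed vector remains.\<close>
  have "cinner (bernstein i (col_series h k m j) x) (Phi (plist P i) x *v ?w) = cinner (bernstein i ?u x) ?w"
    if "norm x = 1" for x
  proof -
    have "bernstein i (col_series h k m j) x = bernstein i g x"
      by (rule bernstein_cong) (simp add: g_def)
    also have "\<dots> = Phi (plist P i) x *v bernstein i ?u x"
      by (rule Phi_bernstein_T_op[OF idem(1) g(1), symmetric]) (simp add: g_def)
    finally have "cinner (bernstein i (col_series h k m j) x) (Phi (plist P i) x *v ?w)
        = cinner (bernstein i ?u x) ((adj (Phi (plist P i) x) ** Phi (plist P i) x) *v ?w)"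
      by (simp add: cinner_adj matrix_vector_mul_assoc)
    then show ?thesis
      using Phi_unitary[OF idem(1) herm that] by (simp add: unitary_group_def)
  qed
  then have "(\<Sum>l<Suc i. cinner (bernstein i (col_series h k m j) (runity (Suc i) l))
           (Phi (plist P i) (runity (Suc i) l) *v ?w)) = cinner (\<Sum>l<Suc i. bernstein i ?u (runity (Suc i) l)) ?w"
    by (simp only: norm_runity cinner_sum_left)
  also have "\<dots> = of_nat (Suc i) * cinner (?u 0) ?w"
    by (simp only: bernstein_mean cinner_scale_left complex_cnj_of_nat)
  \<comment> \<open>The mean of that polynomial lies in the range of the projection, the fixed
    vector in its kernel.\<close>
  also have "cinner (?u 0) ?w = cinner (P (Suc i) *v ?u 0) ?w"
    using g(2) by simp
  also have "\<dots> = cinner (?u 0) (P (Suc i) *v ?w)"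
    using assms(2)[OF order_refl] by (simp add: cinner_adj)
  also have "P (Suc i) *v ?w = 0"
    using idem(2) by (simp add: mv_simps matrix_vector_mul_assoc)
  finally show ?thesis by (simp add: cinner_def)
qed

section \<open>Orthogonal projection in coordinates\<close>

definition coord_inner :: "'a set \<Rightarrow> ('a \<Rightarrow> complex) \<Rightarrow> ('a \<Rightarrow> complex) \<Rightarrow> complex" where
  "coord_inner I u w = (\<Sum>a\<in>I. cnj (u a) * w a)"

lemma coord_inner_diff_right: "coord_inner I u (\<lambda>a. v a - w a) = coord_inner I u v - coord_inner I u w"
  by (simp add: coord_inner_def right_diff_distrib sum_subtractf)

lemma coord_inner_scale_right: "coord_inner I u (\<lambda>a. c * w a) = c * coord_inner I u w"
  by (simp add: coord_inner_def sum_distrib_left mult_ac)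

lemma coord_inner_sum_left: "coord_inner I (\<lambda>a. \<Sum>b\<in>B. c b * v b a) w = (\<Sum>b\<in>B. cnj (c b) * coord_inner I (v b) w)"
  unfolding coord_inner_def by (simp add: sum_distrib_right sum_distrib_left mult.assoc) (rule sum.swap)

lemma coord_inner_cong: "(\<And>a. a \<in> I \<Longrightarrow> u a = u' a) \<Longrightarrow> (\<And>a. a \<in> I \<Longrightarrow> w a = w' a) \<Longrightarrow> coord_inner I u w = coord_inner I u' w'"
  by (simp add: coord_inner_def)

lemma coord_inner_self: "coord_inner I u u = of_real (\<Sum>a\<in>I. (norm (u a))\<^sup>2)"
  by (simp only: coord_inner_def of_real_sum complex_norm_square mult.commute)

lemma coord_inner_self_eq_0: "finite I \<Longrightarrow> coord_inner I u u = 0 \<Longrightarrow> a \<in> I \<Longrightarrow> u a = 0"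
proof -
  assume "finite I" "coord_inner I u u = 0" "a \<in> I"
  then have "(\<Sum>a\<in>I. (norm (u a))\<^sup>2) = 0" by (simp only: coord_inner_self of_real_eq_0_iff)
  then have "(norm (u a))\<^sup>2 = 0"
    using sum_nonneg_eq_0_iff[of I "\<lambda>a. (norm (u a))\<^sup>2"] \<open>finite I\<close> \<open>a \<in> I\<close> by simp
  then show "u a = 0" by simp
qed

text \<open>Gram-Schmidt without independence: both x and the new vector are projected onto the old
  span, and the result is corrected along the component \<open>e\<close> of the new vector
  orthogonal to that span.\<close>

lemma orth_coefficients_exist:
  assumes "finite B" "finite I"
  shows "\<exists>c. \<forall>b\<in>B. coord_inner I (v b) (\<lambda>a. x a - (\<Sum>b'\<in>B. c b' * v b' a)) = 0"
  using assms(1)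
proof (induction B arbitrary: x)
  case (insert b B)
  obtain c where c: "\<And>b'. b' \<in> B \<Longrightarrow> coord_inner I (v b') (\<lambda>a. x a - (\<Sum>b'\<in>B. c b' * v b' a)) = 0"
    using insert.IH by blast
  obtain d where d: "\<And>b'. b' \<in> B \<Longrightarrow> coord_inner I (v b') (\<lambda>a. v b a - (\<Sum>b'\<in>B. d b' * v b' a)) = 0"
    using insert.IH by blast
  define e where "e a = v b a - (\<Sum>b'\<in>B. d b' * v b' a)" for a
  define \<rho> where "\<rho> a = x a - (\<Sum>b'\<in>B. c b' * v b' a)" for a
  have e: "coord_inner I (v b') e = 0" and \<rho>: "coord_inner I (v b') \<rho> = 0" if "b' \<in> B" for b'
    using c[OF that] d[OF that] by (simp_all add: e_def[abs_def] \<rho>_def[abs_def])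
  \<comment> \<open>If the new vector already lies in the old span, \<open>e\<close> vanishes on I
    and division by zero gives the coefficient 0.\<close>
  define \<tau> where "\<tau> = coord_inner I e \<rho> / coord_inner I e e"
  define R where "R a = \<rho> a - \<tau> * e a" for a
  have RB: "coord_inner I (v b') R = 0" if "b' \<in> B" for b'
    using e[OF that] \<rho>[OF that] by (simp add: R_def[abs_def] coord_inner_diff_right coord_inner_scale_right)
  have Re: "coord_inner I e R = 0"
  proof (cases "coord_inner I e e = 0")
    case True
    then have "\<And>a. a \<in> I \<Longrightarrow> e a = 0" using coord_inner_self_eq_0[OF assms(2)] by blast
    then show ?thesis by (simp add: coord_inner_def)
  next
    case False
    moreover have "coord_inner I e R = coord_inner I e \<rho> - \<tau> * coord_inner I e e"
      by (simp add: R_def[abs_def] coord_inner_diff_right coord_inner_scale_right)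
    ultimately show ?thesis by (simp add: \<tau>_def)
  qed
  have "coord_inner I (v b) R = coord_inner I e R + coord_inner I (\<lambda>a. \<Sum>b'\<in>B. d b' * v b' a) R"
    by (simp add: coord_inner_def e_def sum.distrib[symmetric] algebra_simps)
  also have "\<dots> = 0"
    using RB Re by (simp add: coord_inner_sum_left)
  finally have Rb: "coord_inner I (v b) R = 0" .
  define c' where "c' b' = (if b' = b then \<tau> else c b' - \<tau> * d b')" for b'
  have R_eq: "R a = x a - (\<Sum>b'\<in>insert b B. c' b' * v b' a)" for a
  proof -
    have "(\<Sum>b'\<in>B. c' b' * v b' a) = (\<Sum>b'\<in>B. c b' * v b' a - \<tau> * (d b' * v b' a))"
      by (rule sum.cong) (use insert.hyps in \<open>auto simp: c'_def algebra_simps\<close>)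
    then show ?thesis using insert.hyps
      by (simp add: R_def \<rho>_def e_def c'_def sum_subtractf sum_distrib_left algebra_simps)
  qed
  have "\<forall>b'\<in>insert b B. coord_inner I (v b') (\<lambda>a. x a - (\<Sum>b'\<in>insert b B. c' b' * v b' a)) = 0"
    unfolding R_eq[symmetric] using Rb RB by simp
  then show ?case by blast
qed simp

section \<open>Subspaces in graph form\<close>

text \<open>The coordinates in S are free and determine the others linearly. Spanning vectors may
  blow up or become dependent at a pole, whereas the coefficients \<open>g\<close> are determined by
  the subspace, and when they converge the dimension is preserved in the limit.\<close>

definition in_graph :: "'a set \<Rightarrow> 'a set \<Rightarrow> ('a \<Rightarrow> 'a \<Rightarrow> complex) \<Rightarrow> ('a \<Rightarrow> complex) \<Rightarrow> bool" where
  "in_graph I S g x \<longleftrightarrow> (\<forall>a\<in>I - S. x a = (\<Sum>s\<in>S. g a s * x s))"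

definition lift_graph :: "'a set \<Rightarrow> ('a \<Rightarrow> 'a \<Rightarrow> complex) \<Rightarrow> ('a \<Rightarrow> complex) \<Rightarrow> 'a \<Rightarrow> complex" where
  "lift_graph S g y a = (if a \<in> S then y a else (\<Sum>s\<in>S. g a s * y s))"

lemma in_graph_lift: "in_graph I S g (lift_graph S g y)"
  by (simp add: in_graph_def lift_graph_def)

lemma in_graph_eq_lift: "in_graph I S g x \<Longrightarrow> a \<in> I \<Longrightarrow> x a = lift_graph S g x a"
  by (simp add: in_graph_def lift_graph_def)

lemma in_graph_diff: "in_graph I S g x \<Longrightarrow> in_graph I S g y \<Longrightarrow> in_graph I S g (\<lambda>a. x a - y a)"
  by (simp add: in_graph_def right_diff_distrib sum_subtractf)

lemma graph_projection_exists:
  assumes "finite I" "S \<subseteq> I"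
  shows "\<exists>p. in_graph I S g p \<and> (\<forall>y. in_graph I S g y \<longrightarrow> coord_inner I y (\<lambda>a. x a - p a) = 0)"
proof -
  define e where "e s = lift_graph S g (\<lambda>a. if a = s then 1 else 0)" for s
  have fin: "finite S" using assms finite_subset by blast
  have expand: "(\<Sum>s\<in>S. c s * e s a) = lift_graph S g c a" for c a
  proof (cases "a \<in> S")
    case True
    have "(\<Sum>s\<in>S. c s * e s a) = (\<Sum>s\<in>S. if s = a then c a else 0)"
      by (rule sum.cong) (use True in \<open>auto simp: e_def lift_graph_def\<close>)
    then show ?thesis using True fin by (simp add: lift_graph_def)
  next
    case False
    have "e s a = g a s" if "s \<in> S" for s
    proof -
      have "e s a = (\<Sum>s'\<in>S. if s' = s then g a s else 0)"
        unfolding e_def lift_graph_def using False by (auto intro!: sum.cong)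
      then show ?thesis using fin that by simp
    qed
    then show ?thesis using False by (simp add: lift_graph_def mult.commute)
  qed
  obtain c where c: "\<And>s. s \<in> S \<Longrightarrow> coord_inner I (e s) (\<lambda>a. x a - (\<Sum>s\<in>S. c s * e s a)) = 0"
    using orth_coefficients_exist[OF fin assms(1), of e x] by blast
  define p where "p = lift_graph S g c"
  have c': "coord_inner I (e s) (\<lambda>a. x a - p a) = 0" if "s \<in> S" for s
    using c[OF that] by (simp add: expand p_def)
  have "coord_inner I y (\<lambda>a. x a - p a) = 0" if "in_graph I S g y" for y
  proof -
    have "coord_inner I y (\<lambda>a. x a - p a) = coord_inner I (\<lambda>a. \<Sum>s\<in>S. y s * e s a) (\<lambda>a. x a - p a)"
      by (rule coord_inner_cong) (use in_graph_eq_lift[OF that] in \<open>auto simp: expand\<close>)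
    then show ?thesis by (simp add: coord_inner_sum_left c')
  qed
  then show ?thesis using in_graph_lift p_def by blast
qed

text \<open>The projection \<open>p\<close> is compared with \<open>q\<close>, the lift of
  \<open>p0\<close> to the current graph. Their difference \<open>e\<close> lies in the graph, so
  its squared norm is the pairing of \<open>e\<close> with \<open>x - q\<close>. Subtracting the
  vanishing pairing of \<open>x0 - p0\<close> with the lift of \<open>e\<close> to the limit graph
  leaves terms bounded by the norm of \<open>e\<close> times a quantity tending to 0.\<close>

lemma graph_projection_tendsto:
  assumes fin: "finite I" and SI: "S \<subseteq> I"
    and g: "\<And>a s. a \<in> I - S \<Longrightarrow> s \<in> S \<Longrightarrow> ((\<lambda>w. g w a s) \<longlongrightarrow> g0 a s) F"
    and x: "\<And>a. a \<in> I \<Longrightarrow> ((\<lambda>w. x w a) \<longlongrightarrow> x0 a) F"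
    and p: "\<forall>\<^sub>F w in F. in_graph I S (g w) (p w) \<and> (\<forall>y. in_graph I S (g w) y \<longrightarrow> coord_inner I y (\<lambda>a. x w a - p w a) = 0)"
    and p0: "in_graph I S g0 p0" "\<And>y. in_graph I S g0 y \<Longrightarrow> coord_inner I y (\<lambda>a. x0 a - p0 a) = 0"
    and a: "a \<in> I"
  shows "((\<lambda>w. p w a) \<longlongrightarrow> p0 a) F"
proof -
  have finS: "finite S" using fin SI finite_subset by blast
  define q where "q w = lift_graph S (g w) p0" for w
  define e where "e w a = p w a - q w a" for w a
  define \<rho> where "\<rho> w a = (x w a - q w a) - (x0 a - p0 a)" for w a
  \<comment> \<open>The first sum measures how far \<open>x\<close> and the lifted point are from
    their limits, the second how far the graph is from the limit graph.\<close>
  define \<epsilon> where "\<epsilon> w = (\<Sum>a\<in>I. norm (\<rho> w a)) + (\<Sum>a\<in>I - S. \<Sum>s\<in>S. norm (g w a s - g0 a s) * norm (x0 a - p0 a))" for w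
  have q: "((\<lambda>w. q w b) \<longlongrightarrow> p0 b) F" if "b \<in> I" for b
  proof (cases "b \<in> S")
    case False
    have "((\<lambda>w. \<Sum>s\<in>S. g w b s * p0 s) \<longlongrightarrow> (\<Sum>s\<in>S. g0 b s * p0 s)) F"
      by (intro tendsto_sum tendsto_mult g tendsto_const) (use that False in auto)
    then show ?thesis using in_graph_eq_lift[OF p0(1) that] False by (simp add: q_def lift_graph_def)
  qed (simp add: q_def lift_graph_def)
  have "((\<lambda>w. \<rho> w b) \<longlongrightarrow> (x0 b - p0 b) - (x0 b - p0 b)) F" if "b \<in> I" for b
    unfolding \<rho>_def by (intro tendsto_diff x q tendsto_const that)
  then have \<rho>: "((\<lambda>w. norm (\<rho> w b)) \<longlongrightarrow> 0) F" if "b \<in> I" for b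
    using that tendsto_norm_zero by fastforce
  have g': "((\<lambda>w. norm (g w b s - g0 b s) * norm (x0 b - p0 b)) \<longlongrightarrow> 0) F" if "b \<in> I - S" "s \<in> S" for b s
    using tendsto_mult_left_zero[OF tendsto_norm_zero[OF LIM_zero[OF g[OF that]]]] by simp
  have \<epsilon>: "(\<epsilon> \<longlongrightarrow> 0) F"
    unfolding \<epsilon>_def[abs_def] by (intro tendsto_add_zero tendsto_null_sum \<rho> g')
  have bound: "\<forall>\<^sub>F w in F. norm (e w a) \<le> \<epsilon> w"
    using p
  proof eventually_elim
    case (elim w)
    define N where "N = sqrt (\<Sum>b\<in>I. (norm (e w b))\<^sup>2)"
    have N2: "N\<^sup>2 = (\<Sum>b\<in>I. (norm (e w b))\<^sup>2)" and N0: "N \<ge> 0"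
      unfolding N_def by (simp_all add: sum_nonneg)
    have le: "norm (e w b) \<le> N" if "b \<in> I" for b
    proof -
      have "(norm (e w b))\<^sup>2 \<le> N\<^sup>2"
        unfolding N2 by (rule member_le_sum) (use that fin in auto)
      then show ?thesis using N0 by (rule power2_le_imp_le)
    qed
    have eg: "in_graph I S (g w) (e w)"
      unfolding e_def[abs_def] by (intro in_graph_diff) (use elim in_graph_lift in \<open>auto simp: q_def\<close>)
    define e' where "e' = lift_graph S g0 (e w)"
    have "coord_inner I (e w) (e w) = coord_inner I (e w) (\<lambda>a. x w a - q w a) - coord_inner I (e w) (\<lambda>a. x w a - p w a)"
      by (subst (2) e_def[abs_def]) (simp add: coord_inner_diff_right)
    also have "\<dots> = coord_inner I (e w) (\<lambda>a. x w a - q w a) - coord_inner I e' (\<lambda>a. x0 a - p0 a)"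
      using elim eg p0(2)[OF in_graph_lift] by (simp add: e'_def)
    also have "\<dots> = (\<Sum>b\<in>I. cnj (e w b) * \<rho> w b) + (\<Sum>b\<in>I. cnj (e w b - e' b) * (x0 b - p0 b))"
      by (simp add: coord_inner_def \<rho>_def algebra_simps sum.distrib sum_subtractf)
    also have "(\<Sum>b\<in>I. cnj (e w b - e' b) * (x0 b - p0 b)) = (\<Sum>b\<in>I - S. cnj (e w b - e' b) * (x0 b - p0 b))"
      by (rule sum.mono_neutral_right) (use fin in \<open>auto simp: e'_def lift_graph_def\<close>)
    also have "\<dots> = (\<Sum>b\<in>I - S. \<Sum>s\<in>S. cnj ((g w b s - g0 b s) * e w s) * (x0 b - p0 b))"
    proof (rule sum.cong[OF refl])
      fix b assume b: "b \<in> I - S"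
      have "e w b - e' b = (\<Sum>s\<in>S. (g w b s - g0 b s) * e w s)"
        using eg b by (simp add: in_graph_def e'_def lift_graph_def left_diff_distrib sum_subtractf)
      then show "cnj (e w b - e' b) * (x0 b - p0 b) = (\<Sum>s\<in>S. cnj ((g w b s - g0 b s) * e w s) * (x0 b - p0 b))"
        by (simp only: cnj_sum sum_distrib_right)
    qed
    finally have eq: "coord_inner I (e w) (e w) = (\<Sum>b\<in>I. cnj (e w b) * \<rho> w b)
      + (\<Sum>b\<in>I - S. \<Sum>s\<in>S. cnj ((g w b s - g0 b s) * e w s) * (x0 b - p0 b))" .
    have "N\<^sup>2 = norm (coord_inner I (e w) (e w))"
      by (simp only: coord_inner_self norm_of_real N2) (simp add: sum_nonneg)
    also have "\<dots> \<le> (\<Sum>b\<in>I. norm (cnj (e w b) * \<rho> w b))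
      + (\<Sum>b\<in>I - S. \<Sum>s\<in>S. norm (cnj ((g w b s - g0 b s) * e w s) * (x0 b - p0 b)))"
      unfolding eq by (rule norm_triangle_mono[OF norm_sum order_trans[OF norm_sum sum_mono[OF norm_sum]]])
    also have "\<dots> \<le> (\<Sum>b\<in>I. N * norm (\<rho> w b)) + (\<Sum>b\<in>I - S. \<Sum>s\<in>S. N * (norm (g w b s - g0 b s) * norm (x0 b - p0 b)))"
    proof (intro add_mono sum_mono)
      fix b assume "b \<in> I"
      then show "norm (cnj (e w b) * \<rho> w b) \<le> N * norm (\<rho> w b)"
        by (simp add: norm_mult mult_right_mono le)
    next
      fix b s assume "b \<in> I - S" "s \<in> S"
      then have "norm (e w s) \<le> N" using SI le by blast
      then have "norm (e w s) * (norm (g w b s - g0 b s) * norm (x0 b - p0 b)) \<le> N * (norm (g w b s - g0 b s) * norm (x0 b - p0 b))"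
        by (intro mult_right_mono) auto
      then show "norm (cnj ((g w b s - g0 b s) * e w s) * (x0 b - p0 b)) \<le> N * (norm (g w b s - g0 b s) * norm (x0 b - p0 b))"
        unfolding norm_mult complex_mod_cnj by (simp only: mult_ac)
    qed
    also have "\<dots> = N * \<epsilon> w"
      by (simp add: \<epsilon>_def sum_distrib_left distrib_left)
    finally have "N * N \<le> N * \<epsilon> w" by (simp add: power2_eq_square)
    moreover have "\<epsilon> w \<ge> 0" unfolding \<epsilon>_def by (intro add_nonneg_nonneg sum_nonneg) auto
    ultimately have "N \<le> \<epsilon> w" using N0 by (cases "N = 0") auto
    then show ?case using le[OF a] by linarith
  qed
  have "((\<lambda>w. e w a) \<longlongrightarrow> 0) F"
    by (rule Lim_null_comparison[OF bound \<epsilon>])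
  from tendsto_add[OF this q[OF a]] show ?thesis by (simp add: e_def)
qed

section \<open>Spans of meromorphic vectors\<close>

text \<open>The pivot is an entry whose Laurent expansion has least order among the nonzero ones;
  all quotients by it then have expansions of nonnegative order.\<close>

lemma meromorphic_pivot:
  assumes "finite A" "\<And>a. a \<in> A \<Longrightarrow> f a meromorphic_on {0}"
    and nz: "\<not> (\<forall>a\<in>A. \<forall>\<^sub>F w in at 0. f a w = 0)"
  shows "\<exists>l\<in>A. (\<forall>\<^sub>F w in at 0. f l w \<noteq> 0) \<and> (\<forall>a\<in>A. \<exists>c. ((\<lambda>w. f a w / f l w) \<longlongrightarrow> c) (at 0))"
proof -
  have "\<exists>F. f a has_laurent_expansion F" if "a \<in> A" for a
    using assms(2)[OF that] unfolding meromorphic_on_def by simp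
  then obtain L where L: "\<And>a. a \<in> A \<Longrightarrow> f a has_laurent_expansion L a" by metis
  define A' where "A' = {a\<in>A. L a \<noteq> 0}"
  show ?thesis
  proof (cases "A' = {}")
    case True
    then have "\<forall>\<^sub>F w in at 0. f a w = 0" if "a \<in> A" for a
      using has_laurent_expansion_eventually_zero_iff[of "f a" 0 "L a"] L[OF that] that
      by (auto simp: A'_def)
    then show ?thesis using nz by simp
  next
    case False
    have "finite A'" using assms(1) by (simp add: A'_def)
    define l where "l = arg_min_on (\<lambda>a. fls_subdegree (L a)) A'"
    have l: "l \<in> A'" "\<And>a. a \<in> A' \<Longrightarrow> fls_subdegree (L l) \<le> fls_subdegree (L a)"
      using arg_min_if_finite[OF \<open>finite A'\<close> False, of "\<lambda>a. fls_subdegree (L a)"]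
      by (auto simp: l_def not_less)
    then have lA: "l \<in> A" "L l \<noteq> 0" by (auto simp: A'_def)
    have "\<exists>c. ((\<lambda>w. f a w / f l w) \<longlongrightarrow> c) (at 0)" if a: "a \<in> A" for a
    proof -
      have "fls_subdegree (L a / L l) \<ge> 0"
      proof (cases "L a = 0")
        case False
        then have "fls_subdegree (L a / L l) = fls_subdegree (L a) - fls_subdegree (L l)"
          using lA by (simp add: fls_divide_subdegree)
        then show ?thesis using l(2)[of a] a False by (simp add: A'_def)
      qed simp
      then show ?thesis
        using has_laurent_expansion_imp_tendsto_0[OF has_laurent_expansion_divide[OF L[OF a] L[OF lA(1)]]] by blast
    qed
    then show ?thesis
      using has_laurent_expansion_nonzero_imp_eventually_nonzero[OF L[OF lA(1)] lA(2)] lA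
      by (intro bexI[of _ l]) auto
  qed
qed

text \<open>Pivoting on an entry of least order keeps all coefficients bounded.\<close>

lemma meromorphic_span_graph:
  assumes "finite B" "finite I" "\<And>b a. b \<in> B \<Longrightarrow> a \<in> I \<Longrightarrow> v b a meromorphic_on {0}"
  shows "\<exists>S g. S \<subseteq> I \<and>
    (\<forall>a\<in>I - S. \<forall>s\<in>S. g a s meromorphic_on {0} \<and> (\<exists>l. (g a s \<longlongrightarrow> l) (at 0))) \<and>
    (\<forall>\<^sub>F w in at 0. \<forall>x. (\<exists>c. \<forall>a\<in>I. x a = (\<Sum>b\<in>B. c b * v b a w)) \<longleftrightarrow> in_graph I S (\<lambda>a s. g a s w) x)"
  using assms(1,3)
proof (induction B)
  case empty
  show ?case by (rule exI[of _ "{}"]) (simp add: in_graph_def)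
next
  case (insert \<beta> B)
  have "\<exists>S g. S \<subseteq> I \<and>
    (\<forall>a\<in>I - S. \<forall>s\<in>S. g a s meromorphic_on {0} \<and> (\<exists>l. (g a s \<longlongrightarrow> l) (at 0))) \<and>
    (\<forall>\<^sub>F w in at 0. \<forall>x. (\<exists>c. \<forall>a\<in>I. x a = (\<Sum>b\<in>B. c b * v b a w)) \<longleftrightarrow> in_graph I S (\<lambda>a s. g a s w) x)"
    by (rule insert.IH) (use insert.prems in auto)
  then obtain S g where S: "S \<subseteq> I"
    and g: "\<And>a s. a \<in> I - S \<Longrightarrow> s \<in> S \<Longrightarrow> g a s meromorphic_on {0}"
      "\<And>a s. a \<in> I - S \<Longrightarrow> s \<in> S \<Longrightarrow> \<exists>l. (g a s \<longlongrightarrow> l) (at 0)"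
    and ev: "\<forall>\<^sub>F w in at 0. \<forall>x. (\<exists>c. \<forall>a\<in>I. x a = (\<Sum>b\<in>B. c b * v b a w)) \<longleftrightarrow> in_graph I S (\<lambda>a s. g a s w) x"
    by blast
  have finS: "finite S" using S assms(2) finite_subset by blast
  \<comment> \<open>What remains of the new vector after subtracting the element of the graph with
    the same free coordinates.\<close>
  define f where "f a w = v \<beta> a w - (\<Sum>s\<in>S. g a s w * v \<beta> s w)" for a w
  have f: "f a meromorphic_on {0}" if "a \<in> I - S" for a
    unfolding f_def[abs_def] by (intro meromorphic_intros g insert.prems) (use that S in auto)
  have span_insert: "(\<exists>c. \<forall>a\<in>I. x a = (\<Sum>b\<in>insert \<beta> B. c b * v b a w))
      \<longleftrightarrow> (\<exists>\<tau>. in_graph I S (\<lambda>a s. g a s w) (\<lambda>a. x a - \<tau> * v \<beta> a w))"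
    if H: "\<forall>x. (\<exists>c. \<forall>a\<in>I. x a = (\<Sum>b\<in>B. c b * v b a w)) \<longleftrightarrow> in_graph I S (\<lambda>a s. g a s w) x" for x w
  proof
    assume "\<exists>c. \<forall>a\<in>I. x a = (\<Sum>b\<in>insert \<beta> B. c b * v b a w)"
    then obtain c where "\<forall>a\<in>I. x a - c \<beta> * v \<beta> a w = (\<Sum>b\<in>B. c b * v b a w)"
      using insert.hyps by (auto simp: algebra_simps)
    then show "\<exists>\<tau>. in_graph I S (\<lambda>a s. g a s w) (\<lambda>a. x a - \<tau> * v \<beta> a w)"
      using H by blast
  next
    assume "\<exists>\<tau>. in_graph I S (\<lambda>a s. g a s w) (\<lambda>a. x a - \<tau> * v \<beta> a w)"
    then obtain \<tau> where "in_graph I S (\<lambda>a s. g a s w) (\<lambda>a. x a - \<tau> * v \<beta> a w)" by blast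
    then obtain c where "\<forall>a\<in>I. x a - \<tau> * v \<beta> a w = (\<Sum>b\<in>B. c b * v b a w)"
      using spec[OF H, of "\<lambda>a. x a - \<tau> * v \<beta> a w"] by blast
    then have "\<forall>a\<in>I. x a = (\<Sum>b\<in>insert \<beta> B. (c(\<beta> := \<tau>)) b * v b a w)"
      using insert.hyps by (auto simp: algebra_simps intro!: sum.cong)
    then show "\<exists>c. \<forall>a\<in>I. x a = (\<Sum>b\<in>insert \<beta> B. c b * v b a w)" by blast
  qed
  have reduce: "in_graph I S (\<lambda>a s. g a s w) (\<lambda>a. x a - \<tau> * v \<beta> a w)
      \<longleftrightarrow> (\<forall>a\<in>I - S. x a - (\<Sum>s\<in>S. g a s w * x s) = \<tau> * f a w)" for x \<tau> w
    unfolding in_graph_def f_def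
    by (intro ball_cong refl) (auto simp: algebra_simps sum_subtractf sum_distrib_left)
  have "finite (I - S)" using assms(2) by simp
  note pivot = meromorphic_pivot[of "I - S" f, OF this f]
  show ?case
  proof (cases "\<forall>a\<in>I - S. \<forall>\<^sub>F w in at 0. f a w = 0")
    case True
    have "\<forall>\<^sub>F w in at 0. \<forall>a\<in>I - S. f a w = 0"
      using True assms(2) by (simp add: eventually_ball_finite)
    with ev have "\<forall>\<^sub>F w in at 0. \<forall>x. (\<exists>c. \<forall>a\<in>I. x a = (\<Sum>b\<in>insert \<beta> B. c b * v b a w)) \<longleftrightarrow> in_graph I S (\<lambda>a s. g a s w) x"
    proof eventually_elim
      case (elim w)
      then show ?case
        unfolding span_insert[OF elim(1)] reduce by (auto simp: in_graph_def)
    qed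
    then show ?thesis
      by (intro exI[of _ S] exI[of _ g] conjI ballI S g)
  next
    case False
    from pivot[OF _ False]
    obtain l where lI: "l \<in> I - S" and l': "(\<forall>\<^sub>F w in at 0. f l w \<noteq> 0) \<and>
        (\<forall>a\<in>I - S. \<exists>c. ((\<lambda>w. f a w / f l w) \<longlongrightarrow> c) (at 0))"
      by (rule bexE)
    note l = lI conjunct1[OF l'] and ratio = conjunct2[OF l']
    let ?S = "insert l S"
    \<comment> \<open>Gaussian elimination: the multiple of the new vector is solved for from
      coordinate \<open>l\<close>, which thereby becomes free.\<close>
    define g' where "g' a s w = (if s = l then f a w / f l w else g a s w - (f a w / f l w) * g l s w)" for a s w
    have lS: "l \<notin> S" "l \<in> I" using l by auto
    have mer: "g' a s meromorphic_on {0}" if "a \<in> I - ?S" "s \<in> ?S" for a s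
      unfolding g'_def[abs_def] using that l(1)
      by (cases "s = l") (auto intro!: meromorphic_intros f g)
    have lim: "\<exists>c. (g' a s \<longlongrightarrow> c) (at 0)" if a: "a \<in> I - ?S" and s: "s \<in> ?S" for a s
    proof -
      obtain c where c: "((\<lambda>w. f a w / f l w) \<longlongrightarrow> c) (at 0)" using ratio a by blast
      show ?thesis
      proof (cases "s = l")
        case True
        then show ?thesis using c by (auto simp: g'_def[abs_def])
      next
        case False
        then have "s \<in> S" using s by simp
        then obtain c1 c2 where "(g a s \<longlongrightarrow> c1) (at 0)" "(g l s \<longlongrightarrow> c2) (at 0)"
          using g(2)[of a s] g(2)[of l s] a l(1) by auto
        then have "((\<lambda>w. g a s w - f a w / f l w * g l s w) \<longlongrightarrow> c1 - c * c2) (at 0)"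
          by (intro tendsto_diff tendsto_mult c)
        moreover have "g' a s = (\<lambda>w. g a s w - f a w / f l w * g l s w)"
          using False by (simp add: g'_def fun_eq_iff)
        ultimately show ?thesis by auto
      qed
    qed
    have "\<forall>\<^sub>F w in at 0. \<forall>x. (\<exists>c. \<forall>a\<in>I. x a = (\<Sum>b\<in>insert \<beta> B. c b * v b a w)) \<longleftrightarrow> in_graph I ?S (\<lambda>a s. g' a s w) x"
      using ev l(2)
    proof eventually_elim
      case (elim w)
      have sum': "(\<Sum>s\<in>?S. g' a s w * x s) = (\<Sum>s\<in>S. g a s w * x s) + (f a w / f l w) * (x l - (\<Sum>s\<in>S. g l s w * x s))" for a x
      proof -
        have "(\<Sum>s\<in>S. g' a s w * x s) = (\<Sum>s\<in>S. g a s w * x s - (f a w / f l w) * (g l s w * x s))"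
          by (rule sum.cong) (use lS in \<open>auto simp: g'_def algebra_simps\<close>)
        then show ?thesis using finS lS
          by (simp add: g'_def sum_subtractf sum_distrib_left algebra_simps)
      qed
      have "(\<exists>\<tau>. \<forall>a\<in>I - S. x a - (\<Sum>s\<in>S. g a s w * x s) = \<tau> * f a w) \<longleftrightarrow> in_graph I ?S (\<lambda>a s. g' a s w) x" for x
      proof
        assume "\<exists>\<tau>. \<forall>a\<in>I - S. x a - (\<Sum>s\<in>S. g a s w * x s) = \<tau> * f a w"
        then obtain \<tau> where \<tau>: "\<And>a. a \<in> I - S \<Longrightarrow> x a - (\<Sum>s\<in>S. g a s w * x s) = \<tau> * f a w" by blast
        show "in_graph I ?S (\<lambda>a s. g' a s w) x"
          unfolding in_graph_def
        proof
          fix a assume "a \<in> I - ?S"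
          then show "x a = (\<Sum>s\<in>?S. g' a s w * x s)"
            using \<tau>[of a] \<tau>[of l] lS elim(2) unfolding sum' by (simp add: field_simps)
        qed
      next
        assume gr: "in_graph I ?S (\<lambda>a s. g' a s w) x"
        show "\<exists>\<tau>. \<forall>a\<in>I - S. x a - (\<Sum>s\<in>S. g a s w * x s) = \<tau> * f a w"
        proof (intro exI ballI)
          fix a assume a: "a \<in> I - S"
          show "x a - (\<Sum>s\<in>S. g a s w * x s) = ((x l - (\<Sum>s\<in>S. g l s w * x s)) / f l w) * f a w"
          proof (cases "a = l")
            case False
            then have "x a = (\<Sum>s\<in>?S. g' a s w * x s)" using gr a by (simp add: in_graph_def)
            then show ?thesis unfolding sum' by simp
          qed (use elim(2) in simp)
        qed
      qed
      then show ?case unfolding span_insert[OF elim(1)] reduce by blast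
    qed
    moreover have "?S \<subseteq> I" using S lS by simp
    ultimately show ?thesis
      by (intro exI[of _ ?S] exI[of _ g'] conjI ballI mer lim)
  qed
qed

lemma eventually_at_imp_eventually_nhd:
  fixes z :: "'a::t1_space"
  assumes "\<forall>\<^sub>F w in at z. P w"
  shows "\<forall>\<^sub>F w in at z. P w \<and> (\<forall>\<^sub>F u in at w. P u)"
proof -
  obtain S where S: "open S" "z \<in> S" "\<And>w. w \<in> S \<Longrightarrow> w \<noteq> z \<Longrightarrow> P w"
    using assms unfolding eventually_at_topological by blast
  have "\<exists>U. open U \<and> w \<in> U \<and> (\<forall>u\<in>U. u \<noteq> w \<longrightarrow> P u)" if "w \<in> S" "w \<noteq> z" for w
    using S that by (intro exI[of _ "S - {z}"]) (auto intro: open_delete)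
  then show ?thesis
    unfolding eventually_at_topological by (intro exI[of _ S]) (use S in simp)
qed

lemma meromorphic_eventually_analytic:
  assumes "f meromorphic_on {0}"
  shows "\<forall>\<^sub>F w in at 0. f analytic_on {w}"
proof -
  obtain r where r: "r > 0" "f analytic_on ball 0 r - {0}"
    using assms meromorphic_on_isolated_singularity unfolding isolated_singularity_at_def by blast
  have "f analytic_on {w}" if "w \<noteq> 0" "dist w 0 < r" for w
    by (rule analytic_on_subset[OF r(2)]) (use that in auto)
  then show ?thesis unfolding eventually_at using r(1) by blast
qed

lemma meromorphic_eventually_isCont:
  assumes "f meromorphic_on {0}"
  shows "\<forall>\<^sub>F w in at 0. isCont f w"
  using meromorphic_eventually_analytic[OF assms] by (rule eventually_mono) (rule analytic_at_imp_isCont)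

text \<open>Near 0 the span is a graph with convergent coefficients, and the projection follows
  them. The second conclusion is the same convergence at a nearby point, where the coefficients are
  continuous; it serves to identify a bundle given by limits with the projection it arises
  from.\<close>

theorem meromorphic_projection_limit:
  assumes fin: "finite B" "finite I"
    and mer: "\<And>b a. b \<in> B \<Longrightarrow> a \<in> I \<Longrightarrow> v b a meromorphic_on {0}"
    and x: "\<And>a. a \<in> I \<Longrightarrow> \<exists>l. ((\<lambda>w. x w a) \<longlongrightarrow> l) (at 0)"
    and xc: "\<And>a. a \<in> I \<Longrightarrow> \<forall>\<^sub>F w in at 0. isCont (\<lambda>w. x w a) w"
    and p: "\<forall>\<^sub>F w in at 0. (\<exists>c. \<forall>a\<in>I. p w a = (\<Sum>b\<in>B. c b * v b a w)) \<and>
              (\<forall>b\<in>B. coord_inner I (\<lambda>a. v b a w) (\<lambda>a. x w a - p w a) = 0)"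
    and a: "a \<in> I"
  shows "\<exists>l. ((\<lambda>w. p w a) \<longlongrightarrow> l) (at 0)" "\<forall>\<^sub>F w in at 0. isCont (\<lambda>w. p w a) w"
proof -
  have "\<exists>S g. S \<subseteq> I \<and>
    (\<forall>a\<in>I - S. \<forall>s\<in>S. g a s meromorphic_on {0} \<and> (\<exists>l. (g a s \<longlongrightarrow> l) (at 0))) \<and>
    (\<forall>\<^sub>F w in at 0. \<forall>x. (\<exists>c. \<forall>a\<in>I. x a = (\<Sum>b\<in>B. c b * v b a w)) \<longleftrightarrow> in_graph I S (\<lambda>a s. g a s w) x)"
    by (rule meromorphic_span_graph[OF fin mer])
  then obtain S g where Sg: "S \<subseteq> I \<and>
    (\<forall>a\<in>I - S. \<forall>s\<in>S. g a s meromorphic_on {0} \<and> (\<exists>l. (g a s \<longlongrightarrow> l) (at 0))) \<and>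
    (\<forall>\<^sub>F w in at 0. \<forall>x. (\<exists>c. \<forall>a\<in>I. x a = (\<Sum>b\<in>B. c b * v b a w)) \<longleftrightarrow> in_graph I S (\<lambda>a s. g a s w) x)"
    by (elim exE) auto
  note S = conjunct1[OF Sg] and ev = conjunct2[OF conjunct2[OF Sg]]
  have g: "g a s meromorphic_on {0}" "\<exists>l. (g a s \<longlongrightarrow> l) (at 0)" if "a \<in> I - S" "s \<in> S" for a s
    using bspec[OF bspec[OF conjunct1[OF conjunct2[OF Sg]] that(1)] that(2)] by simp_all
  have finS: "finite S" using S fin finite_subset by blast
  define Q where "Q w \<longleftrightarrow> in_graph I S (\<lambda>a s. g a s w) (p w) \<and>
    (\<forall>y. in_graph I S (\<lambda>a s. g a s w) y \<longrightarrow> coord_inner I y (\<lambda>a. x w a - p w a) = 0)" for w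
  have Q: "\<forall>\<^sub>F w in at 0. Q w"
    using ev p
  proof eventually_elim
    case (elim w)
    have "coord_inner I y (\<lambda>a. x w a - p w a) = 0" if y: "in_graph I S (\<lambda>a s. g a s w) y" for y
    proof -
      obtain c where "\<forall>a\<in>I. y a = (\<Sum>b\<in>B. c b * v b a w)" using y elim(1) by blast
      then have "coord_inner I y (\<lambda>a. x w a - p w a) = coord_inner I (\<lambda>a. \<Sum>b\<in>B. c b * v b a w) (\<lambda>a. x w a - p w a)"
        by (intro coord_inner_cong) auto
      then show ?thesis using elim(2) by (simp add: coord_inner_sum_left)
    qed
    moreover have "in_graph I S (\<lambda>a s. g a s w) (p w)" using elim by blast
    ultimately show ?case unfolding Q_def by blast
  qed
  obtain g0 where g0: "\<And>a s. a \<in> I - S \<Longrightarrow> s \<in> S \<Longrightarrow> (g a s \<longlongrightarrow> g0 a s) (at 0)"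
    using g(2) by metis
  obtain x0 where x0: "\<And>a. a \<in> I \<Longrightarrow> ((\<lambda>w. x w a) \<longlongrightarrow> x0 a) (at 0)"
    using x by metis
  obtain p0 where p0: "in_graph I S g0 p0" "\<And>y. in_graph I S g0 y \<Longrightarrow> coord_inner I y (\<lambda>a. x0 a - p0 a) = 0"
    using graph_projection_exists[OF fin(2) S] by blast
  have "((\<lambda>w. p w a) \<longlongrightarrow> p0 a) (at 0)"
    by (rule graph_projection_tendsto[OF fin(2) S, where g = "\<lambda>w a s. g a s w" and x = x and ?g0.0 = g0 and ?x0.0 = x0])
      (use g0 x0 Q p0 a in \<open>auto simp: Q_def\<close>)
  then show "\<exists>l. ((\<lambda>w. p w a) \<longlongrightarrow> l) (at 0)" by blast
  have gc: "\<forall>\<^sub>F w in at 0. \<forall>a\<in>I - S. \<forall>s\<in>S. isCont (g a s) w"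
    using fin(2) finS by (intro eventually_ball_finite ballI meromorphic_eventually_isCont g) auto
  have xc': "\<forall>\<^sub>F w in at 0. \<forall>a\<in>I. isCont (\<lambda>w. x w a) w"
    using fin(2) xc by (intro eventually_ball_finite ballI) auto
  show "\<forall>\<^sub>F w in at 0. isCont (\<lambda>w. p w a) w"
    using eventually_at_imp_eventually_nhd[OF Q] gc xc'
  proof eventually_elim
    case (elim w)
    have "((\<lambda>u. p u a) \<longlongrightarrow> p w a) (at w)"
      by (rule graph_projection_tendsto[OF fin(2) S, where g = "\<lambda>w a s. g a s w" and x = x
            and ?g0.0 = "\<lambda>a s. g a s w" and ?x0.0 = "x w"])
        (use elim a in \<open>auto simp: Q_def isCont_def\<close>)
    then show ?case by (simp add: isCont_def)
  qed
qed

section \<open>Existence of orthogonal projections\<close>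

lemma cinner_eq_coord_inner: "cinner v w = coord_inner UNIV (\<lambda>a. v $ a) (\<lambda>a. w $ a)"
  by (simp add: cinner_def coord_inner_def)

lemma cinner_self_eq_0: "cinner v v = 0 \<Longrightarrow> v = 0"
  using coord_inner_self_eq_0[of UNIV "vec_nth v"] by (simp add: cinner_eq_coord_inner vec_eq_iff)

lemma cinner_diff_right: "cinner u (v - w) = cinner u v - cinner u w"
  by (simp add: cinner_def right_diff_distrib sum_subtractf)

lemma cnj_cinner: "cnj (cinner v w) = cinner w v"
  by (simp add: cinner_def mult.commute)

lemma adj_eqI:
  fixes A :: "complex^'n^'n"
  assumes "\<And>v w. cinner (A *v v) w = cinner v (A *v w)"
  shows "adj A = A"
proof -
  have "adj A *v w = A *v w" for w
  proof -
    have "cinner v (adj A *v w - A *v w) = 0" for v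
      using assms[of v w] by (simp add: cinner_diff_right flip: cinner_adj)
    then show ?thesis using cinner_self_eq_0 by fastforce
  qed
  then show ?thesis by (simp add: matrix_eq)
qed

definition is_orth_proj :: "(complex^'n) set \<Rightarrow> complex^'n^'n \<Rightarrow> bool" where
  "is_orth_proj V P \<longleftrightarrow> P ** P = P \<and> adj P = P \<and> range (\<lambda>v. P *v v) = V"

text \<open>Each projection fixes the range of the other, so P P' = P' and P' P = P; taking adjoints
  exchanges the two products.\<close>

lemma is_orth_proj_unique:
  fixes P P' :: "complex^'n^'n"
  assumes "is_orth_proj V P" "is_orth_proj V P'"
  shows "P = P'"
proof -
  have "A ** B = B" if "is_orth_proj V A" "is_orth_proj V B" for A B :: "complex^'n^'n"
  proof -
    have "A *v (B *v v) = B *v v" for v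
      by (rule idem_range_fixed) (use that in \<open>auto simp: is_orth_proj_def\<close>)
    then show ?thesis by (simp add: matrix_eq matrix_vector_mul_assoc)
  qed
  from this[OF assms] this[OF assms(2,1)] show ?thesis
    using assms by (metis adj_mult is_orth_proj_def)
qed

lemma orth_proj_exists:
  fixes A :: "(complex^'n) set"
  assumes "finite A"
  shows "\<exists>P. is_orth_proj (vec.span A) P"
proof -
  have "\<exists>c. \<forall>b\<in>A. cinner b (x - (\<Sum>b\<in>A. c b *s b)) = 0" for x
    using orth_coefficients_exist[OF assms, of UNIV "vec_nth" "vec_nth x"]
    by (simp add: cinner_eq_coord_inner)
  then obtain c where c: "\<And>x. \<forall>b\<in>A. cinner b (x - (\<Sum>b\<in>A. c x b *s b)) = 0"
    by metis
  define p where "p x = (\<Sum>b\<in>A. c x b *s b)" for x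
  have p: "p x \<in> vec.span A" "b \<in> A \<Longrightarrow> cinner b (x - p x) = 0" for x b
    using c[of x] unfolding p_def by (auto intro: vec.span_sum vec.span_scale vec.span_base)
  \<comment> \<open>Built from the images of the basis vectors, the map is linear whatever choices
    were made in \<open>c\<close>.\<close>
  define P where "P = (\<chi> k i. p (axis i 1) $ k)"
  have P: "P *v x = (\<Sum>i\<in>UNIV. x $ i *s p (axis i 1))" for x
    by (simp add: P_def matrix_vector_mult_def vec_eq_iff mult.commute)
  have x: "x = (\<Sum>i\<in>UNIV. x $ i *s axis i 1)" for x :: "complex^'n"
    by (simp add: basis_expansion)
  have Pspan: "P *v x \<in> vec.span A" for x
    unfolding P by (intro vec.span_sum vec.span_scale p)
  have orth: "cinner y (x - P *v x) = 0" if "y \<in> vec.span A" for x y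
    using that
  proof (induction rule: vec.span_induct_alt)
    case base
    show ?case by (simp add: cinner_def)
  next
    case (step c b y)
    have "x - P *v x = (\<Sum>i\<in>UNIV. x $ i *s (axis i 1 - p (axis i 1)))"
      by (subst x) (simp add: P vec.scale_right_diff_distrib sum_subtractf)
    then have "cnj (cinner b (x - P *v x)) = (\<Sum>i\<in>UNIV. cnj (x $ i) * cnj (cinner b (axis i 1 - p (axis i 1))))"
      by (simp only: cnj_cinner cinner_sum_left cinner_scale_left)
    then have "cinner b (x - P *v x) = 0" using p(2)[OF step(1)] by simp
    then show ?case using step by (simp add: cinner_add_left cinner_scale_left)
  qed
  have fixed: "P *v x = x" if "x \<in> vec.span A" for x
  proof -
    have "x - P *v x \<in> vec.span A" using that Pspan by (simp add: vec.span_diff)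
    from orth[OF this] have "x - P *v x = 0" by (rule cinner_self_eq_0)
    then show ?thesis by simp
  qed
  have "range (\<lambda>v. P *v v) = vec.span A"
    using Pspan fixed by (metis (no_types, lifting) image_subset_iff rangeI subsetI subset_antisym)
  moreover have "P ** P = P"
    using fixed[OF Pspan] by (simp add: matrix_eq matrix_vector_mul_assoc[symmetric])
  moreover have "adj P = P"
  proof (rule adj_eqI)
    fix v w
    have "cinner (P *v v) w = cinner (P *v v) (P *v w)"
      using orth[OF Pspan, of v w] by (simp add: cinner_diff_right)
    also have "\<dots> = cnj (cinner (P *v w) (P *v v))"
      by (simp add: cnj_cinner)
    also have "cinner (P *v w) (P *v v) = cinner (P *v w) v"
      using orth[OF Pspan, of w v] by (simp add: cinner_diff_right)
    finally show "cinner (P *v v) w = cinner v (P *v w)" by (simp add: cnj_cinner)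
  qed
  ultimately show ?thesis by (auto simp: is_orth_proj_def)
qed

lemma orth_proj_span:
  fixes A :: "(complex^'n) set"
  assumes "finite A"
  shows "is_orth_proj (vec.span A) (orth_proj (vec.span A))"
proof -
  obtain P where P: "is_orth_proj (vec.span A) P"
    using orth_proj_exists[OF assms] by blast
  then have "\<exists>!P. P ** P = P \<and> adj P = P \<and> range (\<lambda>v. P *v v) = vec.span A"
    using is_orth_proj_unique unfolding is_orth_proj_def by blast
  from theI'[OF this] show ?thesis by (simp add: orth_proj_def is_orth_proj_def)
qed

section \<open>Limits of matrices\<close>

lemma tendsto_matrix_mult:
  fixes A B :: "'x \<Rightarrow> complex^'n^'n"
  assumes "(A \<longlongrightarrow> a) F" "(B \<longlongrightarrow> b) F"
  shows "((\<lambda>x. A x ** B x) \<longlongrightarrow> a ** b) F"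
  unfolding matrix_matrix_mult_def by (intro tendsto_vec_lambda tendsto_sum tendsto_mult tendsto_vec_nth assms)

lemma tendsto_matrix_vector_mult:
  fixes A :: "'x \<Rightarrow> complex^'n^'n"
  assumes "(A \<longlongrightarrow> a) F"
  shows "((\<lambda>x. A x *v v) \<longlongrightarrow> a *v v) F"
  unfolding matrix_vector_mult_def by (intro tendsto_vec_lambda tendsto_sum tendsto_mult tendsto_vec_nth tendsto_const assms)

lemma tendsto_adj:
  assumes "(A \<longlongrightarrow> a) F"
  shows "((\<lambda>x. adj (A x)) \<longlongrightarrow> adj a) F"
  unfolding adj_def by (intro tendsto_vec_lambda tendsto_cnj tendsto_vec_nth assms)

lemma tendsto_Phi:
  fixes P :: "'x \<Rightarrow> nat \<Rightarrow> complex^'n^'n"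
  assumes "\<And>m. m \<in> {1..i} \<Longrightarrow> ((\<lambda>z. P z m) \<longlongrightarrow> p m) F"
  shows "((\<lambda>z. Phi (plist (P z) i) x) \<longlongrightarrow> Phi (plist p i) x) F"
  using assms
proof (induction i)
  case (Suc i)
  have "((\<lambda>z. P z (Suc i) + mat x ** (mat 1 - P z (Suc i))) \<longlongrightarrow> p (Suc i) + mat x ** (mat 1 - p (Suc i))) F"
    by (intro tendsto_add tendsto_matrix_mult tendsto_diff tendsto_const Suc.prems) auto
  then show ?case
    using Suc by (simp add: plist_Suc Phi_append) (intro tendsto_matrix_mult; simp)
qed simp

lemma tendsto_matrix_columns:
  fixes A :: "'x \<Rightarrow> complex^'n^'n"
  assumes "\<And>i k. \<exists>l. ((\<lambda>x. (A x *v axis i 1) $ k) \<longlongrightarrow> l) F"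
  shows "\<exists>a. (A \<longlongrightarrow> a) F"
proof -
  have "\<forall>ik. \<exists>l. ((\<lambda>x. A x $ snd ik $ fst ik) \<longlongrightarrow> l) F"
    using assms by (simp add: mult_axis_nth)
  then obtain l where l: "\<forall>ik. ((\<lambda>x. A x $ snd ik $ fst ik) \<longlongrightarrow> l ik) F"
    by (rule exE[OF choice])
  have "((\<lambda>x. A x $ k $ i) \<longlongrightarrow> l (i, k)) F" for k i
    using spec[OF l, of "(i, k)"] by simp
  then have "(A \<longlongrightarrow> (\<chi> k i. l (i, k))) F"
    by (intro vec_tendstoI) simp
  then show ?thesis by blast
qed

section \<open>Charts of the sphere\<close>

text \<open>Every point of the sphere is placed at w = 0, so that one local theory at 0 serves
  finite points and infinity alike. At infinity the value at w = 0 itself is a default that the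
  punctured filter ignores.\<close>

definition chart :: "rsphere \<Rightarrow> complex \<Rightarrow> complex" where
  "chart p w = (case p of Some z \<Rightarrow> z + w | None \<Rightarrow> inverse w)"

definition chart_inv :: "rsphere \<Rightarrow> complex \<Rightarrow> complex" where
  "chart_inv p u = (case p of Some z \<Rightarrow> u - z | None \<Rightarrow> inverse u)"

definition sphere_filter :: "rsphere \<Rightarrow> complex filter" where
  "sphere_filter p = (case p of Some z \<Rightarrow> at z | None \<Rightarrow> at_infinity)"

lemma sphere_filter_chart: "sphere_filter p = filtermap (chart p) (at 0)"
proof (cases p)
  case None
  have "filtermap inverse (at (0::complex)) = filtermap inverse (filtermap inverse at_infinity)"
    by (simp add: at_to_infinity)
  also have "\<dots> = at_infinity" by (simp add: filtermap_filtermap)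
  finally show ?thesis using None by (simp add: sphere_filter_def chart_def[abs_def])
next
  case (Some z)
  have "at z = filtermap (\<lambda>w. w + z) (at 0)" by (rule at_to_0)
  then show ?thesis using Some by (simp add: sphere_filter_def chart_def[abs_def] add.commute)
qed

lemma sphere_filter_not_bot: "sphere_filter p \<noteq> bot"
  by (simp add: sphere_filter_chart filtermap_bot_iff)

lemma eventually_sphere_filter: "eventually P (sphere_filter p) \<longleftrightarrow> eventually (\<lambda>w. P (chart p w)) (at 0)"
  by (simp add: sphere_filter_chart eventually_filtermap)

lemma tendsto_sphere_filter: "(f \<longlongrightarrow> l) (sphere_filter p) \<longleftrightarrow> ((\<lambda>w. f (chart p w)) \<longlongrightarrow> l) (at 0)"
  by (simp add: sphere_filter_chart filterlim_filtermap)

lemma chart_inv_chart [simp]: "chart_inv p (chart p w) = w"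
  by (simp add: chart_def chart_inv_def split: option.split)

lemma chart_chart_inv [simp]: "chart p (chart_inv p u) = u"
  by (simp add: chart_def chart_inv_def split: option.split)

lemma isCont_chart: "w \<noteq> 0 \<Longrightarrow> isCont (chart p) w"
  by (cases p) (auto simp: chart_def[abs_def] intro!: continuous_intros)

lemma isCont_chart_inv: "w \<noteq> 0 \<Longrightarrow> isCont (chart_inv p) (chart p w)"
  by (cases p) (auto simp: chart_inv_def[abs_def] chart_def intro!: continuous_intros)

lemma isCont_via_chart:
  assumes "isCont (\<lambda>w. f (chart p w)) w" "w \<noteq> 0"
  shows "isCont f (chart p w)"
proof -
  have "isCont (\<lambda>u. f (chart p (chart_inv p u))) (chart p w)"
    by (rule isCont_o2[OF isCont_chart_inv[OF assms(2)]]) (simp add: assms(1))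
  then show ?thesis by simp
qed

section \<open>Meromorphic functions on the sphere\<close>

lemma mero_sphere_chart:
  assumes "mero_sphere f"
  shows "(\<lambda>w. f (chart p w)) meromorphic_on {0}"
proof (cases p)
  case None
  then show ?thesis using assms by (simp add: mero_sphere_def chart_def inverse_eq_divide)
next
  case (Some z)
  have "(\<lambda>w. f (z + w)) meromorphic_on {0}"
    by (rule meromorphic_on_compose[where A = UNIV])
      (use assms in \<open>auto simp: mero_sphere_def intro!: analytic_intros\<close>)
  then show ?thesis using Some by (simp add: chart_def)
qed

lemma mero_sphere_eventually_analytic:
  assumes "mero_sphere f"
  shows "\<forall>\<^sub>F z in sphere_filter p. f analytic_on {z}"
proof -
  have "\<forall>\<^sub>F w in at 0. w \<noteq> (0::complex)" by (simp add: eventually_at_filter)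
  with meromorphic_eventually_analytic[OF mero_sphere_chart[OF assms, of p]] show ?thesis
    unfolding eventually_sphere_filter
  proof eventually_elim
    case (elim w)
    have "chart_inv p analytic_on {chart p w}"
      using elim(2) by (cases p) (auto simp: chart_inv_def[abs_def] chart_def intro!: analytic_intros)
    moreover have "(\<lambda>w. f (chart p w)) analytic_on chart_inv p ` {chart p w}"
      using elim(1) by simp
    ultimately have "(\<lambda>w. f (chart p w)) \<circ> chart_inv p analytic_on {chart p w}"
      by (rule analytic_on_compose)
    then show ?case by (simp add: o_def)
  qed
qed

text \<open>The derivative is in the affine coordinate also near infinity: with g(w) = f(1 / w), the
  chain rule gives f'(1 / w) = - w^2 g'(w).\<close>

lemma mero_sphere_deriv:
  assumes "mero_sphere f"
  shows "mero_sphere (deriv f)"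
proof -
  define g where "g w = f (1 / w)" for w
  have f: "f = (\<lambda>u. g (1 / u))" by (simp add: g_def)
  have g: "g meromorphic_on {0}" using assms by (simp add: mero_sphere_def g_def[abs_def])
  have "\<forall>\<^sub>F w in at 0. w \<noteq> (0::complex)" by (simp add: eventually_at_filter)
  with meromorphic_eventually_analytic[OF g]
  have "\<forall>\<^sub>F w in at 0. - (w\<^sup>2) * deriv g w = deriv f (1 / w)"
  proof eventually_elim
    case (elim w)
    have "(g has_field_derivative deriv g w) (at w)"
      using elim(1) analytic_on_imp_differentiable_at DERIV_deriv_iff_field_differentiable by blast
    then have "((\<lambda>u. g (1 / u)) has_field_derivative deriv g w * (- (w\<^sup>2))) (at (1 / w))"
      by (intro DERIV_chain2[where f = g and g = "\<lambda>u. 1 / u"])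
        (use elim(2) in \<open>auto intro!: derivative_eq_intros simp: power2_eq_square field_simps\<close>)
    then have "(f has_field_derivative deriv g w * (- (w\<^sup>2))) (at (1 / w))"
      unfolding f[symmetric] .
    then show ?case using DERIV_imp_deriv by fastforce
  qed
  moreover have "(\<lambda>w. - (w\<^sup>2) * deriv g w) meromorphic_on {0}"
    by (intro meromorphic_intros g)
  ultimately have "(\<lambda>w. deriv f (1 / w)) meromorphic_on {0}"
    using meromorphic_on_cong[of "{0}" "\<lambda>w. - (w\<^sup>2) * deriv g w" "\<lambda>w. deriv f (1 / w)" "{0}"] by simp
  moreover have "deriv f meromorphic_on UNIV"
    using assms by (auto simp: mero_sphere_def intro: meromorphic_on_deriv)
  ultimately show ?thesis by (simp add: mero_sphere_def)
qed

lemma mero_sphere_higher_deriv: "mero_sphere f \<Longrightarrow> mero_sphere ((deriv ^^ k) f)"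
  by (induction k) (auto intro: mero_sphere_deriv)

lemma mero_sphere_vderiv:
  assumes "mero_sphere_vec f"
  shows "mero_sphere (\<lambda>z. vderiv k f z $ l)"
  using assms mero_sphere_higher_deriv[of "\<lambda>w. f w $ l" k] by (simp add: vderiv_def mero_sphere_vec_def)

section \<open>The bundles of an array\<close>

definition jets :: "'n::finite array \<Rightarrow> complex \<Rightarrow> nat \<Rightarrow> nat \<Rightarrow> nat \<Rightarrow> complex^'n" where
  "jets H z k l j = vderiv k (H l j) z"

definition bundle_at :: "nat \<Rightarrow> 'n::finite array \<Rightarrow> complex \<Rightarrow> nat \<Rightarrow> complex^'n^'n" where
  "bundle_at J H z m = bundle_proj J H m (Some z)"

definition sections :: "(nat \<Rightarrow> complex^'n^'n) \<Rightarrow> (nat \<Rightarrow> nat \<Rightarrow> nat \<Rightarrow> complex^'n) \<Rightarrow> nat \<Rightarrow> nat \<Rightarrow> (complex^'n) set" where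
  "sections P h J i = {\<Sum>s=k..i. Cmat P i s *v h k (s - k) j | k j. k \<le> i \<and> j \<in> {1..J}}"

lemma finite_sections: "finite (sections P h J i)"
proof (rule finite_subset)
  show "sections P h J i \<subseteq> (\<lambda>(k, j). \<Sum>s=k..i. Cmat P i s *v h k (s - k) j) ` ({..i} \<times> {1..J})"
    unfolding sections_def by force
qed simp

lemma plist_cong:
  assumes "\<And>m. m \<in> {1..i} \<Longrightarrow> P m = Q m"
  shows "plist P i = plist Q i"
  unfolding plist_def by (rule map_cong) (use assms in auto)

lemma Cmat_cong:
  assumes "\<And>m. m \<in> {1..i} \<Longrightarrow> P m = Q m"
  shows "Cmat P i s = Cmat Q i s"
  unfolding Cmat_def
proof (rule sum.cong[OF refl])
  fix I assume I: "I \<in> {I. I \<subseteq> {1..i} \<and> card I = s}"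
  then have "finite I" using finite_subset by blast
  then have "map (\<lambda>m. mat 1 - P m) (rev (sorted_list_of_set I)) = map (\<lambda>m. mat 1 - Q m) (rev (sorted_list_of_set I))"
    using I assms by (intro map_cong refl) auto
  then show "mprod (map (\<lambda>m. mat 1 - P m) (rev (sorted_list_of_set I))) =
      mprod (map (\<lambda>m. mat 1 - Q m) (rev (sorted_list_of_set I)))" by (simp only:)
qed

lemma sections_cong:
  assumes "\<And>m. m \<in> {1..i} \<Longrightarrow> P m = Q m"
  shows "sections P h J i = sections Q h J i"
  unfolding sections_def by (simp only: Cmat_cong[of i P Q, OF assms])

lemma frame_of_alt:
  "frame_of P h J r \<longleftrightarrow> (\<forall>i<r. P (Suc i) ** P (Suc i) = P (Suc i) \<and>
     range (\<lambda>v. P (Suc i) *v v) = vec.span (sections P h J i))"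
  by (simp add: frame_of_def sections_def)

lemma frame_of_cong:
  assumes "\<And>m. m \<in> {1..i} \<Longrightarrow> P m = Q m" "frame_of P h J i"
  shows "frame_of Q h J i"
proof -
  have "sections Q h J i' = sections P h J i'" if "i' < i" for i'
    by (rule sections_cong) (use assms(1) that in auto)
  then show ?thesis using assms by (simp add: frame_of_alt)
qed

lemma frame_of_Suc:
  "frame_of P h J (Suc i) \<longleftrightarrow> frame_of P h J i \<and> P (Suc i) ** P (Suc i) = P (Suc i) \<and>
     range (\<lambda>v. P (Suc i) *v v) = vec.span (sections P h J i)"
  by (auto simp: frame_of_alt less_Suc_eq)

lemma projs_eq_bundle_proj: "1 \<le> m \<Longrightarrow> m \<le> i \<Longrightarrow> projs J H i m = bundle_proj J H m"
proof (induction i)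
  case (Suc i)
  then show ?case by (cases "m = Suc i") (auto simp: bundle_proj_def)
qed simp

lemma extend_sphere_sphere_filter: "extend_sphere f p = Lim (sphere_filter p) f"
  by (cases p) (simp_all add: extend_sphere_def sphere_filter_def)

lemma bundle_proj_Suc:
  "bundle_proj J H (Suc i) p = Lim (sphere_filter p) (\<lambda>z. orth_proj (vec.span (sections (bundle_at J H z) (jets H z) J i)))"
proof -
  have "{alpha (\<lambda>m. projs J H i m (Some z)) H i k j z | k j. k \<le> i \<and> j \<in> {1..J}} =
      sections (bundle_at J H z) (jets H z) J i" for z
  proof -
    have "Cmat (\<lambda>m. projs J H i m (Some z)) i s = Cmat (bundle_at J H z) i s" for s
      by (rule Cmat_cong) (simp add: projs_eq_bundle_proj bundle_at_def)
    then show ?thesis by (simp add: sections_def alpha_def jets_def)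
  qed
  then show ?thesis by (simp add: bundle_proj_def extend_sphere_sphere_filter)
qed

text \<open>The generators are assembled from derivatives of the array alone, with no projections
  among their coefficients.\<close>

lemma frame_meromorphic:
  assumes "\<forall>l\<le>i. \<forall>j\<in>{1..J}. mero_sphere_vec (H l j)" "j \<in> {1..J}"
  shows "(\<lambda>w. bernstein i (col_series (jets H (chart p w)) k m j) x $ a) meromorphic_on {0}"
proof -
  have "(\<lambda>w. (x ^ q * (1 - x) ^ (i - q)) * (if q < k + m then 0 else vderiv k (H (q - (k + m)) j) (chart p w) $ a))
      meromorphic_on {0}" if "q \<le> i" for q
  proof (cases "q < k + m")
    case False
    have "mero_sphere_vec (H (q - (k + m)) j)" using assms that by simp
    from mero_sphere_chart[OF mero_sphere_vderiv[OF this, of k a], of p] False show ?thesis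
      by (auto intro!: meromorphic_intros)
  qed (simp add: meromorphic_on_const)
  then have "(\<lambda>w. \<Sum>q\<le>i. (x ^ q * (1 - x) ^ (i - q)) * (if q < k + m then 0 else vderiv k (H (q - (k + m)) j) (chart p w) $ a))
      meromorphic_on {0}"
    by (intro meromorphic_on_sum) auto
  also have "(\<lambda>w. \<Sum>q\<le>i. (x ^ q * (1 - x) ^ (i - q)) * (if q < k + m then 0 else vderiv k (H (q - (k + m)) j) (chart p w) $ a))
     = (\<lambda>w. bernstein i (col_series (jets H (chart p w)) k m j) x $ a)"
    by (rule ext) (simp add: bernstein_def col_series_def jets_def if_distrib[of "\<lambda>v. v $ a"] cong: if_cong)
  finally show ?thesis .
qed

text \<open>The projection to be extended is read off at the root of unity \<open>1\<close>, where \<open>\<Phi>\<close> is the identity.\<close>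

lemma bundle_step:
  fixes H :: "'n::finite array"
  assumes mero: "\<forall>l\<le>i. \<forall>j\<in>{1..J}. mero_sphere_vec (H l j)"
    and lim: "\<And>m p. m \<in> {1..i} \<Longrightarrow> ((\<lambda>z. bundle_at J H z m) \<longlongrightarrow> bundle_proj J H m p) (sphere_filter p)"
    and herm: "\<And>m p. m \<in> {1..i} \<Longrightarrow> adj (bundle_proj J H m p) = bundle_proj J H m p"
    and frame: "\<And>p. \<forall>\<^sub>F z in sphere_filter p. frame_of (bundle_at J H z) (jets H z) J i"
  defines "f \<equiv> \<lambda>z. orth_proj (vec.span (sections (bundle_at J H z) (jets H z) J i))"
  shows "\<exists>L. (f \<longlongrightarrow> L) (sphere_filter p)" "\<forall>\<^sub>F z in sphere_filter p. isCont f z"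
proof -
  \<comment> \<open>A vector polynomial of degree at most i is recorded by its coordinates at i + 1
    roots of unity; on such polynomials \<open>coord_inner\<close> over I is a multiple of the inner
    product over the circle.\<close>
  define I where "I = {..<Suc i} \<times> (UNIV :: 'n set)"
  define v where "v b la w = (case b of (k, m, j) \<Rightarrow>
      bernstein i (col_series (jets H (chart p w)) k m j) (runity (Suc i) (fst la)) $ (snd la))" for b la w
  \<comment> \<open>\<open>X\<close> is the polynomial to be projected, \<Phi>_i applied to a basis
    vector; \<open>Y\<close> turns out to be its projection onto the span of the generators.\<close>
  define X where "X b w la = (Phi (plist (bundle_at J H (chart p w)) i) (runity (Suc i) (fst la)) *v axis b 1) $ (snd la)" for b w la
  define Y where "Y b w la = (Phi (plist (bundle_at J H (chart p w)) i) (runity (Suc i) (fst la)) *v (f (chart p w) *v axis b 1)) $ (snd la)" for b w la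
  have finI: "finite I" by (simp add: I_def)
  have mer: "v b la meromorphic_on {0}" if "b \<in> spanned_index (Suc i) J" "la \<in> I" for b la
    using that frame_meromorphic[OF mero] by (auto simp: v_def[abs_def] spanned_index_def)
  have f: "is_orth_proj (vec.span (sections (bundle_at J H z) (jets H z) J i)) (f z)" for z
    unfolding f_def by (rule orth_proj_span[OF finite_sections])
  have Xlim: "\<exists>l. ((\<lambda>w. X b w la) \<longlongrightarrow> l) (at 0)" for b la
  proof -
    have "((\<lambda>w. Phi (plist (bundle_at J H (chart p w)) i) (runity (Suc i) (fst la))) \<longlongrightarrow>
        Phi (plist (\<lambda>m. bundle_proj J H m p) i) (runity (Suc i) (fst la))) (at 0)"
      by (rule tendsto_Phi) (use lim[where p = p] in \<open>simp add: tendsto_sphere_filter\<close>)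
    then show ?thesis
      unfolding X_def by (intro exI) (rule tendsto_vec_nth[OF tendsto_matrix_vector_mult])
  qed
  have nz: "\<forall>\<^sub>F w in at 0. w \<noteq> (0::complex)" by (simp add: eventually_at_filter)
  have Xcont: "\<forall>\<^sub>F w in at 0. isCont (\<lambda>w. X b w la) w" for b la
    using nz
  proof eventually_elim
    case (elim w)
    have "isCont (\<lambda>w. bundle_at J H (chart p w) m) w" if "m \<in> {1..i}" for m
    proof (rule isCont_o2[OF isCont_chart[OF elim]])
      show "isCont (\<lambda>z. bundle_at J H z m) (chart p w)"
        using lim[OF that, of "Some (chart p w)"] by (simp add: isCont_def sphere_filter_def bundle_at_def)
    qed
    then have "((\<lambda>w. Phi (plist (bundle_at J H (chart p w)) i) (runity (Suc i) (fst la))) \<longlongrightarrow>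
        Phi (plist (bundle_at J H (chart p w)) i) (runity (Suc i) (fst la))) (at w)"
      by (intro tendsto_Phi) (simp add: isCont_def)
    then show ?case
      unfolding X_def isCont_def by (rule tendsto_vec_nth[OF tendsto_matrix_vector_mult])
  qed
  have Yproj: "\<forall>\<^sub>F w in at 0. (\<exists>c. \<forall>la\<in>I. Y b w la = (\<Sum>\<beta>\<in>spanned_index (Suc i) J. c \<beta> * v \<beta> la w)) \<and>
     (\<forall>\<beta>\<in>spanned_index (Suc i) J. coord_inner I (\<lambda>la. v \<beta> la w) (\<lambda>la. X b w la - Y b w la) = 0)" for b
    using frame[of p, unfolded eventually_sphere_filter]
  proof eventually_elim
    case (elim w)
    define z where "z = chart p w"
    \<comment> \<open>At index i + 1 the value of \<open>f\<close> is inserted by hand: the bundle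
      there is the limit of \<open>f\<close>, whose existence is still to be proved.\<close>
    define P where "P = (bundle_at J H z)(Suc i := f z)"
    have PB: "P m = bundle_at J H z m" if "m \<in> {1..i}" for m
      using that by (simp add: P_def)
    have plist: "plist (bundle_at J H z) i = plist P i"
      by (rule plist_cong) (simp add: PB)
    have "frame_of P (jets H z) J i"
      by (rule frame_of_cong[OF _ elim[folded z_def]]) (simp add: PB)
    moreover have "sections P (jets H z) J i = sections (bundle_at J H z) (jets H z) J i"
      by (rule sections_cong) (rule PB)
    moreover have "P (Suc i) = f z" by (simp add: P_def)
    ultimately have fr: "frame_of P (jets H z) J (Suc i)"
      unfolding frame_of_Suc using f[of z] by (simp add: is_orth_proj_def)
    have adjP: "adj (P (Suc m)) = P (Suc m)" if "m \<le> i" for m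
    proof (cases "m = i")
      case True
      then show ?thesis using f[of z] by (simp add: is_orth_proj_def P_def)
    next
      case False
      then show ?thesis using that herm[of "Suc m"] by (simp add: PB bundle_at_def)
    qed
    obtain c where c: "\<And>x. Phi (plist P i) x *v (f z *v axis b 1) =
        (\<Sum>(k, m, j)\<in>spanned_index (Suc i) J. c (k, m, j) *s bernstein i (col_series (jets H z) k m j) x)"
      using proj_in_column_span[OF fr, of "axis b 1"] by (auto simp: P_def)
    have "Y b w la = (\<Sum>\<beta>\<in>spanned_index (Suc i) J. c \<beta> * v \<beta> la w)" for la
      unfolding Y_def z_def[symmetric] plist c v_def by (simp add: case_prod_beta)
    moreover have "coord_inner I (\<lambda>la. v \<beta> la w) (\<lambda>la. X b w la - Y b w la) = 0" if "\<beta> \<in> spanned_index (Suc i) J" for \<beta>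
    proof -
      obtain k m j where \<beta>1: "\<beta> = (k, m, j)" by (cases \<beta>)
      then have \<beta>: "\<beta> = (k, m, j)" "j \<in> {1..J}" using that by (auto simp: spanned_index_def)
      have "coord_inner I (\<lambda>la. v \<beta> la w) (\<lambda>la. X b w la - Y b w la) =
        (\<Sum>l<Suc i. cinner (bernstein i (col_series (jets H z) k m j) (runity (Suc i) l))
           (Phi (plist P i) (runity (Suc i) l) *v (axis b 1 - P (Suc i) *v axis b 1)))"
        unfolding coord_inner_def I_def v_def X_def Y_def z_def[symmetric] plist \<beta> cinner_def
        by (simp add: sum.cartesian_product' matrix_vector_mult_diff_distrib P_def del: sum.lessThan_Suc)
      also have "\<dots> = 0"
        by (rule compl_orth_column[OF fr adjP \<beta>(2)])
      finally show ?thesis .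
    qed
    ultimately show ?case by blast
  qed
  have Y0: "Y b w (0, k) = (f (chart p w) *v axis b 1) $ k" for b w k
    by (simp add: Y_def Phi_1)
  have in_I: "(0, k) \<in> I" for k by (simp add: I_def)
  note L = meromorphic_projection_limit[OF finite_spanned_index finI mer Xlim Xcont Yproj in_I, unfolded Y0]
  have "\<exists>a. ((\<lambda>w. f (chart p w)) \<longlongrightarrow> a) (at 0)"
    by (rule tendsto_matrix_columns) (rule L(1))
  then show "\<exists>L. (f \<longlongrightarrow> L) (sphere_filter p)" by (simp add: tendsto_sphere_filter)
  have "\<forall>\<^sub>F w in at 0. \<forall>b\<in>UNIV. \<forall>k\<in>UNIV. isCont (\<lambda>w. (f (chart p w) *v axis b 1) $ k) w"
    by (intro eventually_ball_finite ballI L(2)) auto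
  with nz have "\<forall>\<^sub>F w in at 0. isCont f (chart p w)"
  proof eventually_elim
    case (elim w)
    have "isCont (\<lambda>w. f (chart p w)) w"
      unfolding isCont_def using elim(2)
      by (intro vec_tendstoI) (simp add: mult_axis_nth isCont_def)
    then show ?case using elim(1) by (rule isCont_via_chart)
  qed
  then show "\<forall>\<^sub>F z in sphere_filter p. isCont f z" by (simp add: eventually_sphere_filter)
qed

text \<open>The assertions advance together: extending the next bundle uses convergence and symmetry
  of the earlier ones and their frame property at generic points, while symmetry and idempotence are
  inherited by limits.\<close>

theorem bundle_structure:
  fixes H :: "'n::finite array"
  assumes "\<forall>l<r. \<forall>j\<in>{1..J}. mero_sphere_vec (H l j)" "i \<le> r"
  shows "(\<forall>m\<in>{1..i}. \<forall>p. ((\<lambda>z. bundle_at J H z m) \<longlongrightarrow> bundle_proj J H m p) (sphere_filter p) \<and>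
      adj (bundle_proj J H m p) = bundle_proj J H m p \<and>
      bundle_proj J H m p ** bundle_proj J H m p = bundle_proj J H m p) \<and>
    (\<forall>p. \<forall>\<^sub>F z in sphere_filter p. frame_of (bundle_at J H z) (jets H z) J i)"
  using assms(2)
proof (induction i)
  case 0
  then show ?case by (simp add: frame_of_def)
next
  case (Suc i)
  define f where "f z = orth_proj (vec.span (sections (bundle_at J H z) (jets H z) J i))" for z
  have mero: "\<forall>l\<le>i. \<forall>j\<in>{1..J}. mero_sphere_vec (H l j)" using assms(1) Suc.prems by simp
  have IH: "\<And>m p. m \<in> {1..i} \<Longrightarrow> ((\<lambda>z. bundle_at J H z m) \<longlongrightarrow> bundle_proj J H m p) (sphere_filter p)"
    "\<And>m p. m \<in> {1..i} \<Longrightarrow> adj (bundle_proj J H m p) = bundle_proj J H m p"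
    "\<And>m p. m \<in> {1..i} \<Longrightarrow> bundle_proj J H m p ** bundle_proj J H m p = bundle_proj J H m p"
    "\<And>p. \<forall>\<^sub>F z in sphere_filter p. frame_of (bundle_at J H z) (jets H z) J i"
    using Suc by auto
  have step: "\<exists>L. (f \<longlongrightarrow> L) (sphere_filter p)" "\<forall>\<^sub>F z in sphere_filter p. isCont f z" for p
    unfolding f_def[abs_def]
    by (rule bundle_step[OF mero IH(1,2,4)]; assumption)+
  have fproj: "is_orth_proj (vec.span (sections (bundle_at J H z) (jets H z) J i)) (f z)" for z
    unfolding f_def by (rule orth_proj_span[OF finite_sections])
  have B: "bundle_proj J H (Suc i) p = Lim (sphere_filter p) f" for p
    by (simp add: bundle_proj_Suc f_def[abs_def])
  have flim: "(f \<longlongrightarrow> bundle_proj J H (Suc i) p) (sphere_filter p)" for p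
    using step(1)[of p] tendsto_Lim[OF sphere_filter_not_bot] unfolding B by blast
  \<comment> \<open>By definition the bundle at z is the limit of \<open>f\<close> at z, whatever
    \<open>f z\<close> may be; continuity identifies the two.\<close>
  have Bf: "bundle_at J H z (Suc i) = f z" if "isCont f z" for z
    using tendsto_unique[OF sphere_filter_not_bot flim[of "Some z"]] that by (simp add: isCont_def sphere_filter_def bundle_at_def)
  have ev: "\<forall>\<^sub>F z in sphere_filter p. bundle_at J H z (Suc i) = f z" for p
    using step(2)[of p] by (rule eventually_mono) (rule Bf)
  have "((\<lambda>z. bundle_at J H z (Suc i)) \<longlongrightarrow> bundle_proj J H (Suc i) p) (sphere_filter p)" for p
    by (rule Lim_transform_eventually[OF flim]) (use ev[of p] in \<open>auto elim: eventually_mono\<close>)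
  moreover have "adj (bundle_proj J H (Suc i) p) = bundle_proj J H (Suc i) p" for p
  proof (rule tendsto_unique[OF sphere_filter_not_bot _ flim])
    show "(f \<longlongrightarrow> adj (bundle_proj J H (Suc i) p)) (sphere_filter p)"
      using tendsto_adj[OF flim[of p]] fproj by (simp add: is_orth_proj_def)
  qed
  moreover have "bundle_proj J H (Suc i) p ** bundle_proj J H (Suc i) p = bundle_proj J H (Suc i) p" for p
  proof (rule tendsto_unique[OF sphere_filter_not_bot _ flim])
    show "(f \<longlongrightarrow> bundle_proj J H (Suc i) p ** bundle_proj J H (Suc i) p) (sphere_filter p)"
      using tendsto_matrix_mult[OF flim[of p] flim[of p]] fproj by (simp add: is_orth_proj_def)
  qed
  moreover have "\<forall>\<^sub>F z in sphere_filter p. frame_of (bundle_at J H z) (jets H z) J (Suc i)" for p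
    using IH(4)[of p] ev[of p]
  proof eventually_elim
    case (elim z)
    then show ?case using fproj[of z] by (simp add: frame_of_Suc is_orth_proj_def)
  qed
  ultimately show ?case using IH by (auto simp: le_Suc_eq)
qed

section \<open>Fourier analysis on the circle and uniqueness of the Iwasawa factor\<close>

section \<open>Fourier coefficients of continuous functions on the circle\<close>

lemma integrable_circle: "continuous_on UNIV F \<Longrightarrow> F integrable_on {0..2*pi}" for F :: "real \<Rightarrow> complex"
  by (rule integrable_continuous_real) (rule continuous_on_subset, auto)

lemma polynomial_cis_continuous:
  fixes p :: "complex \<Rightarrow> 'a::euclidean_space"
  assumes "polynomial_function p"
  shows "continuous_on UNIV (\<lambda>\<theta>. p (cis \<theta>))"
  by (rule continuous_on_compose2[OF continuous_on_polymonial_function[OF assms, of UNIV]])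
    (simp_all add: continuous_on_cis continuous_on_id)

text \<open>On the circle a real linear function is a combination of \<open>cis \<theta>\<close> and
  its inverse, so multiplication by it shifts Fourier coefficients by one in both directions. The
  factor \<open>q\<close> is arbitrary so that a product can be treated by absorbing one polynomial
  into it.\<close>

lemma real_polynomial_on_circle:
  assumes "real_polynomial_function p"
    and "continuous_on UNIV q" "\<And>m::int. integral {0..2*pi} (\<lambda>\<theta>. q \<theta> * cis (of_int m * \<theta>)) = 0"
  shows "integral {0..2*pi} (\<lambda>\<theta>. q \<theta> * of_real (p (cis \<theta>)) * cis (of_int m * \<theta>)) = 0"
  using assms
proof (induction arbitrary: q m)
  case (linear f)
  define a where "a = (of_real (f 1) - \<i> * of_real (f \<i>)) / 2"
  define b where "b = (of_real (f 1) + \<i> * of_real (f \<i>)) / 2"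
  have f: "of_real (f (cis \<theta>)) = a * cis \<theta> + b * cis (- \<theta>)" for \<theta>
  proof -
    have "cis \<theta> = cos \<theta> *\<^sub>R 1 + sin \<theta> *\<^sub>R \<i>" by (simp add: complex_eq_iff)
    then have "f (cis \<theta>) = cos \<theta> * f 1 + sin \<theta> * f \<i>"
      using linear(1) by (simp add: bounded_linear.linear linear_add linear_scale)
    then show ?thesis by (simp add: a_def b_def complex_eq_iff field_simps)
  qed
  have "(\<lambda>\<theta>. q \<theta> * of_real (f (cis \<theta>)) * cis (of_int m * \<theta>)) =
      (\<lambda>\<theta>. a * (q \<theta> * cis (of_int (m + 1) * \<theta>)) + b * (q \<theta> * cis (of_int (m - 1) * \<theta>)))"
  proof
    fix \<theta>
    have "cis (of_int (m + 1) * \<theta>) = cis \<theta> * cis (of_int m * \<theta>)"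
      "cis (of_int (m - 1) * \<theta>) = cis (- \<theta>) * cis (of_int m * \<theta>)"
      by (simp_all add: cis_mult algebra_simps)
    then show "q \<theta> * of_real (f (cis \<theta>)) * cis (of_int m * \<theta>) =
      a * (q \<theta> * cis (of_int (m + 1) * \<theta>)) + b * (q \<theta> * cis (of_int (m - 1) * \<theta>))"
      unfolding f by (simp only: algebra_simps)
  qed
  moreover have "(\<lambda>\<theta>. c * (q \<theta> * cis (of_int k * \<theta>))) integrable_on {0..2*pi}" for c k
    by (intro integrable_circle continuous_intros linear)
  ultimately show ?case
    using linear(3) by (simp add: integral_add del: of_int_add of_int_diff)
next
  case (const c)
  have "(\<lambda>\<theta>. q \<theta> * of_real c * cis (of_int m * \<theta>)) = (\<lambda>\<theta>. of_real c * (q \<theta> * cis (of_int m * \<theta>)))"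
    by (simp add: mult_ac)
  then show ?case using const by simp
next
  case (add f g)
  have cont: "continuous_on UNIV (\<lambda>\<theta>. h (cis \<theta>))" if "real_polynomial_function h" for h :: "complex \<Rightarrow> real"
    using that unfolding real_polynomial_function_eq by (rule polynomial_cis_continuous)
  have "(\<lambda>\<theta>. q \<theta> * of_real (f (cis \<theta>) + g (cis \<theta>)) * cis (of_int m * \<theta>)) =
    (\<lambda>\<theta>. q \<theta> * of_real (f (cis \<theta>)) * cis (of_int m * \<theta>) + q \<theta> * of_real (g (cis \<theta>)) * cis (of_int m * \<theta>))"
    by (simp add: algebra_simps)
  moreover have "(\<lambda>\<theta>. q \<theta> * of_real (h (cis \<theta>)) * cis (of_int m * \<theta>)) integrable_on {0..2*pi}"
    if "real_polynomial_function h" for h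
    by (intro integrable_circle continuous_intros add.prems(1) cont that)
  ultimately show ?case using add by (simp add: integral_add)
next
  case (mult f g)
  have "continuous_on UNIV (\<lambda>\<theta>. f (cis \<theta>))"
    using mult.hyps(1) unfolding real_polynomial_function_eq by (rule polynomial_cis_continuous)
  then have "continuous_on UNIV (\<lambda>\<theta>. q \<theta> * of_real (f (cis \<theta>)))"
    by (intro continuous_intros mult.prems(1))
  moreover have "integral {0..2*pi} (\<lambda>\<theta>. q \<theta> * of_real (f (cis \<theta>)) * cis (of_int m * \<theta>)) = 0" for m
    by (rule mult.IH(1)[OF mult.prems])
  ultimately have "integral {0..2*pi} (\<lambda>\<theta>. q \<theta> * of_real (f (cis \<theta>)) * of_real (g (cis \<theta>)) * cis (of_int m * \<theta>)) = 0"
    by (rule mult.IH(2))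
  then show ?case by (simp add: mult_ac)
qed

text \<open>Rotating z0 to 1, where the argument is continuous, gives a local inverse of
  \<open>cis\<close> near z0 clear of the branch cut.\<close>

lemma continuous_on_circle:
  fixes g :: "complex \<Rightarrow> complex"
  assumes "continuous_on UNIV (\<lambda>\<theta>. g (cis \<theta>))"
  shows "continuous_on (sphere 0 1) g"
  unfolding continuous_on_eq_continuous_within
proof
  fix z0 :: complex assume z0: "z0 \<in> sphere 0 1"
  then have nz: "z0 \<noteq> 0" by auto
  define h where "h z = g (cis (Arg (z / z0) + Arg z0))" for z
  have "isCont Arg (z0 / z0)"
    using nz by (intro continuous_at_Arg) simp
  then have "isCont (\<lambda>z. Arg (z / z0)) z0"
    using nz by (intro isCont_o2[of _ "\<lambda>z. z / z0" Arg]) (auto intro!: continuous_intros)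
  then have c: "isCont (\<lambda>z. Arg (z / z0) + Arg z0) z0"
    by (intro continuous_intros)
  have "isCont (\<lambda>\<theta>. g (cis \<theta>)) (Arg (z0 / z0) + Arg z0)"
    using assms by (simp add: continuous_on_eq_continuous_at)
  from isCont_o2[OF c this] have "isCont h z0"
    by (simp add: h_def[abs_def])
  then have "continuous (at z0 within sphere 0 1) h"
    by (rule continuous_at_imp_continuous_at_within)
  moreover have "h z = g z" if "z \<in> sphere 0 1" for z
  proof -
    have n: "norm z = 1" "norm z0 = 1" using that z0 by auto
    have "cis (Arg (z / z0)) = z / z0"
      using n nz by (subst cis_Arg) (auto simp: sgn_div_norm norm_divide)
    moreover have "cis (Arg z0) = z0" using n nz by (simp add: cis_Arg sgn_div_norm)
    ultimately show ?thesis using nz by (simp add: h_def cis_mult[symmetric])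
  qed
  ultimately show "continuous (at z0 within sphere 0 1) g"
    using z0 unfolding continuous_within
    by (auto intro!: Lim_transform_within[of h _ z0 "sphere 0 1" 1 g])
qed

lemma cis_surj_circle: "norm z = 1 \<Longrightarrow> \<exists>\<theta>\<in>{0..2*pi}. z = cis \<theta>"
  using Arg2pi[of z] by (intro bexI[of _ "Arg2pi z"]) (auto simp: cis_conv_exp is_Arg_def)

text \<open>By Stone-Weierstrass the conjugate of g is a uniform limit of polynomials in the real
  coordinates, each of which integrates to zero against g. Hence the integral of the squared modulus
  of g vanishes, and continuity does the rest.\<close>

lemma fourier_zero_imp_zero:
  assumes cont: "continuous_on UNIV (\<lambda>\<theta>. g (cis \<theta>))"
    and int0: "\<And>m::int. integral {0..2*pi} (\<lambda>\<theta>. g (cis \<theta>) * cis (of_int m * \<theta>)) = 0"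
    and z: "norm z = 1"
  shows "g z = 0"
proof -
  define w where "w \<theta> = g (cis \<theta>)" for \<theta>
  have w: "continuous_on UNIV w" using cont by (simp add: w_def[abs_def])
  have bounded: "bounded (w ` {0..2*pi})"
    by (intro compact_imp_bounded compact_continuous_image continuous_on_subset[OF w]) auto
  then obtain M where M: "M > 0" "\<And>\<theta>. \<theta> \<in> {0..2*pi} \<Longrightarrow> norm (w \<theta>) \<le> M"
    unfolding bounded_pos by auto
  have small: "norm (integral {0..2*pi} (\<lambda>\<theta>. w \<theta> * cnj (w \<theta>))) \<le> M * e * (2 * pi)" if e: "e > 0" for e
  proof -
    have "continuous_on (sphere 0 1) (\<lambda>z. cnj (g z))"
      by (intro continuous_intros continuous_on_circle cont)
    from Stone_Weierstrass_polynomial_function[OF compact_sphere this e]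
    obtain p where p: "polynomial_function p" "\<forall>z\<in>sphere 0 1. norm (cnj (g z) - p z) < e"
      by (elim exE conjE)
    have pc: "continuous_on UNIV (\<lambda>\<theta>. p (cis \<theta>))"
      by (rule polynomial_cis_continuous[OF p(1)])
    have re: "real_polynomial_function (\<lambda>z. Re (p z))" "real_polynomial_function (\<lambda>z. Im (p z))"
      using p(1) bounded_linear_Re bounded_linear_Im by (auto simp: polynomial_function_def o_def)
    have zero: "integral {0..2*pi} (\<lambda>\<theta>. w \<theta> * of_real (r (cis \<theta>))) = 0" if "real_polynomial_function r" for r
      using real_polynomial_on_circle[OF that w, of 0] int0 by (simp add: w_def)
    have rc: "continuous_on UNIV (\<lambda>\<theta>. Re (p (cis \<theta>)))" "continuous_on UNIV (\<lambda>\<theta>. Im (p (cis \<theta>)))"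
      by (intro continuous_intros pc)+
    have "integral {0..2*pi} (\<lambda>\<theta>. w \<theta> * p (cis \<theta>)) =
      integral {0..2*pi} (\<lambda>\<theta>. w \<theta> * of_real (Re (p (cis \<theta>))) + \<i> * (w \<theta> * of_real (Im (p (cis \<theta>)))))"
      by (rule integral_cong) (simp add: complex_eq_iff algebra_simps)
    also have "\<dots> = integral {0..2*pi} (\<lambda>\<theta>. w \<theta> * of_real (Re (p (cis \<theta>)))) + \<i> * integral {0..2*pi} (\<lambda>\<theta>. w \<theta> * of_real (Im (p (cis \<theta>))))"
      by (subst integral_add) (auto intro!: integrable_circle continuous_intros w rc)
    also have "\<dots> = 0"
      using zero[OF re(1)] zero[OF re(2)] by simp
    finally have "integral {0..2*pi} (\<lambda>\<theta>. w \<theta> * cnj (w \<theta>)) = integral {0..2*pi} (\<lambda>\<theta>. w \<theta> * (cnj (w \<theta>) - p (cis \<theta>)))"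
      by (simp add: right_diff_distrib, subst integral_diff) (auto intro!: integrable_circle continuous_intros w pc)
    also have "norm \<dots> \<le> M * e * (2 * pi - 0)"
    proof (rule integral_bound)
      show "continuous_on {0..2*pi} (\<lambda>\<theta>. w \<theta> * (cnj (w \<theta>) - p (cis \<theta>)))"
        by (intro continuous_intros continuous_on_subset[OF w] continuous_on_subset[OF pc]) auto
      fix \<theta> :: real assume "\<theta> \<in> {0..2*pi}"
      then show "norm (w \<theta> * (cnj (w \<theta>) - p (cis \<theta>))) \<le> M * e"
        unfolding norm_mult using M p(2)[rule_format, of "cis \<theta>"]
        by (intro mult_mono) (auto simp: w_def)
    qed simp
    finally show ?thesis by simp
  qed
  have "norm (integral {0..2*pi} (\<lambda>\<theta>. w \<theta> * cnj (w \<theta>))) \<le> 0 + e" if "e > 0" for e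
    using small[of "e / (M * (2 * pi))"] that M(1) by (simp add: field_simps)
  then have "norm (integral {0..2*pi} (\<lambda>\<theta>. w \<theta> * cnj (w \<theta>))) \<le> 0"
    by (rule field_le_epsilon)
  then have "integral {0..2*pi} (\<lambda>\<theta>. w \<theta> * cnj (w \<theta>)) = 0" by simp
  also have "(\<lambda>\<theta>. w \<theta> * cnj (w \<theta>)) = (\<lambda>\<theta>. complex_of_real ((norm (w \<theta>))\<^sup>2))"
    by (rule ext) (rule complex_norm_square[symmetric])
  finally have "integral {0..2*pi} (\<lambda>\<theta>. complex_of_real ((norm (w \<theta>))\<^sup>2)) = 0" .
  moreover have "(\<lambda>\<theta>. (norm (w \<theta>))\<^sup>2) integrable_on {0..2*pi}"
    by (intro integrable_continuous_real continuous_intros continuous_on_subset[OF w]) auto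
  ultimately have "integral {0..2*pi} (\<lambda>\<theta>. (norm (w \<theta>))\<^sup>2) = 0"
    using integral_linear[OF _ bounded_linear_of_real[where 'a = complex], of "\<lambda>\<theta>. (norm (w \<theta>))\<^sup>2" "{0..2*pi}"]
    by (simp add: o_def)
  then have "\<forall>\<theta>\<in>{0..2*pi}. (norm (w \<theta>))\<^sup>2 = 0"
    by (subst (asm) integral_eq_0_iff) (auto intro!: continuous_intros continuous_on_subset[OF w])
  then show ?thesis using cis_surj_circle[OF z] by (auto simp: w_def)
qed

lemma integral_cis_int: "m \<noteq> 0 \<Longrightarrow> integral {0..2*pi} (\<lambda>\<theta>. cis (of_int m * \<theta>)) = 0" for m :: int
proof -
  assume m: "m \<noteq> 0"
  let ?F = "\<lambda>\<theta>. cis (of_int m * \<theta>) / (\<i> * of_int m)"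
  have "(?F has_vector_derivative cis (of_int m * \<theta>)) (at \<theta> within {0..2*pi})" for \<theta>
    unfolding has_vector_derivative_def using m
    by (auto intro!: derivative_eq_intros simp: scaleR_conv_of_real mult.left_commute[of _ "\<i>"])
  then have "((\<lambda>\<theta>. cis (of_int m * \<theta>)) has_integral ?F (2 * pi) - ?F 0) {0..2*pi}"
    by (intro fundamental_theorem_of_calculus) auto
  moreover have "cis (of_int m * (2 * pi)) = 1"
    using cis_multiple_2pi[of "of_int m"] by (simp add: mult_ac)
  ultimately show ?thesis by (simp add: integral_unique)
qed

lemma fourier_constant:
  assumes cont: "continuous_on UNIV (\<lambda>\<theta>. g (cis \<theta>))"
    and int0: "\<And>m::int. m \<noteq> 0 \<Longrightarrow> integral {0..2*pi} (\<lambda>\<theta>. g (cis \<theta>) * cis (of_int m * \<theta>)) = 0"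
    and z: "norm z = 1"
  shows "g z = g 1"
proof -
  define c where "c = integral {0..2*pi} (\<lambda>\<theta>. g (cis \<theta>)) / (2 * pi)"
  have zero: "(\<lambda>z. g z - c) z = 0" if "norm z = 1" for z
  proof (rule fourier_zero_imp_zero[OF _ _ that])
    show "continuous_on UNIV (\<lambda>\<theta>. g (cis \<theta>) - c)" by (intro continuous_intros cont)
    fix m :: int
    have "integral {0..2*pi} (\<lambda>\<theta>. (g (cis \<theta>) - c) * cis (of_int m * \<theta>)) =
      integral {0..2*pi} (\<lambda>\<theta>. g (cis \<theta>) * cis (of_int m * \<theta>)) - c * integral {0..2*pi} (\<lambda>\<theta>. cis (of_int m * \<theta>))"
      by (simp add: left_diff_distrib, subst integral_diff) (auto intro!: integrable_circle continuous_intros cont)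
    also have "\<dots> = 0"
      by (cases "m = 0") (simp_all add: int0 integral_cis_int c_def scaleR_conv_of_real)
    finally show "integral {0..2*pi} (\<lambda>\<theta>. (g (cis \<theta>) - c) * cis (of_int m * \<theta>)) = 0" .
  qed
  show ?thesis using zero[OF z] zero[of 1] by simp
qed

section \<open>Polynomial loops\<close>

lemma linear_mat_mult: "linear (\<lambda>c. mat c ** A)" for A :: "complex^'n^'n"
  by (rule linearI) (simp_all add: mat_mult_left vec_eq_iff algebra_simps)

lemma scaleR_poly_loop: "v *\<^sub>R poly_loop N A x = poly_loop N (\<lambda>m. mat (of_real v) ** A m) x"
proof -
  have "v *\<^sub>R (mat c ** A m) = mat c ** (mat (of_real v) ** A m)" for c m
    by (simp add: mat_mult_left vec_eq_iff vector_scaleR_component scaleR_conv_of_real[where 'a = complex] mult_ac)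
  then show ?thesis by (simp add: poly_loop_def scaleR_right.sum)
qed

lemma poly_loop_has_derivative:
  "((\<lambda>\<theta>. poly_loop N A (cis \<theta>)) has_derivative
    (\<lambda>v. v *\<^sub>R poly_loop N (\<lambda>m. mat (\<i> * of_nat m) ** A m) (cis \<theta>))) (at \<theta>)"
proof -
  have "((\<lambda>\<theta>. mat (cis (real m * \<theta>)) ** A m) has_derivative
      (\<lambda>v. mat ((v * real m) *\<^sub>R (\<i> * cis (real m * \<theta>))) ** A m)) (at \<theta>)" for m
  proof (rule bounded_linear.has_derivative[OF linear_conv_bounded_linear[THEN iffD1, OF linear_mat_mult]])
    show "((\<lambda>\<theta>. cis (real m * \<theta>)) has_derivative (\<lambda>v. (v * real m) *\<^sub>R (\<i> * cis (real m * \<theta>)))) (at \<theta>)"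
      by (auto intro!: derivative_eq_intros simp: mult.commute)
  qed
  then have "((\<lambda>\<theta>. \<Sum>m\<le>N. mat (cis (real m * \<theta>)) ** A m) has_derivative
      (\<lambda>v. \<Sum>m\<le>N. mat ((v * real m) *\<^sub>R (\<i> * cis (real m * \<theta>))) ** A m)) (at \<theta>)"
    by (rule has_derivative_sum)
  moreover have "(\<Sum>m\<le>N. mat ((v * real m) *\<^sub>R (\<i> * cis (real m * \<theta>))) ** A m)
      = v *\<^sub>R poly_loop N (\<lambda>m. mat (\<i> * of_nat m) ** A m) (cis \<theta>)" for v
    unfolding poly_loop_def scaleR_right.sum
    by (rule sum.cong) (simp_all add: Complex.DeMoivre mat_mult_left vec_eq_iff vector_scaleR_component scaleR_conv_of_real[where 'a = complex] mult_ac)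
  ultimately show ?thesis by (simp add: poly_loop_def Complex.DeMoivre)
qed

text \<open>Differentiation in \<theta> only multiplies the coefficients by \<i> m, so the induction
  on the order runs over all coefficient families.\<close>

lemma smooth_poly_loop: "smooth_loop (poly_loop N A)"
proof -
  have "C_order k (\<lambda>\<theta>. poly_loop N A (cis \<theta>))" for k
  proof (induction k arbitrary: A)
    case 0
    have "(\<lambda>\<theta>. poly_loop N A (cis \<theta>)) differentiable at \<theta>" for \<theta>
      using poly_loop_has_derivative by (auto simp: differentiable_def)
    then show ?case
      by (simp add: continuous_on_eq_continuous_at differentiable_imp_continuous_within)
  next
    case (Suc k)
    have "frechet_derivative (\<lambda>\<theta>. poly_loop N A (cis \<theta>)) (at \<theta>) v =
        poly_loop N (\<lambda>m. mat (of_real v) ** (mat (\<i> * of_nat m) ** A m)) (cis \<theta>)" for \<theta> v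
      by (subst frechet_derivative_at[OF poly_loop_has_derivative, symmetric]) (rule scaleR_poly_loop)
    moreover have "(\<lambda>\<theta>. poly_loop N A (cis \<theta>)) differentiable_on UNIV"
      using poly_loop_has_derivative by (auto simp: differentiable_on_def differentiable_def)
    ultimately show ?case using Suc by simp
  qed
  then show ?thesis by (simp add: smooth_loop_def C_infinity_def)
qed

lemma smooth_loop_cong:
  assumes "smooth_loop \<gamma>" "\<And>x. norm x = 1 \<Longrightarrow> \<gamma> x = \<delta> x"
  shows "smooth_loop \<delta>"
  using assms by (simp add: smooth_loop_def)

lemma smooth_loop_continuous:
  assumes "smooth_loop \<gamma>"
  shows "continuous_on UNIV (\<lambda>\<theta>. \<gamma> (cis \<theta>) $ a $ b)"
proof -
  have "C_order 0 (\<lambda>\<theta>. \<gamma> (cis \<theta>))"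
    using assms unfolding smooth_loop_def C_infinity_def by blast
  then have "continuous_on UNIV (\<lambda>\<theta>. \<gamma> (cis \<theta>))" by simp
  then show ?thesis
    by (intro bounded_linear.continuous_on[OF bounded_linear_vec_nth])
qed

section \<open>Uniqueness of the Iwasawa factor\<close>

definition neg_free :: "(real \<Rightarrow> complex) \<Rightarrow> bool" where
  "neg_free F \<longleftrightarrow> continuous_on UNIV F \<and>
     (\<forall>m<0. integral {0..2*pi} (\<lambda>\<theta>. F \<theta> * cis (- of_int m * \<theta>)) = 0)"

lemma neg_free_sum:
  assumes "\<And>x. x \<in> X \<Longrightarrow> neg_free (F x)"
  shows "neg_free (\<lambda>\<theta>. \<Sum>x\<in>X. F x \<theta>)"
proof (cases "finite X")
  case True
  have cont: "continuous_on UNIV (F x)" if "x \<in> X" for x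
    using assms[OF that] by (simp add: neg_free_def)
  have "integral {0..2*pi} (\<lambda>\<theta>. (\<Sum>x\<in>X. F x \<theta>) * cis (- of_int m * \<theta>)) = 0" if "m < 0" for m
  proof -
    have "integral {0..2*pi} (\<lambda>\<theta>. \<Sum>x\<in>X. F x \<theta> * cis (- of_int m * \<theta>)) =
        (\<Sum>x\<in>X. integral {0..2*pi} (\<lambda>\<theta>. F x \<theta> * cis (- of_int m * \<theta>)))"
      by (rule integral_sum[OF True]) (intro integrable_circle continuous_intros cont)
    also have "\<dots> = 0"
      using assms that by (intro sum.neutral) (auto simp: neg_free_def)
    finally show ?thesis by (simp only: sum_distrib_right)
  qed
  then show ?thesis unfolding neg_free_def by (auto intro!: continuous_intros cont)
qed (simp add: neg_free_def)

lemma neg_free_one: "neg_free (\<lambda>_. 1)"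
  unfolding neg_free_def
proof (intro conjI allI impI)
  fix m :: int assume "m < 0"
  then show "integral {0..2*pi} (\<lambda>\<theta>. 1 * cis (- of_int m * \<theta>)) = 0"
    using integral_cis_int[of "- m"] by simp
qed simp

lemma neg_free_mult:
  assumes "neg_free F"
  shows "neg_free (\<lambda>\<theta>. cis \<theta> ^ k * c * F \<theta>)"
proof -
  have "integral {0..2*pi} (\<lambda>\<theta>. cis \<theta> ^ k * c * F \<theta> * cis (- of_int m * \<theta>)) = 0" if "m < 0" for m
  proof -
    have eq: "cis \<theta> ^ k * c * F \<theta> * cis (- of_int m * \<theta>) = c * (F \<theta> * cis (- of_int (m - int k) * \<theta>))" for \<theta>
    proof -
      have "cis (- of_int (m - int k) * \<theta>) = cis \<theta> ^ k * cis (- of_int m * \<theta>)"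
        by (simp add: Complex.DeMoivre cis_mult algebra_simps)
      then show ?thesis by (simp only: mult_ac)
    qed
    have "integral {0..2*pi} (\<lambda>\<theta>. F \<theta> * cis (- of_int (m - int k) * \<theta>)) = 0"
      using assms[unfolded neg_free_def, THEN conjunct2, rule_format, of "m - int k"] that by simp
    then show ?thesis unfolding eq by (simp only: integral_mult_right mult_zero_right)
  qed
  then show ?thesis using assms unfolding neg_free_def by (auto intro!: continuous_intros)
qed

lemma poly_loop_nth: "poly_loop N A x $ a $ b = (\<Sum>m\<le>N. x ^ m * A m $ a $ b)"
  by (simp add: poly_loop_def mat_mult_left)

lemma neg_free_poly_loop_mult:
  assumes "\<And>c. neg_free (F c)"
  shows "neg_free (\<lambda>\<theta>. \<Sum>c\<in>UNIV. poly_loop N A (cis \<theta>) $ a $ c * F c \<theta>)"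
  unfolding poly_loop_nth sum_distrib_right by (intro neg_free_sum neg_free_mult assms)

lemma neg_free_poly_loop: "neg_free (\<lambda>\<theta>. poly_loop N A (cis \<theta>) $ a $ b)"
proof -
  have "neg_free (\<lambda>\<theta>. \<Sum>m\<le>N. cis \<theta> ^ m * A m $ a $ b * 1)"
    by (intro neg_free_sum neg_free_mult neg_free_one)
  then show ?thesis by (simp add: poly_loop_nth)
qed

lemma fourier_coeff_eq_0_iff:
  "fourier_coeff \<gamma> m = 0 \<longleftrightarrow>
    (\<forall>a b. integral {0..2*pi} (\<lambda>\<theta>. \<gamma> (cis \<theta>) $ a $ b * cis (- of_int m * \<theta>)) = 0)"
  by (simp add: fourier_coeff_def vec_eq_iff)

lemma matrix_inv_mult:
  fixes A :: "complex^'n^'n"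
  assumes "invertible A"
  shows "A ** matrix_inv A = mat 1" "matrix_inv A ** A = mat 1"
proof -
  have "\<exists>B. A ** B = mat 1 \<and> B ** A = mat 1" using assms by (simp add: invertible_def)
  from someI_ex[OF this] show "A ** matrix_inv A = mat 1" "matrix_inv A ** A = mat 1"
    by (simp_all add: matrix_inv_def)
qed

lemma matrix_inv_eqI:
  fixes A B :: "complex^'n^'n"
  assumes "A ** B = mat 1" "B ** A = mat 1"
  shows "matrix_inv A = B"
proof -
  have "invertible A" using assms by (auto simp: invertible_def)
  then have "matrix_inv A ** (A ** B) = B" by (simp add: matrix_mul_assoc matrix_inv_mult)
  then show ?thesis by (simp add: assms)
qed

lemma loops_plusI:
  fixes \<delta> :: "complex \<Rightarrow> complex^'n^'n"
  assumes "\<And>x. norm x = 1 \<Longrightarrow> \<delta> x = poly_loop N A x"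
    and "\<And>x. norm x = 1 \<Longrightarrow> poly_loop N A x ** poly_loop N' A' x = mat 1"
    and "\<And>x. norm x = 1 \<Longrightarrow> poly_loop N' A' x ** poly_loop N A x = mat 1"
  shows "\<delta> \<in> loops_plus"
proof -
  have inv: "matrix_inv (\<delta> x) = poly_loop N' A' x" if "norm x = 1" for x
    by (rule matrix_inv_eqI) (simp_all add: assms that)
  have "invertible (\<delta> x)" if "norm x = 1" for x
    using assms[OF that] by (auto simp: invertible_def)
  moreover have "smooth_loop \<delta>"
    by (rule smooth_loop_cong[OF smooth_poly_loop[of N A]]) (simp add: assms(1))
  moreover have "fourier_coeff \<delta> m = 0" if "m < 0" for m
    using neg_free_poly_loop[of N A] that
    unfolding fourier_coeff_eq_0_iff by (simp add: assms(1) neg_free_def)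
  moreover have "fourier_coeff (\<lambda>x. matrix_inv (\<delta> x)) m = 0" if "m < 0" for m
    using neg_free_poly_loop[of N' A'] that
    unfolding fourier_coeff_eq_0_iff by (simp add: inv neg_free_def)
  ultimately show ?thesis by (simp add: loops_plus_def loops_GL_def)
qed

text \<open>Let W be the adjoint of U times another unitary factor V. Comparing factorizations
  expresses W as the product of one nonnegative factor with the inverse of the other, so W has no
  negative Fourier coefficients. The same holds for its adjoint, which is its inverse; hence W has
  no positive ones either. It is constant, and equals the identity at 1.\<close>

theorem iwasawa_u_eq:
  fixes \<gamma> :: "complex \<Rightarrow> complex^'n^'n"
  assumes U: "U \<in> based_loops"
    and fac: "\<And>x. norm x = 1 \<Longrightarrow> \<gamma> x = U x ** poly_loop N A x"
    and inv: "\<And>x. norm x = 1 \<Longrightarrow> poly_loop N A x ** poly_loop N' A' x = mat 1"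
      "\<And>x. norm x = 1 \<Longrightarrow> poly_loop N' A' x ** poly_loop N A x = mat 1"
    and x: "norm x = 1"
  shows "iwasawa_u \<gamma> x = U x"
proof -
  define V where "V = iwasawa_u \<gamma>"
  have "poly_loop N A \<in> loops_plus"
    by (rule loops_plusI[OF refl inv])
  then have "U \<in> based_loops \<and> (\<exists>\<delta>\<in>loops_plus. \<forall>\<zeta>\<in>sphere 0 1. \<gamma> \<zeta> = U \<zeta> ** \<delta> \<zeta>)"
    using U fac by auto
  \<comment> \<open>\<open>U\<close> witnesses that the choice in \<open>iwasawa_u\<close> is not
    void.\<close>
  then have "V \<in> based_loops \<and> (\<exists>\<delta>\<in>loops_plus. \<forall>\<zeta>\<in>sphere 0 1. \<gamma> \<zeta> = V \<zeta> ** \<delta> \<zeta>)"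
    unfolding V_def iwasawa_u_def
    by (rule someI[where P = "\<lambda>V. V \<in> based_loops \<and> (\<exists>\<delta>\<in>loops_plus. \<forall>\<zeta>\<in>sphere 0 1. \<gamma> \<zeta> = V \<zeta> ** \<delta> \<zeta>)"])
  then obtain \<epsilon> where V: "V \<in> based_loops" and \<epsilon>: "\<epsilon> \<in> loops_plus"
    and fac': "\<And>x. norm x = 1 \<Longrightarrow> \<gamma> x = V x ** \<epsilon> x" by auto
  let ?D = "poly_loop N A" and ?D' = "poly_loop N' A'"
  have unit: "adj (U y) ** U y = mat 1" "U y ** adj (U y) = mat 1"
    "adj (V y) ** V y = mat 1" "V y ** adj (V y) = mat 1" if "norm y = 1" for y
    using U V that by (auto simp: based_loops_def unitary_group_def image_subset_iff)
  have \<epsilon>inv: "\<epsilon> y ** matrix_inv (\<epsilon> y) = mat 1" "matrix_inv (\<epsilon> y) ** \<epsilon> y = mat 1" if "norm y = 1" for y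
    using \<epsilon> that by (auto simp: loops_plus_def loops_GL_def matrix_inv_mult)
  define W where "W y = adj (U y) ** V y" for y
  have W1: "W y = ?D y ** matrix_inv (\<epsilon> y)" if y: "norm y = 1" for y
  proof -
    have "W y = adj (U y) ** (V y ** \<epsilon> y) ** matrix_inv (\<epsilon> y)"
      by (simp add: W_def \<epsilon>inv[OF y] flip: matrix_mul_assoc)
    also have "\<dots> = (adj (U y) ** U y) ** ?D y ** matrix_inv (\<epsilon> y)"
      using fac[OF y] fac'[OF y] by (simp add: matrix_mul_assoc)
    finally show ?thesis by (simp add: unit[OF y])
  qed
  have W2: "adj (W y) = \<epsilon> y ** ?D' y" if y: "norm y = 1" for y
  proof -
    have "adj (W y) = adj (V y) ** (U y ** ?D y) ** ?D' y"
      by (simp add: W_def adj_mult inv(1)[OF y] flip: matrix_mul_assoc)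
    also have "U y ** ?D y = V y ** \<epsilon> y"
      using fac[OF y] fac'[OF y] by simp
    also have "adj (V y) ** (V y ** \<epsilon> y) ** ?D' y = (adj (V y) ** V y) ** \<epsilon> y ** ?D' y"
      by (simp add: matrix_mul_assoc)
    finally show ?thesis by (simp add: unit[OF y])
  qed
  \<comment> \<open>This expression supplies the continuity of the inverse of
    \<open>\<epsilon>\<close>, needed to multiply its Fourier series.\<close>
  have W3: "matrix_inv (\<epsilon> y) = ?D' y ** W y" if y: "norm y = 1" for y
    by (simp add: W1[OF y] matrix_mul_assoc inv(2)[OF y])
  have Ucont: "continuous_on UNIV (\<lambda>\<theta>. U (cis \<theta>) $ a $ b)" and Vcont: "continuous_on UNIV (\<lambda>\<theta>. V (cis \<theta>) $ a $ b)" for a b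
    using U V by (auto simp: based_loops_def intro: smooth_loop_continuous)
  have Wcont: "continuous_on UNIV (\<lambda>\<theta>. W (cis \<theta>) $ a $ b)" for a b
    unfolding W_def adj_def matrix_matrix_mult_def by (auto intro!: continuous_intros Ucont Vcont)
  have Dcont: "continuous_on UNIV (\<lambda>\<theta>. ?D' (cis \<theta>) $ a $ b)" for a b
    by (rule smooth_loop_continuous[OF smooth_poly_loop])
  have "continuous_on UNIV (\<lambda>\<theta>. matrix_inv (\<epsilon> (cis \<theta>)) $ a $ b)" for a b
    by (simp add: W3 matrix_matrix_mult_def) (intro continuous_intros Wcont Dcont)
  moreover have "continuous_on UNIV (\<lambda>\<theta>. \<epsilon> (cis \<theta>) $ a $ b)" for a b
    using \<epsilon> by (auto simp: loops_plus_def loops_GL_def intro: smooth_loop_continuous)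
  ultimately have nf: "neg_free (\<lambda>\<theta>. matrix_inv (\<epsilon> (cis \<theta>)) $ a $ b)" "neg_free (\<lambda>\<theta>. \<epsilon> (cis \<theta>) $ a $ b)" for a b
    using \<epsilon> unfolding neg_free_def loops_plus_def fourier_coeff_eq_0_iff by auto
  have nf1: "neg_free (\<lambda>\<theta>. W (cis \<theta>) $ a $ b)" for a b
    using neg_free_poly_loop_mult[where F = "\<lambda>c \<theta>. matrix_inv (\<epsilon> (cis \<theta>)) $ c $ b"
        and N = N and A = A and a = a, OF nf(1)] by (simp add: W1 matrix_matrix_mult_def)
  have nf2: "neg_free (\<lambda>\<theta>. cnj (W (cis \<theta>) $ a $ b))" for a b
  proof -
    have "cnj (W (cis \<theta>) $ a $ b) = (\<epsilon> (cis \<theta>) ** ?D' (cis \<theta>)) $ b $ a" for \<theta>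
      using W2[of "cis \<theta>"] by (simp add: adj_def vec_eq_iff)
    then have "(\<lambda>\<theta>. cnj (W (cis \<theta>) $ a $ b)) = (\<lambda>\<theta>. \<Sum>c\<in>UNIV. \<Sum>m\<le>N'. cis \<theta> ^ m * A' m $ c $ a * \<epsilon> (cis \<theta>) $ b $ c)"
      by (simp add: fun_eq_iff matrix_matrix_mult_def poly_loop_nth sum_distrib_left mult_ac)
    moreover have "neg_free (\<lambda>\<theta>. \<Sum>c\<in>UNIV. \<Sum>m\<le>N'. cis \<theta> ^ m * A' m $ c $ a * \<epsilon> (cis \<theta>) $ b $ c)"
      by (intro neg_free_sum neg_free_mult nf)
    ultimately show ?thesis by simp
  qed
  have "W x $ a $ b = W 1 $ a $ b" for a b
  proof (rule fourier_constant[OF Wcont _ x])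
    fix m :: int assume "m \<noteq> 0"
    then consider "m > 0" | "m < 0" by linarith
    then show "integral {0..2*pi} (\<lambda>\<theta>. W (cis \<theta>) $ a $ b * cis (of_int m * \<theta>)) = 0"
    proof cases
      case 1
      then show ?thesis using nf1[of a b] by (auto simp: neg_free_def dest!: spec[of _ "- m"])
    next
      case 2
      have "integral {0..2*pi} (\<lambda>\<theta>. cnj (W (cis \<theta>) $ a $ b) * cis (- of_int m * \<theta>)) = 0"
        using nf2[of a b] 2 by (simp add: neg_free_def)
      then have "cnj (integral {0..2*pi} (\<lambda>\<theta>. W (cis \<theta>) $ a $ b * cis (of_int m * \<theta>))) = 0"
        by (simp add: Henstock_Kurzweil_Integration.integral_cnj cis_cnj)
      then show ?thesis by simp
    qed
  qed
  then have "W x = W 1" by (simp add: vec_eq_iff)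
  also have "W 1 = mat 1"
    using U V by (simp add: W_def based_loops_def adj_mat)
  finally have "U x ** (adj (U x) ** V x) = U x" by (simp add: W_def)
  then show ?thesis by (simp add: matrix_mul_assoc unit[OF x] V_def)
qed

section \<open>Assembly: all points of the sphere, the deformed array and the flow\<close>

section \<open>Passing to the limit in the loop parameter\<close>

text \<open>Discrete Fourier inversion: N + 1 roots of unity separate the exponents 0, ...,
  N.\<close>

lemma poly_loop_coeff:
  assumes "m \<le> N"
  shows "mat (1 / of_nat (Suc N)) ** (\<Sum>l<Suc N. mat (cnj (runity (Suc N) l) ^ m) ** poly_loop N D (runity (Suc N) l)) = D m"
proof -
  have "(\<Sum>l<Suc N. mat (cnj (runity (Suc N) l) ^ m) ** poly_loop N D (runity (Suc N) l)) $ a $ b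
      = of_nat (Suc N) * D m $ a $ b" for a b
  proof -
    have "(\<Sum>l<Suc N. mat (cnj (runity (Suc N) l) ^ m) ** poly_loop N D (runity (Suc N) l)) $ a $ b
      = (\<Sum>l<Suc N. \<Sum>m'\<le>N. cnj (runity (Suc N) l) ^ m * runity (Suc N) l ^ m' * D m' $ a $ b)"
      unfolding sum_component
      by (rule sum.cong) (simp_all add: mat_mult_left poly_loop_nth sum_distrib_left mult.assoc)
    also have "\<dots> = (\<Sum>m'\<le>N. (\<Sum>l<Suc N. cnj (runity (Suc N) l) ^ m * runity (Suc N) l ^ m') * D m' $ a $ b)"
      unfolding sum_distrib_right by (rule sum.swap)
    also have "\<dots> = (\<Sum>m'\<le>N. if m = m' then of_nat (Suc N) * D m' $ a $ b else 0)"
    proof (rule sum.cong[OF refl])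
      fix m' assume "m' \<in> {..N}"
      then show "(\<Sum>l<Suc N. cnj (runity (Suc N) l) ^ m * runity (Suc N) l ^ m') * D m' $ a $ b
          = (if m = m' then of_nat (Suc N) * D m' $ a $ b else 0)"
        using sum_runity_cnj[of m "Suc N" m'] assms by (simp del: sum.lessThan_Suc of_nat_Suc)
    qed
    also have "\<dots> = of_nat (Suc N) * D m $ a $ b"
      using assms by simp
    finally show ?thesis .
  qed
  then show ?thesis
    by (simp add: vec_eq_iff mat_mult_left del: sum.lessThan_Suc of_nat_Suc)
qed

lemma tendsto_poly_loop:
  assumes "\<And>m. m \<le> N \<Longrightarrow> ((\<lambda>z. A z m) \<longlongrightarrow> A0 m) F"
  shows "((\<lambda>z. poly_loop N (A z) x) \<longlongrightarrow> poly_loop N A0 x) F"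
  unfolding poly_loop_def by (intro tendsto_sum tendsto_matrix_mult tendsto_const assms) auto

text \<open>The coefficients are fixed linear combinations of N + 1 values, so they converge
  although \<open>D\<close> is given separately for each z. The sample points are nonzero, which
  allows x = 0 to be left out.\<close>

lemma poly_loop_limit:
  fixes f :: "complex \<Rightarrow> 'x \<Rightarrow> complex^'n^'n"
  assumes "F \<noteq> bot" and lim: "\<And>x. x \<noteq> 0 \<Longrightarrow> (f x \<longlongrightarrow> L x) F"
    and poly: "\<forall>\<^sub>F z in F. \<exists>D. \<forall>x. x \<noteq> 0 \<longrightarrow> f x z = poly_loop N D x"
  shows "\<exists>A. \<forall>x. x \<noteq> 0 \<longrightarrow> L x = poly_loop N A x"
proof -
  let ?\<omega> = "runity (Suc N)"
  define A where "A h m = mat (1 / of_nat (Suc N)) ** (\<Sum>l<Suc N. mat (cnj (?\<omega> l) ^ m) ** h (?\<omega> l))"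
    for h :: "complex \<Rightarrow> complex^'n^'n" and m
  have nz: "?\<omega> l \<noteq> 0" for l using norm_runity[of "Suc N" l] by (metis norm_zero zero_neq_one)
  have "L x = poly_loop N (A L) x" if x: "x \<noteq> 0" for x
  proof (rule tendsto_unique[OF assms(1) lim[OF x]])
    have "((\<lambda>z. A (\<lambda>y. f y z) m) \<longlongrightarrow> A L m) F" for m
      unfolding A_def by (intro tendsto_matrix_mult tendsto_sum tendsto_const lim nz)
    then have "((\<lambda>z. poly_loop N (A (\<lambda>y. f y z)) x) \<longlongrightarrow> poly_loop N (A L) x) F"
      by (rule tendsto_poly_loop)
    moreover have "\<forall>\<^sub>F z in F. poly_loop N (A (\<lambda>y. f y z)) x = f x z"
      using poly
    proof eventually_elim
      case (elim z)
      then obtain D where D: "\<And>x. x \<noteq> 0 \<Longrightarrow> f x z = poly_loop N D x" by blast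
      have "A (\<lambda>y. f y z) m = D m" if "m \<le> N" for m
        unfolding A_def D[OF nz] by (rule poly_loop_coeff[OF that])
      then show ?case by (simp add: D[OF x] poly_loop_def)
    qed
    ultimately show "(f x \<longlongrightarrow> poly_loop N (A L) x) F"
      by (rule Lim_transform_eventually)
  qed
  then show ?thesis by blast
qed

lemma tendsto_Phi_rev:
  fixes P :: "'x \<Rightarrow> nat \<Rightarrow> complex^'n^'n"
  assumes "\<And>m. m \<in> {1..i} \<Longrightarrow> ((\<lambda>z. P z m) \<longlongrightarrow> p m) F"
  shows "((\<lambda>z. Phi (rev (plist (P z) i)) x) \<longlongrightarrow> Phi (rev (plist p i)) x) F"
  using assms
proof (induction i)
  case (Suc i)
  have "((\<lambda>z. P z (Suc i) + mat x ** (mat 1 - P z (Suc i))) \<longlongrightarrow> p (Suc i) + mat x ** (mat 1 - p (Suc i))) F"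
    by (intro tendsto_add tendsto_matrix_mult tendsto_diff tendsto_const Suc.prems) auto
  then show ?case
    using Suc by (simp add: plist_Suc) (intro tendsto_matrix_mult; simp)
qed simp

section \<open>The deformed array\<close>

lemma sphere_filter_eventually_nhds:
  assumes "\<forall>\<^sub>F z in sphere_filter p. P z"
  shows "\<forall>\<^sub>F z in sphere_filter p. \<forall>\<^sub>F u in nhds z. P u"
proof (cases p)
  case (Some z0)
  then have "\<forall>\<^sub>F z in at z0. P z" using assms by (simp add: sphere_filter_def)
  from eventually_at_imp_eventually_nhd[OF this]
  have "\<forall>\<^sub>F z in at z0. \<forall>\<^sub>F u in nhds z. P u"
    by (rule eventually_mono) (simp add: eventually_nhds_conv_at)
  then show ?thesis using Some by (simp add: sphere_filter_def)
next
  case None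
  then obtain b where b: "\<And>z. b \<le> norm z \<Longrightarrow> P z"
    using assms by (auto simp: sphere_filter_def eventually_at_infinity)
  have "\<forall>\<^sub>F u in nhds z. P u" if "b + 1 \<le> norm z" for z
  proof -
    have "open {u::complex. b < norm u}" by (intro open_Collect_less continuous_intros)
    then have "\<forall>\<^sub>F u in nhds z. u \<in> {u. b < norm u}"
      using that by (intro eventually_nhds_in_open) auto
    then show ?thesis by (rule eventually_mono) (use b in auto)
  qed
  then have "\<forall>\<^sub>F z in at_infinity. \<forall>\<^sub>F u in nhds z. P u"
    unfolding eventually_at_infinity by blast
  then show ?thesis using None by (simp add: sphere_filter_def)
qed

text \<open>The exceptional set is sparse in the plane and could accumulate at infinity. Meromorphy
  there leaves only the alternative that f is nonzero near infinity, which a finite point of large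
  modulus refutes.\<close>

lemma mero_sphere_vanish:
  assumes "mero_sphere f" "\<forall>\<^sub>\<approx>z\<in>UNIV. f z = 0"
  shows "\<forall>\<^sub>F z in sphere_filter p. f z = 0"
proof -
  have at: "\<forall>\<^sub>F z in at z0. f z = 0" for z0
    by (rule eventually_cosparse_imp_eventually_at[OF assms(2)]) simp
  show ?thesis
  proof (cases p)
    case (Some z0)
    then show ?thesis using at by (simp add: sphere_filter_def)
  next
    case None
    have mer: "(\<lambda>w. f (chart p w)) meromorphic_on {0}" by (rule mero_sphere_chart[OF assms(1)])
    show ?thesis
    proof (rule ccontr)
      assume "\<not> ?thesis"
      then have "\<not> (\<forall>\<^sub>F w in at 0. f (chart p w) = 0)" by (simp add: eventually_sphere_filter)
      with meromorphic_pivot[of "{()}" "\<lambda>_ w. f (chart p w)"] mer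
      have "\<forall>\<^sub>F w in at 0. f (chart p w) \<noteq> 0" by auto
      then have "\<forall>\<^sub>F z in sphere_filter p. f z \<noteq> 0" by (simp add: eventually_sphere_filter)
      then have "\<forall>\<^sub>F z in at_infinity. f z \<noteq> 0" using None by (simp add: sphere_filter_def)
      then obtain b where b: "\<And>z. b \<le> norm z \<Longrightarrow> f z \<noteq> 0"
        by (auto simp: eventually_at_infinity)
      define z0 :: complex where "z0 = of_real (\<bar>b\<bar> + 1)"
      have "\<forall>\<^sub>F u in at z0. u \<in> {u. b < norm u}"
        by (intro eventually_at_in_open' open_Collect_less continuous_intros) (auto simp: z0_def)
      with at[of z0] have "\<forall>\<^sub>F u in at z0. False"
      proof eventually_elim
        case (elim u)
        then show ?case using b[of u] by auto
      qed
      then show False by (simp add: at_neq_bot)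
    qed
  qed
qed

lemma higher_deriv_sum_at:
  assumes "finite S" "\<And>s. s \<in> S \<Longrightarrow> f s analytic_on {z}"
  shows "(deriv ^^ k) (\<lambda>w. \<Sum>s\<in>S. c s * f s w) z = (\<Sum>s\<in>S. c s * (deriv ^^ k) (f s) z)"
  using assms
proof (induction S)
  case empty
  then show ?case by (induction k) simp_all
next
  case (insert s S)
  have "(deriv ^^ k) (\<lambda>w. c s * f s w + (\<Sum>s\<in>S. c s * f s w)) z =
      (deriv ^^ k) (\<lambda>w. c s * f s w) z + (deriv ^^ k) (\<lambda>w. \<Sum>s\<in>S. c s * f s w) z"
    by (rule higher_deriv_add_at) (use insert in \<open>auto intro!: analytic_intros\<close>)
  also have "(deriv ^^ k) (\<lambda>w. c s * f s w) z = c s * (deriv ^^ k) (f s) z"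
    by (rule higher_deriv_cmult') (use insert in auto)
  finally show ?case using insert by simp
qed

lemma deform_mero:
  assumes "\<forall>l<r. \<forall>j\<in>{1..J}. mero_sphere_vec (H l j)"
  shows "\<forall>l<r. \<forall>j\<in>{1..J}. mero_sphere_vec (deform d r t H l j)"
proof (intro allI ballI impI)
  fix l j assume l: "l < r" and j: "j \<in> {1..J}"
  have H: "(\<lambda>z. H s j z $ a) meromorphic_on UNIV" "(\<lambda>w. H s j (1 / w) $ a) meromorphic_on {0}" if "s \<le> l" for s a
    using assms j l that by (auto simp: mero_sphere_vec_def mero_sphere_def)
  show "mero_sphere_vec (deform d r t H l j)"
    unfolding mero_sphere_vec_def mero_sphere_def deform_def Let_def
    by (cases "1 \<le> j \<and> j \<le> d r") (auto intro!: meromorphic_intros H)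
qed

text \<open>The index \<open>k\<close> attached to a column only contributes a nonzero scalar factor.\<close>

definition deform_scale :: "(nat \<Rightarrow> nat) \<Rightarrow> nat \<Rightarrow> real \<Rightarrow> nat \<Rightarrow> complex" where
  "deform_scale d r t j = (if j \<le> d r
     then of_real t powi (- int (THE k. k < r \<and> d k + 1 \<le> j \<and> j \<le> d (Suc k))) else 1)"

lemma deform_scale_nonzero: "t > 0 \<Longrightarrow> deform_scale d r t j \<noteq> 0"
  by (simp add: deform_scale_def power_int_eq_0_iff)

text \<open>Splitting t^(s - k) as t^(-k) t^s shows that a column up to d r is a scalar times
  \<open>column_rescale\<close> of the original, a constant combination that commutes with
  derivatives where the entries are analytic. For the columns beyond d r both sides vanish.\<close>

lemma deform_derivatives:
  fixes H :: "'n::finite array"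
  assumes t: "t > 0"
    and mero: "\<forall>l<r. \<forall>j\<in>{1..J}. mero_sphere_vec (H l j)"
    and vanish: "\<And>l j. l < r \<Longrightarrow> j \<in> {1..J} \<Longrightarrow> d r < j \<Longrightarrow> \<forall>\<^sub>\<approx>z\<in>UNIV. H l j z = 0"
  shows "\<forall>\<^sub>F z in sphere_filter p. \<forall>l<r. \<forall>j\<in>{1..J}. \<forall>k.
    jets (deform d r t H) z k l j = deform_scale d r t j *s column_rescale (of_real t) (\<lambda>l. jets H z k l j) l"
proof -
  have an: "\<forall>\<^sub>F z in sphere_filter p. \<forall>l\<in>{..<r}. \<forall>j\<in>{1..J}. \<forall>a\<in>UNIV. (\<lambda>z. H l j z $ a) analytic_on {z}"
    using mero by (intro eventually_ball_finite ballI mero_sphere_eventually_analytic) (auto simp: mero_sphere_vec_def)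
  have "\<forall>\<^sub>F z in sphere_filter p. H l j z $ a = 0" if "l < r" "j \<in> {1..J}" "d r < j" for l j a
  proof (rule mero_sphere_vanish)
    show "mero_sphere (\<lambda>z. H l j z $ a)" using mero that by (auto simp: mero_sphere_vec_def)
    show "\<forall>\<^sub>\<approx>z\<in>UNIV. H l j z $ a = 0"
      by (rule eventually_mono[OF vanish[OF that]]) simp
  qed
  \<comment> \<open>Derivatives at z depend on a neighbourhood, so vanishing at z alone would not be
    enough.\<close>
  then have "\<forall>\<^sub>F z in sphere_filter p. \<forall>\<^sub>F u in nhds z. H l j u $ a = 0" if "l < r" "j \<in> {1..J}" "d r < j" for l j a
    using sphere_filter_eventually_nhds that by blast
  then have van: "\<forall>\<^sub>F z in sphere_filter p. \<forall>l\<in>{..<r}. \<forall>j\<in>{1..J}. \<forall>a\<in>UNIV. d r < j \<longrightarrow> (\<forall>\<^sub>F u in nhds z. H l j u $ a = 0)"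
    by (intro eventually_ball_finite ballI) auto
  show ?thesis
    using an van
  proof eventually_elim
    case (elim z)
    show ?case
    proof (intro allI ballI impI)
      fix l j k assume l: "l < r" and j: "j \<in> {1..J}"
      show "jets (deform d r t H) z k l j = deform_scale d r t j *s column_rescale (of_real t) (\<lambda>l. jets H z k l j) l"
      proof (cases "j \<le> d r")
        case True
        define c where "c s = of_nat (l choose s) * of_real t ^ s * (of_real t - 1 :: complex) ^ (l - s)" for s
        have "deform d r t H l j u = (\<Sum>s\<le>l. (deform_scale d r t j * c s) *s H s j u)" for u
        proof -
          have "of_nat (l choose s) * of_real t powi (int s - int k) * (of_real t - 1) ^ (l - s)
            = of_real t powi (- int k) * c s" for s k
            using t power_int_add[of "complex_of_real t" "- int k" "int s"]
            by (simp add: c_def mult_ac)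
          then show ?thesis
            using True j by (simp add: deform_def deform_scale_def Let_def atLeast0AtMost)
        qed
        then have "jets (deform d r t H) z k l j $ a = (deriv ^^ k) (\<lambda>u. \<Sum>s\<le>l. (deform_scale d r t j * c s) * H s j u $ a) z" for a
          by (simp add: jets_def vderiv_def)
        also have "\<dots> a = (\<Sum>s\<le>l. (deform_scale d r t j * c s) * (deriv ^^ k) (\<lambda>u. H s j u $ a) z)" for a
          by (rule higher_deriv_sum_at) (use elim(1) l j in auto)
        finally show ?thesis
          by (simp add: vec_eq_iff column_rescale_def jets_def vderiv_def c_def sum_distrib_left mult_ac)
      next
        case False
        have "jets H z k s j = 0" if "s \<le> l" for s
        proof -
          have "(deriv ^^ k) (\<lambda>u. H s j u $ a) z = (deriv ^^ k) (\<lambda>u. 0) z" for a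
            by (rule higher_deriv_cong_ev) (use elim(2) that l j False in auto)
          moreover have "(deriv ^^ k) (\<lambda>u. 0) = (\<lambda>u. 0 :: complex)" by (induction k) simp_all
          ultimately show ?thesis by (simp add: jets_def vderiv_def vec_eq_iff)
        qed
        then have "column_rescale (of_real t) (\<lambda>l. jets H z k l j) l = 0"
          by (simp add: column_rescale_def)
        moreover have "jets (deform d r t H) z k l j = 0"
        proof -
          have "deform d r t H l j = (\<lambda>u. 0)" using False by (simp add: deform_def fun_eq_iff)
          moreover have "(deriv ^^ k) (\<lambda>u. 0) = (\<lambda>u. 0 :: complex)" by (induction k) simp_all
          ultimately show ?thesis by (simp add: jets_def vderiv_def vec_eq_iff)
        qed
        ultimately show ?thesis by simp
      qed
    qed
  qed
qed

section \<open>The flow of the extended solution\<close>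

definition bundle_list :: "nat \<Rightarrow> 'n::finite array \<Rightarrow> nat \<Rightarrow> rsphere \<Rightarrow> (complex^'n^'n) list" where
  "bundle_list J H r p = plist (\<lambda>m. bundle_proj J H m p) r"

lemma Phi_eq_mprod: "Phi Ps x = mprod (map (\<lambda>P. P + mat x ** (mat 1 - P)) Ps)"
  by (induction Ps) (simp_all add: mprod_def)

lemma Phi_array_eq: "Phi_array r J H x p = Phi (bundle_list J H r p) x"
  by (simp add: Phi_array_def Phi_eq_mprod bundle_list_def plist_def o_def)

lemma phi_array_eq:
  fixes H :: "'n::finite array"
  shows "phi_array Q r J H p = Q ** Phi_array r J H (-1) p"
proof -
  have "P - (mat 1 - P) = P + mat (-1) ** (mat 1 - P)" for P :: "complex^'n^'n"
    by (simp add: mat_mult_left vec_eq_iff)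
  then show ?thesis by (simp only: phi_array_def Phi_array_def)
qed

text \<open>The quotient is written with the reversed product at 1 / x as inverse, an expression
  that has a limit at every p. It is a polynomial in x at generic points, hence also in the
  limit.\<close>

lemma flow_poly:
  fixes H H' :: "'n::finite array"
  assumes mero: "\<forall>l<r. \<forall>j\<in>{1..J}. mero_sphere_vec (H l j)" "\<forall>l<r. \<forall>j\<in>{1..J}. mero_sphere_vec (H' l j)"
    and rel: "\<forall>\<^sub>F z in sphere_filter p. \<forall>l<r. \<forall>j\<in>{1..J}. \<forall>k. jets H' z k l j = c j *s column_rescale t (\<lambda>l. jets H z k l j) l"
    and c: "\<And>j. c j \<noteq> 0"
  shows "\<exists>A. \<forall>x. x \<noteq> 0 \<longrightarrow> Phi (bundle_list J H r p) (t * x) = Phi (bundle_list J H' r p) x ** poly_loop r A x"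
proof -
  note B = bundle_structure[OF mero(1) order_refl] and B' = bundle_structure[OF mero(2) order_refl]
  define f where "f x z = Phi (rev (plist (bundle_at J H' z) r)) (inverse x) ** Phi (plist (bundle_at J H z) r) (t * x)" for x z
  define L where "L x = Phi (rev (bundle_list J H' r p)) (inverse x) ** Phi (bundle_list J H r p) (t * x)" for x
  have idem: "\<forall>P\<in>set (bundle_list J H' r p). P ** P = P"
    using B' by (auto simp: bundle_list_def set_plist)
  have "\<exists>A. \<forall>x. x \<noteq> 0 \<longrightarrow> L x = poly_loop r A x"
  proof (rule poly_loop_limit[OF sphere_filter_not_bot])
    show "(f x \<longlongrightarrow> L x) (sphere_filter p)" for x
      unfolding f_def[abs_def] L_def bundle_list_def
      using B B' by (intro tendsto_matrix_mult tendsto_Phi tendsto_Phi_rev) auto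
    have "\<forall>\<^sub>F z in sphere_filter p. frame_of (bundle_at J H z) (jets H z) J r" "\<forall>\<^sub>F z in sphere_filter p. frame_of (bundle_at J H' z) (jets H' z) J r"
      using B B' by auto
    then show "\<forall>\<^sub>F z in sphere_filter p. \<exists>D. \<forall>x. x \<noteq> 0 \<longrightarrow> f x z = poly_loop r D x"
      using rel
    proof eventually_elim
      case (elim z)
      obtain D where D: "\<And>x. Phi (plist (bundle_at J H z) r) (t * x) = Phi (plist (bundle_at J H' z) r) x ** poly_loop r D x"
        using Phi_flow[OF elim(1,2), of c t] elim(3) c by blast
      have "f x z = poly_loop r D x" if "x \<noteq> 0" for x
        using Phi_rev_inverse(1)[OF frame_of_idem[OF elim(2) order_refl] that]
        by (simp add: f_def D matrix_mul_assoc)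
      then show ?case by blast
    qed
  qed
  then obtain A where A: "\<And>x. x \<noteq> 0 \<Longrightarrow> L x = poly_loop r A x" by blast
  have "Phi (bundle_list J H r p) (t * x) = Phi (bundle_list J H' r p) x ** poly_loop r A x" if "x \<noteq> 0" for x
    using Phi_rev_inverse(2)[OF idem that] by (simp add: L_def matrix_mul_assoc flip: A[OF that])
  then show ?thesis by blast
qed

lemma poly_loop_mult_right: "poly_loop N A x ** M = poly_loop N (\<lambda>m. A m ** M) x"
proof -
  have add: "(B + C) ** M = B ** M + C ** M" for B C
    by (simp add: matrix_eq matrix_vector_mult_add_rdistrib flip: matrix_vector_mul_assoc)
  have "(\<Sum>m\<in>X. mat (x ^ m) ** A m) ** M = (\<Sum>m\<in>X. mat (x ^ m) ** (A m ** M))" if "finite X" for X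
    using that by induction (simp_all add: add matrix_mul_assoc)
  then show ?thesis by (simp add: poly_loop_def)
qed

lemma poly_loop_mult_left: "M ** poly_loop N A x = poly_loop N (\<lambda>m. M ** A m) x"
proof -
  have "M ** (mat y ** B) = mat y ** (M ** B)" for y and B :: "complex^'a^'a"
    by (simp add: matrix_mul_assoc mat_commute)
  then show ?thesis by (simp add: poly_loop_def matrix_mult_sum)
qed

lemma poly_loop_scale: "poly_loop N A (t * x) = poly_loop N (\<lambda>m. mat (t ^ m) ** A m) x"
proof -
  have "mat ((t * x) ^ m) ** B = mat (x ^ m) ** (mat (t ^ m) ** B)" for m and B :: "complex^'a^'a"
    by (simp add: matrix_mul_assoc mat_mult_mat power_mult_distrib mult.commute)
  then show ?thesis by (simp add: poly_loop_def)
qed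

text \<open>The quotient of the two loops and its inverse are both polynomial, the latter through
  the parameter 1 / t. The quotient therefore lies in \<Lambda>_+, and the loop of the deformed
  array is the unitary factor.\<close>

theorem flow_eq_deform:
  fixes H :: "'n::finite array"
  assumes t: "t > 0"
    and mero: "\<forall>l<r. \<forall>j\<in>{1..J}. mero_sphere_vec (H l j)"
    and vanish: "\<And>l j. l < r \<Longrightarrow> j \<in> {1..J} \<Longrightarrow> d r < j \<Longrightarrow> \<forall>\<^sub>\<approx>z\<in>UNIV. H l j z = 0"
    and \<zeta>: "norm \<zeta> = 1"
  shows "flow t (Phi_array r J H) \<zeta> p = Phi_array r J (deform d r t H) \<zeta> p"
proof -
  define H' where "H' = deform d r t H"
  define \<tau> where "\<tau> = complex_of_real t"
  have \<tau>: "\<tau> \<noteq> 0" using t by (simp add: \<tau>_def)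
  let ?c = "deform_scale d r t"
  let ?\<Phi> = "Phi (bundle_list J H r p)" and ?\<Phi>' = "Phi (bundle_list J H' r p)"
  have mero': "\<forall>l<r. \<forall>j\<in>{1..J}. mero_sphere_vec (H' l j)"
    unfolding H'_def by (rule deform_mero[OF mero])
  have rel: "\<forall>\<^sub>F z in sphere_filter p. \<forall>l<r. \<forall>j\<in>{1..J}. \<forall>k. jets H' z k l j = ?c j *s column_rescale \<tau> (\<lambda>l. jets H z k l j) l"
    unfolding H'_def \<tau>_def by (rule deform_derivatives[OF t mero vanish])
  have rel': "\<forall>\<^sub>F z in sphere_filter p. \<forall>l<r. \<forall>j\<in>{1..J}. \<forall>k. jets H z k l j = (1 / ?c j) *s column_rescale (1 / \<tau>) (\<lambda>l. jets H' z k l j) l"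
    using rel
  proof eventually_elim
    case (elim z)
    then show ?case
      using deform_scale_nonzero[OF t] \<tau>
      by (intro allI ballI impI column_rescale_relation_inverse[of r J "jets H' z" ?c \<tau> "jets H z"]) auto
  qed
  obtain A where A: "\<And>x. x \<noteq> 0 \<Longrightarrow> ?\<Phi> (\<tau> * x) = ?\<Phi>' x ** poly_loop r A x"
    using flow_poly[OF mero mero' rel] deform_scale_nonzero[OF t] by blast
  obtain A' where A': "\<And>x. x \<noteq> 0 \<Longrightarrow> ?\<Phi>' (1 / \<tau> * x) = ?\<Phi> x ** poly_loop r A' x"
    using flow_poly[OF mero' mero rel'] deform_scale_nonzero[OF t] by auto
  \<comment> \<open>The reverse quotient is needed at \<lambda> rather than at \<lambda> / \<tau>,
    so \<open>A'\<close> is evaluated at \<tau> \<lambda> and its coefficients absorb the powers of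
    \<tau>.\<close>
  define A'' where "A'' m = mat (\<tau> ^ m) ** A' m" for m
  have A'': "?\<Phi>' x = ?\<Phi> (\<tau> * x) ** poly_loop r A'' x" if "x \<noteq> 0" for x
    using A'[of "\<tau> * x"] \<tau> that by (simp add: A''_def[abs_def] flip: poly_loop_scale)
  have idem: "\<forall>P\<in>set (bundle_list J G r p). P ** P = P" "\<forall>P\<in>set (bundle_list J G r p). adj P = P"
    if "\<forall>l<r. \<forall>j\<in>{1..J}. mero_sphere_vec (G l j)" for G :: "'n array"
    using bundle_structure[OF that order_refl] by (auto simp: bundle_list_def set_plist)
  note inv = Phi_rev_inverse[OF idem(1)[OF mero]] and inv' = Phi_rev_inverse[OF idem(1)[OF mero']]
  have AA: "poly_loop r A x ** poly_loop r A'' x = mat 1" if x: "x \<noteq> 0" for x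
  proof -
    have "?\<Phi>' x ** (poly_loop r A x ** poly_loop r A'' x) = ?\<Phi>' x"
      using A[OF x] A''[OF x] by (simp add: matrix_mul_assoc)
    then have "(Phi (rev (bundle_list J H' r p)) (inverse x) ** ?\<Phi>' x) ** (poly_loop r A x ** poly_loop r A'' x)
        = Phi (rev (bundle_list J H' r p)) (inverse x) ** ?\<Phi>' x"
      by (simp flip: matrix_mul_assoc)
    then show ?thesis by (simp add: inv'(1)[OF x])
  qed
  then have AA': "poly_loop r A'' x ** poly_loop r A x = mat 1" if "x \<noteq> 0" for x
    using that by (simp add: matrix_left_right_inverse)
  \<comment> \<open>The normalizing factor of the action is constant in \<lambda>: its inverse is
    absorbed into the nonnegative factor, and \<open>M\<close> itself into the inverse of that
    factor.\<close>
  define M where "M = ?\<Phi> \<tau>"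
  define M' where "M' = matrix_inv M"
  have "invertible M"
    unfolding invertible_def M_def using inv[OF \<tau>] by blast
  then have M: "M ** M' = mat 1" "M' ** M = mat 1"
    unfolding M'_def by (simp_all add: matrix_inv_mult)
  define C where "C m = A m ** M'" for m
  define C' where "C' m = M ** A'' m" for m
  have C: "poly_loop r C x = poly_loop r A x ** M'" "poly_loop r C' x = M ** poly_loop r A'' x" for x
    by (simp_all add: C_def[abs_def] C'_def[abs_def] poly_loop_mult_right poly_loop_mult_left)
  have "iwasawa_u (act t ?\<Phi>) \<zeta> = ?\<Phi>' \<zeta>"
  proof (rule iwasawa_u_eq[where A = C and A' = C'])
    obtain D where "\<And>x. ?\<Phi>' x = poly_loop (length (bundle_list J H' r p)) D x"
      using Phi_poly_loop by blast
    then have "smooth_loop ?\<Phi>'"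
      using smooth_poly_loop[of "length (bundle_list J H' r p)" D] by (simp add: smooth_loop_cong)
    then show "?\<Phi>' \<in> based_loops"
      using Phi_unitary[OF idem[OF mero']] by (auto simp: based_loops_def Phi_1)
  next
    fix x :: complex assume "norm x = 1"
    then have x: "x \<noteq> 0" by auto
    have "act t ?\<Phi> x = ?\<Phi> (\<tau> * x) ** M'"
      by (simp add: act_def M'_def M_def \<tau>_def mult.commute)
    then show "act t ?\<Phi> x = ?\<Phi>' x ** poly_loop r C x"
      by (simp add: A[OF x] C matrix_mul_assoc)
    have "poly_loop r A x ** M' ** (M ** poly_loop r A'' x) = poly_loop r A x ** (M' ** M) ** poly_loop r A'' x"
      by (simp add: matrix_mul_assoc)
    then show "poly_loop r C x ** poly_loop r C' x = mat 1"
      by (simp add: C M AA[OF x])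
    have "M ** poly_loop r A'' x ** (poly_loop r A x ** M') = M ** (poly_loop r A'' x ** poly_loop r A x) ** M'"
      by (simp add: matrix_mul_assoc)
    then show "poly_loop r C' x ** poly_loop r C x = mat 1"
      by (simp add: C M AA'[OF x])
  qed (rule \<zeta>)
  then show ?thesis
    by (simp add: flow_def Phi_array_eq H'_def)
qed

theorem theorem3p1:
  fixes H :: "nat \<Rightarrow> nat \<Rightarrow> complex \<Rightarrow> complex^'n::finite"
    and Q :: "complex^'n^'n" and r J :: nat and d :: "nat \<Rightarrow> nat"
  assumes "is_array r J H" and "echelon r J d H"
    and "Q \<in> unitary_group"
    and "harmonic_map (phi_array Q r J H)"
    and "has_uniton_number (phi_array Q r J H) r"
  shows "\<forall>t::real. 0 < t \<and> t \<le> 1 \<longrightarrow>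
    (\<forall>\<zeta>\<in>sphere 0 1. \<forall>p.
       flow t (Phi_array r J H) \<zeta> p = Phi_array r J (deform d r t H) \<zeta> p) \<and>
    (\<forall>p. Q ** flow t (Phi_array r J H) (-1) p = phi_array Q r J (deform d r t H) p)"
proof -
  have mero: "\<forall>l<r. \<forall>j\<in>{1..J}. mero_sphere_vec (H l j)"
    using assms(1) by (simp add: is_array_def)
  \<comment> \<open>The echelon condition bounds row i by d (i + 1); monotonicity turns this into
    vanishing of every row beyond d r, where the deformed array is zero by definition.\<close>
  have mono: "d i \<le> d r" if "i \<le> r" for i
    using that
  proof (induction rule: inc_induct)
    case (step n)
    then show ?case using assms(2) le_trans unfolding echelon_def by blast
  qed simp
  have vanish: "\<forall>\<^sub>\<approx>z\<in>UNIV. H l j z = 0" if "l < r" "j \<in> {1..J}" "d r < j" for l j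
  proof -
    have "d (Suc l) < j" using mono[of "Suc l"] that by simp
    then show ?thesis using assms(2) that unfolding echelon_def by blast
  qed
  have flow: "flow t (Phi_array r J H) \<zeta> p = Phi_array r J (deform d r t H) \<zeta> p"
    if "0 < t" "norm \<zeta> = 1" for t \<zeta> p
    by (rule flow_eq_deform[OF that(1) mero vanish that(2)])
  \<comment> \<open>The second assertion is the case \<zeta> = -1 of the first.\<close>
  then show ?thesis by (auto simp: phi_array_eq)
qed

end
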